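(* Let $\mathcal{R}$ be a commutative ring containing a distinguished invertible element $q^{1/6}$, and let $X=(X_{ij})_{1\le i,j\le 3}$ be the standard quantum matrix of generators of the quantum group $\mathcal{O}_q(SL_3)$ over $\mathcal{R}$. Let $$\sigma_1=X_{11}+X_{22}+X_{33},\qquad \sigma_2=(X_{11}X_{22}-qX_{12}X_{21})+(X_{22}X_{33}-qX_{23}X_{32})+(X_{11}X_{33}-qX_{13}X_{31})$$ be the trace of $X$ and the sum of the principal $2$-by-$2$ quantum minors of $X$. If $q^{1/3}$ is a root of unity of order $N$ coprime to $6$, then the following identities hold in $\mathcal{O}_q(SL_3)$: $$P^{(N)}(\sigma_1,\sigma_2)=X_{11}^N+X_{22}^N+X_{33}^N,$$ $$P^{(N)}(\sigma_2,\sigma_1)=X_{11}^NX_{22}^N+X_{11}^NX_{33}^N+X_{22}^NX_{33}^N-X_{12}^NX_{21}^N-X_{13}^NX_{31}^N-X_{23}^NX_{32}^N.$$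
   Context: Integer powers of $q^{1/6}$ are written as fractional powers of $q$, so $q^{1/3}=(q^{1/6})^2$ and $q=(q^{1/6})^6$. The quantum group $\mathcal{O}_q(SL_3)$ is the quotient of the free associative unital $\mathcal{R}$-algebra on $X_{ij}$, $1\le i,j\le 3$, by the relations $X_{ij}X_{lm}=q^{-1}X_{lm}X_{ij}$ if $i>l,\ j=m$; $X_{ij}X_{lm}=q^{-1}X_{lm}X_{ij}$ if $i=l,\ j>m$; $X_{ij}X_{lm}=X_{lm}X_{ij}$ if $i<l,\ j>m$; $X_{ij}X_{lm}=X_{lm}X_{ij}-(q-q^{-1})X_{im}X_{lj}$ if $i>l,\ j>m$; together with the quantum determinant relation $1=\sum_{\sigma\in S_3}(-q)^{\ell(\sigma)}X_{\sigma(1)1}X_{\sigma(2)2}X_{\sigma(3)3}$, where $\ell(\sigma)$ is the number of inversions of $\sigma$. Power sum polynomial: in $\mathcal{R}[\lambda_1,\lambda_2,\lambda_3]/(\lambda_1\lambda_2\lambda_3-1)$ put $E_1=\lambda_1+\lambda_2+\lambda_3$ and $E_2=\lambda_1\lambda_2+\lambda_1\lambda_3+\lambda_2\lambda_3$ (these are algebraically independent). $P^{(N)}(e_1,e_2)$ is the unique polynomial in two variables with $P^{(N)}(E_1,E_2)=\lambda_1^N+\lambda_2^N+\lambda_3^N$. It has integer coefficients and satisfies $P^{(0)}=3$, $P^{(1)}=e_1$, $P^{(2)}=e_1^2-2e_2$, $P^{(N)}=e_1P^{(N-1)}-e_2P^{(N-2)}+P^{(N-3)}$ for $N\ge 3$.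 The elements $\sigma_1,\sigma_2$ commute in $\mathcal{O}_q(SL_3)$, so polynomials in two commuting variables can be evaluated on them.
   Formalization: "Root of unity of order N" is read as primitive: besides exact order N, the elements of each nontrivial subgroup generated by a power of q^{1/3} sum to 0. This is automatic in integral domains; with bare order N the claim fails, e.g. over Z[t]/(t^5-1) with q^{1/3}=t. *)

theory Defs
  imports
    "HOL-Algebra.QuotRing"
    "HOL-Algebra.Algebraic_Closure_Type"
    "HOL-Library.Poly_Mapping"
    "HOL-Computational_Algebra.Computational_Algebra"
begin


section \<open>Roots of unity of order \<open>N\<close>\<close>

text \<open>
  The base ring is an arbitrary commutative ring, possibly with zero divisors. There the mere
  minimality of the exponent \<open>N\<close> is too weak a notion: the class of \<open>t\<close> in
  \<open>\<int>[t]/(t^N - 1)\<close> has multiplicative order \<open>N\<close>, yet it specialises to \<open>1\<close>.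
  Hence we also ask that the elements of every nontrivial subgroup of the group generated by \<open>z\<close>
  sum to zero, as they do for complex roots of unity. Since these sums generate the kernel of
  \<open>\<int>[t] \<rightarrow> \<complex>\<close>, \<open>t \<mapsto> exp (2 \<pi> \<i> / N)\<close> (relations between roots of unity,
  Redei, de Bruijn, Schoenberg), this says that the \<open>N\<close>-th cyclotomic polynomial vanishes at \<open>z\<close>.
  In an integral domain the extra condition is automatic, see
  \<open>root_of_unity_of_order_idom\<close> below.
\<close>

definition root_of_unity_of_order :: "nat \<Rightarrow> 'a::comm_ring_1 \<Rightarrow> bool" where
  "root_of_unity_of_order N z \<longleftrightarrow>
     0 < N \<and> z ^ N = 1 \<and> (\<forall>k. 0 < k \<and> k < N \<longrightarrow> z ^ k \<noteq> 1) \<and>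
     (\<forall>d. d dvd N \<and> 1 < d \<longrightarrow> (\<Sum>j<d. (z ^ (N div d)) ^ j) = 0)"

lemma root_of_unity_of_order_idom:
  fixes z :: "'a::idom"
  shows "root_of_unity_of_order N z \<longleftrightarrow>
           0 < N \<and> z ^ N = 1 \<and> (\<forall>k. 0 < k \<and> k < N \<longrightarrow> z ^ k \<noteq> 1)"
proof -
  have "(\<Sum>j<d. (z ^ (N div d)) ^ j) = 0"
    if N: "0 < N" "z ^ N = 1" and min: "\<forall>k. 0 < k \<and> k < N \<longrightarrow> z ^ k \<noteq> 1"
      and d: "d dvd N" "1 < d" for d
  proof -
    let ?w = "z ^ (N div d)"
    have "0 < N div d" "N div d < N"
      using N(1) d by (auto elim!: dvdE)
    with min have "?w \<noteq> 1" by blast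
    moreover have "?w ^ d = 1"
      using N(2) d(1) by (simp flip: power_mult)
    ultimately show ?thesis
      using power_diff_1_eq[of ?w d] by simp
  qed
  then show ?thesis unfolding root_of_unity_of_order_def by blast
qed


section \<open>The power sum polynomials\<close>

text \<open>
  A polynomial in \<open>e\<^sub>1, e\<^sub>2\<close> is a \<open>'a poly poly\<close>: the outer variable is \<open>e\<^sub>2\<close>, the coefficients
  are polynomials in \<open>e\<^sub>1\<close>. Likewise \<open>R[\<lambda>\<^sub>1, \<lambda>\<^sub>2, \<lambda>\<^sub>3]\<close> is \<open>'a poly poly poly\<close>.
\<close>

definition eval2 ::
    "('a::zero \<Rightarrow> 'b::comm_ring_1) \<Rightarrow> 'a poly poly \<Rightarrow> 'b \<Rightarrow> 'b \<Rightarrow> 'b" where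
  "eval2 h P x y = (\<Sum>j\<le>degree P. \<Sum>i\<le>degree (coeff P j). h (coeff (coeff P j) i) * x ^ i * y ^ j)"

definition lam1 :: "'a::comm_ring_1 poly poly poly" where "lam1 = [:[:[:0, 1:]:]:]"
definition lam2 :: "'a::comm_ring_1 poly poly poly" where "lam2 = [:[:0, 1:]:]"
definition lam3 :: "'a::comm_ring_1 poly poly poly" where "lam3 = [:0, 1:]"

definition elem1 :: "'a::comm_ring_1 poly poly poly" where
  "elem1 = lam1 + lam2 + lam3"
definition elem2 :: "'a::comm_ring_1 poly poly poly" where
  "elem2 = lam1 * lam2 + lam1 * lam3 + lam2 * lam3"

text \<open>Equality in \<open>R[\<lambda>\<^sub>1, \<lambda>\<^sub>2, \<lambda>\<^sub>3]/(\<lambda>\<^sub>1\<lambda>\<^sub>2\<lambda>\<^sub>3 - 1)\<close> is divisibility of the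
  difference by \<open>\<lambda>\<^sub>1\<lambda>\<^sub>2\<lambda>\<^sub>3 - 1\<close>.\<close>

definition is_power_sum_poly :: "nat \<Rightarrow> 'a::comm_ring_1 poly poly \<Rightarrow> bool" where
  "is_power_sum_poly N P \<longleftrightarrow>
     lam1 * lam2 * lam3 - 1 dvd
       eval2 (\<lambda>c. [:[:[:c:]:]:]) P elem1 elem2 - (lam1 ^ N + lam2 ^ N + lam3 ^ N)"

definition power_sum_poly :: "nat \<Rightarrow> 'a::comm_ring_1 poly poly" where
  "power_sum_poly N = (THE P. is_power_sum_poly N P)"

subsection \<open>Existence, uniqueness and the recurrence\<close>

definition is_hom :: "('a::comm_ring_1 \<Rightarrow> 'b::comm_ring_1) \<Rightarrow> bool" where
  "is_hom h \<longleftrightarrow> h 1 = 1 \<and> (\<forall>a b. h (a + b) = h a + h b) \<and> (\<forall>a b. h (a * b) = h a * h b)"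

lemma is_homD:
  assumes "is_hom h"
  shows "h 1 = 1" "h (a + b) = h a + h b" "h (a * b) = h a * h b" "h 0 = 0"
    "h (- a) = - h a" "h (a - b) = h a - h b" "h (a ^ n) = h a ^ n" "h (sum f S) = (\<Sum>s\<in>S. h (f s))"
proof -
  show 1: "h 1 = 1" and 2: "h (a + b) = h a + h b" and 3: "h (a * b) = h a * h b" for a b
    using assms by (auto simp: is_hom_def)
  show 4: "h 0 = 0" using 2[of 0 0] by simp
  show 5: "h (- a) = - h a" for a using 2[of a "- a"] 4 by (simp add: eq_neg_iff_add_eq_0 add.commute)
  show "h (a - b) = h a - h b" using 2[of a "- b"] 5 by simp
  show "h (a ^ n) = h a ^ n" by (induction n) (auto simp: 1 3)
  show "h (sum f S) = (\<Sum>s\<in>S. h (f s))" by (induction S rule: infinite_finite_induct) (auto simp: 2 4)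
qed

lemma is_hom_poly:
  assumes h: "is_hom h"
  shows "is_hom (\<lambda>p. poly (map_poly h p) x)"
proof -
  note [simp] = is_homD[OF h]
  have pC: "poly (map_poly h (pCons a p)) x = h a + x * poly (map_poly h p) x" for a p
    by (simp add: map_poly_pCons)
  have add: "poly (map_poly h (p + r)) x = poly (map_poly h p) x + poly (map_poly h r) x" for p r
    by (induction p r rule: poly_induct2) (auto simp: pC algebra_simps)
  have smult: "poly (map_poly h (smult a r)) x = h a * poly (map_poly h r) x" for a r
    by (induction r) (auto simp: pC algebra_simps)
  have "poly (map_poly h (p * r)) x = poly (map_poly h p) x * poly (map_poly h r) x" for p r
    by (induction p) (auto simp: pC add smult algebra_simps)
  with add show ?thesis by (auto simp: is_hom_def)
qed

lemma eval2_conv: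
  assumes h: "is_hom h"
  shows "eval2 h P x y = poly (map_poly (\<lambda>c. poly (map_poly h c) x) P) y"
proof -
  have h0: "h 0 = 0" using h by (rule is_homD)
  have g0: "poly (map_poly h 0) x = 0" by simp
  have *: "poly (map_poly g p) t = (\<Sum>i\<le>degree p. g (coeff p i) * t ^ i)"
    if g: "g 0 = 0" for g :: "'c::comm_ring_1 \<Rightarrow> 'd::comm_ring_1" and p t
  proof -
    have "poly (map_poly g p) t = (\<Sum>i\<le>degree (map_poly g p). g (coeff p i) * t ^ i)"
      by (simp add: poly_altdef coeff_map_poly g)
    also have "\<dots> = (\<Sum>i\<le>degree p. g (coeff p i) * t ^ i)"
    proof (rule sum.mono_neutral_left)
      show "{..degree (map_poly g p)} \<subseteq> {..degree p}"
        by (simp add: map_poly_degree_leq)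
      show "\<forall>i\<in>{..degree p} - {..degree (map_poly g p)}. g (coeff p i) * t ^ i = 0"
        using coeff_eq_0[of "map_poly g p"] by (auto simp: coeff_map_poly g)
    qed simp
    finally show ?thesis .
  qed
  show ?thesis
    by (subst *) (simp_all add: *[of h, OF h0] eval2_def sum_distrib_right)
qed

lemma is_hom_eval2: "is_hom h \<Longrightarrow> is_hom (\<lambda>P. eval2 h P x y)"
  by (simp add: eval2_conv is_hom_poly)

lemma hom_eval2:
  assumes "is_hom g"
  shows "g (eval2 h P x y) = eval2 (\<lambda>c. g (h c)) P (g x) (g y)"
  by (simp add: eval2_def is_homD[OF assms])

lemma is_hom_const3: "is_hom (\<lambda>c. [:[:[:c::'a::comm_ring_1:]:]:])"
  by (auto simp: is_hom_def one_pCons)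

lemma is_power_sum_poly_0: "is_power_sum_poly 0 [:[:3:]:]"
  by (simp add: is_power_sum_poly_def eval2_def numeral_poly one_pCons)

lemma is_power_sum_poly_1: "is_power_sum_poly 1 [:[:0, 1:]:]"
  by (simp add: is_power_sum_poly_def eval2_conv[OF is_hom_const3] map_poly_pCons elem1_def
      flip: one_pCons)

lemma eval2_vars:
  fixes h :: "'a::comm_ring_1 \<Rightarrow> 'b::comm_ring_1"
  assumes "is_hom h"
  shows "eval2 h [:[:0, 1:]:] x y = x" "eval2 h [:0, 1:] x y = y"
  by (simp_all add: eval2_conv[OF assms] map_poly_pCons is_homD[OF assms] one_pCons)

lemma is_power_sum_poly_2:
  "is_power_sum_poly 2 ([:[:0, 1:]:] ^ 2 - 2 * [:0, 1:] :: 'a::comm_ring_1 poly poly)"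
proof -
  note H = is_hom_eval2[OF is_hom_const3, of elem1 elem2]
  have 2: "[:[:0, 1:]:] ^ 2 - 2 * [:0, 1:] = [:[:0, 1:]:] ^ 2 - [:0, 1:] - ([:0, 1:] :: 'a poly poly)"
    by (simp only: mult_2 diff_diff_add)
  show ?thesis
    unfolding is_power_sum_poly_def 2 is_homD[OF H] eval2_vars[OF is_hom_const3]
    by (simp add: elem1_def elem2_def power2_eq_square algebra_simps)
qed

lemma is_power_sum_poly_rec:
  fixes P0 P1 P2 :: "'a::comm_ring_1 poly poly"
  assumes "is_power_sum_poly N P0" "is_power_sum_poly (N + 1) P1" "is_power_sum_poly (N + 2) P2"
  shows "is_power_sum_poly (N + 3) ([:[:0, 1:]:] * P2 - [:0, 1:] * P1 + P0)"
proof -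
  note H = is_hom_eval2[OF is_hom_const3, of elem1 elem2]
  let ?e = "\<lambda>P. eval2 (\<lambda>c. [:[:[:c:]:]:]) P elem1 elem2 :: 'a poly poly poly"
  let ?p = "\<lambda>n. lam1 ^ n + lam2 ^ n + lam3 ^ n :: 'a poly poly poly"
  let ?r = "lam1 * lam2 * lam3 :: 'a poly poly poly"
  have newton: "?p (N + 3) = elem1 * ?p (N + 2) - elem2 * ?p (N + 1) + ?r * ?p N"
    by (simp add: elem1_def elem2_def algebra_simps power_add numeral_eq_Suc)
  have "?e ([:[:0, 1:]:] * P2 - [:0, 1:] * P1 + P0) - ?p (N + 3) =
      elem1 * (?e P2 - ?p (N + 2)) - elem2 * (?e P1 - ?p (N + 1)) + (?e P0 - ?p N)
        - (?r - 1) * ?p N"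
    unfolding newton
    by (simp only: is_homD[OF H] eval2_vars[OF is_hom_const3]) (simp add: algebra_simps)
  also have "?r - 1 dvd \<dots>"
    using assms unfolding is_power_sum_poly_def
    by (meson dvd_add dvd_diff dvd_mult dvd_triv_left)
  finally show ?thesis unfolding is_power_sum_poly_def .
qed

text \<open>Algebraic independence of \<open>E\<^sub>1, E\<^sub>2\<close>: substitute \<open>\<lambda>\<^sub>1 = X\<^sup>-\<^sup>1, \<lambda>\<^sub>2 = Y, \<lambda>\<^sub>3 = X Y\<^sup>-\<^sup>1\<close> and
  compare coefficients of the lowest power of \<open>X\<close>.\<close>

lemma eval2_inj:
  fixes P :: "'a::comm_ring_1 poly poly"
  assumes "lam1 * lam2 * lam3 - 1 dvd eval2 (\<lambda>c. [:[:[:c:]:]:]) P elem1 elem2"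
  shows "P = 0"
proof (rule ccontr)
  assume "P \<noteq> 0"
  define k :: "'a \<Rightarrow> 'a fls fls" where "k = (\<lambda>c. fls_const (fls_const c))"
  define y y' :: "'a fls" where "y = fls_X" and "y' = fls_X_inv"
  have yy: "y * y' = 1" "y' * y = 1" by (simp_all add: y_def y'_def fls_X_times_conv_shift)
  have XX: "fls_X * fls_X_inv = (1 :: 'a fls fls)"  by (simp add: fls_X_times_conv_shift)
  define a1 a2 a3 :: "'a fls fls"
    where "a1 = fls_X_inv" and "a2 = fls_const y" and "a3 = fls_X * fls_const y'"
  have a123: "a1 * a2 * a3 = 1"
  proof -
    have "a1 * a2 * a3 = (fls_X * fls_X_inv) * (fls_const y * fls_const y')"
      by (simp add: a1_def a2_def a3_def mult_ac)
    then show ?thesis by (simp only: XX fls_const_mult_const yy) simp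
  qed
  have hk: "is_hom k" by (simp add: is_hom_def k_def fls_plus_const)
  define f where "f = (\<lambda>F :: 'a poly poly poly. poly (map_poly (\<lambda>G. poly (map_poly
     (\<lambda>c. poly (map_poly k c) a1) G) a2) F) a3)"
  have hf: "is_hom f" unfolding f_def by (intro is_hom_poly hk)
  note fs = is_homD[OF hf]
  note ks = is_homD[OF hk]
  have flam: "f lam1 = a1" "f lam2 = a2" "f lam3 = a3"
    by (simp_all add: f_def lam1_def lam2_def lam3_def map_poly_pCons ks one_pCons)
  have fc: "f [:[:[:c:]:]:] = k c" for c
    by (simp add: f_def map_poly_pCons ks)
  define A B :: "'a fls fps"
    where "A = 1 + fps_const y * fps_X + fps_const y' * fps_X ^ 2"
      and "B = fps_const y + fps_const y' * fps_X + fps_X ^ 2"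
  have X'X: "fls_X_inv * fls_X = (1 :: 'a fls fls)" using XX by (simp add: mult.commute)
  have cyy: "fls_const y * fls_const y' = (1 :: 'a fls fls)"
    by (simp only: fls_const_mult_const yy) simp
  have A: "fps_to_fls A = 1 + fls_const y * fls_X + fls_const y' * (fls_X * fls_X)"
    by (simp add: A_def fps_to_fls_plus fls_times_fps_to_fls power2_eq_square)
  have B: "fps_to_fls B = fls_const y + fls_const y' * fls_X + fls_X * fls_X"
    by (simp add: B_def fps_to_fls_plus fls_times_fps_to_fls power2_eq_square)
  have fE1: "f elem1 = fls_X_inv * fps_to_fls A"
  proof -
    have "fls_X_inv * fps_to_fls A = fls_X_inv + fls_const y * (fls_X_inv * fls_X)
        + fls_const y' * ((fls_X_inv * fls_X) * fls_X)"
      unfolding A by (simp only: distrib_left mult_1_right mult_ac)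
    then show ?thesis
      unfolding X'X by (simp only: elem1_def fs flam a1_def a2_def a3_def mult_1_right mult_1)
        (simp only: mult.commute)
  qed
  have fE2: "f elem2 = fls_X_inv * fps_to_fls B"
  proof -
    have "fls_X_inv * fps_to_fls B = fls_X_inv * fls_const y + fls_const y' * (fls_X_inv * fls_X)
        + (fls_X_inv * fls_X) * fls_X"
      unfolding B by (simp only: distrib_left mult_ac)
    moreover have "f elem2 = fls_X_inv * fls_const y + fls_const y' * (fls_X_inv * fls_X)
        + (fls_const y * fls_const y') * fls_X"
      by (simp only: elem2_def fs flam a1_def a2_def a3_def mult_ac)
    ultimately show ?thesis by (simp only: X'X cyy)
  qed
  have "f (lam1 * lam2 * lam3 - 1) dvd f (eval2 (\<lambda>c. [:[:[:c:]:]:]) P elem1 elem2)"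
    using assms by (auto simp: dvd_def fs)
  then have "f (eval2 (\<lambda>c. [:[:[:c:]:]:]) P elem1 elem2) = 0"
    by (simp add: fs flam a123)
  then have ev: "eval2 k P (fls_X_inv * fps_to_fls A) (fls_X_inv * fps_to_fls B) = 0"
    by (simp add: hom_eval2[OF hf] fc fE1 fE2)
  define C where "C = (\<lambda>i j. coeff (coeff P j) i)"
  define T where "T = Sigma {..degree P} (\<lambda>j. {..degree (coeff P j)})"
  have finT: "finite T" by (simp add: T_def)
  define S where "S = {(j, i) \<in> T. C i j \<noteq> 0}"
  have finS: "finite S" using finT by (auto simp: S_def intro: finite_subset)
  have "(degree P, degree (lead_coeff P)) \<in> S"
    using \<open>P \<noteq> 0\<close> by (simp add: S_def T_def C_def)
  then have neS: "S \<noteq> {}" by auto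
  define n where "n = Max ((\<lambda>(j, i). i + j) ` S)"
  have "n \<in> (\<lambda>(j, i). i + j) ` S"
    unfolding n_def using finS neS by (intro Max_in) auto
  then obtain j0 i0 where ij0: "(j0, i0) \<in> S" "n = i0 + j0" by auto
  have le_n: "i + j \<le> n" if "(j, i) \<in> S" for i j
    unfolding n_def using that finS by (intro Max_ge) force+
  have coefn: "fls_nth (k (C i j) * (fls_X_inv * fps_to_fls A) ^ i * (fls_X_inv * fps_to_fls B) ^ j) (- int n)
      = (if i + j = n then fls_const (C i j) * y ^ j else 0)" if "(j, i) \<in> T" for i j
  proof (cases "C i j = 0")
    case True then show ?thesis by (simp add: ks)
  next
    case False
    with that have le: "i + j \<le> n" by (intro le_n) (simp add: S_def)
    have AB: "(A ^ i * B ^ j) $ 0 = y ^ j"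
      by (simp add: A_def B_def fps_nth_power_0)
    have "k (C i j) * (fls_X_inv * fps_to_fls A) ^ i * (fls_X_inv * fps_to_fls B) ^ j
        = fls_const (fls_const (C i j)) * (fls_X_inv ^ (i + j) * fps_to_fls (A ^ i * B ^ j))"
      by (simp add: k_def power_mult_distrib power_add fps_to_fls_power fls_times_fps_to_fls mult_ac)
    also have "\<dots> = fls_const (fls_const (C i j)) * fls_shift (int (i + j)) (fps_to_fls (A ^ i * B ^ j))"
      by (simp add: fls_X_inv_power_times_conv_shift)
    also have "fls_nth \<dots> (- int n) = fls_const (C i j) * fls_nth (fps_to_fls (A ^ i * B ^ j)) (int (i + j) - int n)"
      by (simp add: add.commute)
    also have "\<dots> = (if i + j = n then fls_const (C i j) * y ^ j else 0)"
      using le AB by (auto simp: nat_eq_iff)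
    finally show ?thesis .
  qed
  have "0 = fls_nth (eval2 k P (fls_X_inv * fps_to_fls A) (fls_X_inv * fps_to_fls B)) (- int n)"
    by (simp add: ev)
  also have "\<dots> = (\<Sum>(j, i)\<in>T. fls_nth (k (C i j) * (fls_X_inv * fps_to_fls A) ^ i
      * (fls_X_inv * fps_to_fls B) ^ j) (- int n))"
    unfolding eval2_def T_def C_def by (simp add: sum.Sigma fls_nth_sum split_def)
  also have "\<dots> = (\<Sum>(j, i)\<in>T. if i + j = n then fls_const (C i j) * y ^ j else 0)"
    by (intro sum.cong) (auto simp: coefn)
  finally have "0 = fls_nth (\<Sum>(j, i)\<in>T. if i + j = n then fls_const (C i j) * y ^ j else 0) (int j0)"
    by simp
  also have "\<dots> = (\<Sum>p\<in>T. if p = (j0, i0) then C i0 j0 else 0)"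
    unfolding fls_nth_sum
    by (intro sum.cong refl, clarsimp simp: split_def) (auto simp: y_def fls_X_power_nth ij0(2))
  also have "\<dots> = C i0 j0"
    using ij0(1) finT by (simp add: S_def)
  finally show False using ij0(1) by (simp add: S_def)
qed

lemma is_power_sum_poly_unique:
  assumes "is_power_sum_poly N P" "is_power_sum_poly N Q"
  shows "P = Q"
proof -
  have "eval2 (\<lambda>c. [:[:[:c:]:]:]) (P - Q) elem1 elem2 =
      (eval2 (\<lambda>c. [:[:[:c:]:]:]) P elem1 elem2 - (lam1 ^ N + lam2 ^ N + lam3 ^ N)) -
      (eval2 (\<lambda>c. [:[:[:c:]:]:]) Q elem1 elem2 - (lam1 ^ N + lam2 ^ N + lam3 ^ N))"
    by (simp add: is_homD[OF is_hom_eval2[OF is_hom_const3]])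
  also have "lam1 * lam2 * lam3 - 1 dvd \<dots>"
    using assms unfolding is_power_sum_poly_def by (rule dvd_diff)
  finally have "P - Q = 0" by (rule eval2_inj)
  then show ?thesis by simp
qed

lemma power_sum_poly_eqI: "is_power_sum_poly N P \<Longrightarrow> power_sum_poly N = P"
  unfolding power_sum_poly_def using is_power_sum_poly_unique by (intro the_equality) auto

lemma is_power_sum_poly_power_sum_poly:
  "is_power_sum_poly N (power_sum_poly N :: 'a::comm_ring_1 poly poly)"
proof -
  let ?P = "power_sum_poly :: nat \<Rightarrow> 'a poly poly"
  have "is_power_sum_poly N (?P N) \<and> is_power_sum_poly (N + 1) (?P (N + 1))
      \<and> is_power_sum_poly (N + 2) (?P (N + 2))"
  proof (induction N)
    case 0
    show ?case
      using is_power_sum_poly_0 is_power_sum_poly_1 is_power_sum_poly_2 power_sum_poly_eqI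
      by (metis add_0)
  next
    case (Suc N)
    then have "is_power_sum_poly (N + 3) ([:[:0, 1:]:] * ?P (N + 2) - [:0, 1:] * ?P (N + 1) + ?P N)"
      by (intro is_power_sum_poly_rec) auto
    then have "is_power_sum_poly (N + 3) (?P (N + 3))"
      by (metis power_sum_poly_eqI)
    with Suc show ?case by (simp add: numeral_eq_Suc)
  qed
  then show ?thesis by blast
qed

lemma power_sum_poly_rec:
  "power_sum_poly 0 = [:[:3:]:]"
  "power_sum_poly 1 = [:[:0, 1:]:]"
  "power_sum_poly 2 = [:[:0, 1:]:] ^ 2 - 2 * [:0, 1:]"
  "power_sum_poly (N + 3) =
     [:[:0, 1:]:] * power_sum_poly (N + 2) - [:0, 1:] * power_sum_poly (N + 1) + power_sum_poly N"
  by (intro power_sum_poly_eqI is_power_sum_poly_0 is_power_sum_poly_1 is_power_sum_poly_2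
      is_power_sum_poly_rec is_power_sum_poly_power_sum_poly)+


section \<open>The quantum group \<open>O\<^sub>q(SL\<^sub>3)\<close>\<close>

text \<open>The free algebra on \<open>'x\<close> is the monoid algebra of the free monoid on \<open>'x\<close>. Words form a new
  type, since a \<^class>\<open>monoid_add\<close> instance for lists would clash with other developments.\<close>

datatype 'x word = Word "'x list"

instantiation word :: (type) monoid_add
begin
definition zero_word :: "'x word" where "zero_word = Word []"
fun plus_word :: "'x word \<Rightarrow> 'x word \<Rightarrow> 'x word" where
  "plus_word (Word u) (Word v) = Word (u @ v)"
instance
proof
  fix a b c :: "'x word"
  show "a + b + c = a + (b + c)" by (cases a; cases b; cases c) simp
  show "0 + a = a" "a + 0 = a" by (cases a; simp add: zero_word_def)+
qed
end

datatype idx = I1 | I2 | I3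

primrec nat_of_idx :: "idx \<Rightarrow> nat" where
  "nat_of_idx I1 = 1" | "nat_of_idx I2 = 2" | "nat_of_idx I3 = 3"

instantiation idx :: linorder
begin
definition "i \<le> j \<longleftrightarrow> nat_of_idx i \<le> nat_of_idx j"
definition "i < j \<longleftrightarrow> nat_of_idx i < nat_of_idx j"
instance
proof
  fix i j :: idx
  show "i \<le> j \<Longrightarrow> j \<le> i \<Longrightarrow> i = j" by (cases i; cases j) (auto simp: less_eq_idx_def)
qed (auto simp: less_eq_idx_def less_idx_def)
end

type_synonym 'a free_alg = "(idx \<times> idx) word \<Rightarrow>\<^sub>0 'a"

definition free_const :: "'a::comm_ring_1 \<Rightarrow> 'a free_alg" where
  "free_const c = Poly_Mapping.single 0 c"

definition free_gen :: "idx \<Rightarrow> idx \<Rightarrow> 'a::comm_ring_1 free_alg" where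
  "free_gen i j = Poly_Mapping.single (Word [(i, j)]) 1"

definition inversions :: "(idx \<Rightarrow> idx) \<Rightarrow> nat" where
  "inversions s = card {(i, j). i < j \<and> s j < s i}"

definition unit_inv :: "'a::comm_ring_1 \<Rightarrow> 'a" where
  "unit_inv u = (THE v. u * v = 1)"

definition oq_relators :: "'a::comm_ring_1 \<Rightarrow> 'a free_alg set" where
  "oq_relators q =
     {free_gen i j * free_gen l m - free_const (unit_inv q) * free_gen l m * free_gen i j
        | i j l m. i > l \<and> j = m} \<union>
     {free_gen i j * free_gen l m - free_const (unit_inv q) * free_gen l m * free_gen i j
        | i j l m. i = l \<and> j > m} \<union>
     {free_gen i j * free_gen l m - free_gen l m * free_gen i j
        | i j l m. i < l \<and> j > m} \<union>
     {free_gen i j * free_gen l m -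
        (free_gen l m * free_gen i j
           - free_const (q - unit_inv q) * free_gen i m * free_gen l j)
        | i j l m. i > l \<and> j > m} \<union>
     {1 - (\<Sum>s | bij s. free_const ((- q) ^ inversions s) *
                         free_gen (s I1) I1 * free_gen (s I2) I2 * free_gen (s I3) I3)}"

definition oq_ideal :: "'a::comm_ring_1 \<Rightarrow> 'a free_alg set" where
  "oq_ideal q = Idl\<^bsub>ring_of_type_algebra\<^esub> (oq_relators q)"

definition Oq_SL3 :: "'a::comm_ring_1 \<Rightarrow> 'a free_alg set ring" where
  "Oq_SL3 q = ring_of_type_algebra Quot oq_ideal q"

definition oq_class :: "'a::comm_ring_1 \<Rightarrow> 'a free_alg \<Rightarrow> 'a free_alg set" where
  "oq_class q f = oq_ideal q +>\<^bsub>ring_of_type_algebra\<^esub> f"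

definition oq_const :: "'a::comm_ring_1 \<Rightarrow> 'a \<Rightarrow> 'a free_alg set" where
  "oq_const q c = oq_class q (free_const c)"

definition oq_gen :: "'a::comm_ring_1 \<Rightarrow> idx \<Rightarrow> idx \<Rightarrow> 'a free_alg set" where
  "oq_gen q i j = oq_class q (free_gen i j)"

lemma ring_Oq_SL3:
  fixes q :: "'a::comm_ring_1"
  shows "ring (Oq_SL3 q)"
proof -
  interpret F: ring "ring_of_type_algebra :: 'a free_alg ring"
  proof -
    have "\<exists>y. x + y = 0" for x :: "'a free_alg"
      using add.right_inverse by blast
    then show "ring (ring_of_type_algebra :: 'a free_alg ring)"
      unfolding ring_of_type_algebra_def using add.right_inverse
      by unfold_locales (auto simp: algebra_simps Units_def)
  qed
  have "ideal (oq_ideal q) ring_of_type_algebra"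
    unfolding oq_ideal_def by (rule F.genideal_ideal) (simp add: ring_of_type_algebra_def)
  then show ?thesis
    unfolding Oq_SL3_def by (rule ideal.quotient_is_ring)
qed

definition oq_minor2 :: "'a::comm_ring_1 \<Rightarrow> idx \<Rightarrow> idx \<Rightarrow> 'a free_alg set" where
  "oq_minor2 q i j =
     oq_gen q i i \<otimes>\<^bsub>Oq_SL3 q\<^esub> oq_gen q j j \<ominus>\<^bsub>Oq_SL3 q\<^esub>
     oq_const q q \<otimes>\<^bsub>Oq_SL3 q\<^esub> oq_gen q i j \<otimes>\<^bsub>Oq_SL3 q\<^esub> oq_gen q j i"

definition oq_sigma1 :: "'a::comm_ring_1 \<Rightarrow> 'a free_alg set" where
  "oq_sigma1 q = oq_gen q I1 I1 \<oplus>\<^bsub>Oq_SL3 q\<^esub> oq_gen q I2 I2 \<oplus>\<^bsub>Oq_SL3 q\<^esub> oq_gen q I3 I3"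

definition oq_sigma2 :: "'a::comm_ring_1 \<Rightarrow> 'a free_alg set" where
  "oq_sigma2 q =
     oq_minor2 q I1 I2 \<oplus>\<^bsub>Oq_SL3 q\<^esub> oq_minor2 q I2 I3 \<oplus>\<^bsub>Oq_SL3 q\<^esub> oq_minor2 q I1 I3"

text \<open>Meant for commuting \<open>x\<close> and \<open>y\<close>; powers of \<open>x\<close> are written to the left of powers of \<open>y\<close>.\<close>

definition oq_eval2 ::
    "'a::comm_ring_1 \<Rightarrow> 'a poly poly \<Rightarrow> 'a free_alg set \<Rightarrow> 'a free_alg set \<Rightarrow> 'a free_alg set" where
  "oq_eval2 q P x y =
     (\<Oplus>\<^bsub>Oq_SL3 q\<^esub>j\<in>{..degree P}. \<Oplus>\<^bsub>Oq_SL3 q\<^esub>i\<in>{..degree (coeff P j)}.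
        oq_const q (coeff (coeff P j) i) \<otimes>\<^bsub>Oq_SL3 q\<^esub> x [^]\<^bsub>Oq_SL3 q\<^esub> i \<otimes>\<^bsub>Oq_SL3 q\<^esub> y [^]\<^bsub>Oq_SL3 q\<^esub> j)"

end

theory Submission
  imports Defs
begin

text \<open>
  Let \<open>M\<close> be a quantum matrix over any ring and \<open>x\<^sub>1, x\<^sub>2, x\<^sub>3\<close> the generators of the quantum
  space. The elements \<open>Y\<^sub>i = \<Sum>\<^sub>j M\<^sub>i\<^sub>j x\<^sub>j\<close> satisfy the relations of the \<open>x\<^sub>i\<close>, and the sum
  \<open>h\<^sub>n\<close> of the coefficients of \<open>x\<^sup>a\<close> in \<open>Y\<^sup>a\<close> over \<open>|a| = n\<close> is the complete symmetric function
  of the formal eigenvalues of \<open>M\<close>: the quantum MacMahon theorem says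
  \<open>h\<^sub>n = \<sigma>\<^sub>1 h\<^sub>n\<^sub>-\<^sub>1 - \<sigma>\<^sub>2 h\<^sub>n\<^sub>-\<^sub>2 + \<sigma>\<^sub>3 h\<^sub>n\<^sub>-\<^sub>3\<close>. At a root of unity
  \<open>Y\<^sub>i\<^sup>N = \<Sum>\<^sub>j M\<^sub>i\<^sub>j\<^sup>N x\<^sub>j\<^sup>N\<close>, so \<open>h\<close> also satisfies, for large \<open>n\<close>, the recurrence with step
  \<open>N\<close> given by the trace \<open>D\<^sub>1\<close> and the sum \<open>D\<^sub>2\<close> of the principal minors of the matrix of \<open>N\<close>-th
  powers. The power sums \<open>p\<^sub>1, p\<^sub>2\<close> of the eigenvalues and of their pairwise products satisfy
  the same two linear equations, hence the Steinberg character
  \<open>h\<^sub>2\<^sub>N\<^sub>-\<^sub>2 h\<^sub>N\<^sub>-\<^sub>1 - h\<^sub>2\<^sub>N\<^sub>-\<^sub>1 h\<^sub>N\<^sub>-\<^sub>2\<close> annihilates \<open>D\<^sub>i - p\<^sub>i\<close>. It might be a zero divisor.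
  But \<open>M + diag(y\<^sub>1, 0, y\<^sub>3)\<close> is again a quantum matrix if \<open>y\<^sub>1, y\<^sub>3\<close> commute with \<open>M\<close> up to
  suitable powers of \<open>q\<close>, and for this matrix the Steinberg character has an invertible leading
  coefficient in \<open>y\<close>. So \<open>D\<^sub>i = p\<^sub>i\<close> holds there, and \<open>y = 0\<close> gives the claim for \<open>M\<close>.
\<close>

section \<open>Quantum matrices\<close>

lemma idx_less [simp]:
  "I1 < I2" "I1 < I3" "I2 < I3" "\<not> I2 < I1" "\<not> I3 < I1" "\<not> I3 < I2"
  by (simp_all add: less_idx_def)

lemma idx_less_cases [consumes 1]:
  fixes i j :: idx
  assumes "i < j"
  obtains "i = I1" "j = I2" | "i = I1" "j = I3" | "i = I2" "j = I3"
  using assms by (cases i; cases j) auto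

text \<open>Scalars are central elements of the ring itself, with \<open>p\<close> the inverse of
  \<open>q\<close>. So one locale covers the algebra, the operators over it and, with
  \<open>q = p = 1\<close>, matrices of commuting entries.\<close>

locale quantum_parameter =
  fixes q p :: "'b::ring_1"
  assumes qp: "q * p = 1"
    and q_central: "x * q = q * x"
    and p_central: "x * p = p * x"
begin

lemma pq: "p * q = 1"
  using qp q_central by metis

lemma scalar_simps:
  "q * p = 1" "p * q = 1" "q * (p * x) = x" "p * (q * x) = x"
  by (simp_all add: qp pq flip: mult.assoc)

end

locale quantum_matrix = quantum_parameter q p for q p :: "'b::ring_1" +
  fixes M :: "idx \<Rightarrow> idx \<Rightarrow> 'b"
  assumes same_column: "l < i \<Longrightarrow> M i j * M l j = p * (M l j * M i j)"
    and same_row: "m < j \<Longrightarrow> M i j * M i m = p * (M i m * M i j)"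
    and antidiagonal: "l < i \<Longrightarrow> j < m \<Longrightarrow> M i j * M l m = M l m * M i j"
    and diagonal: "l < i \<Longrightarrow> m < j \<Longrightarrow>
      M i j * M l m = M l m * M i j - (q - p) * (M l j * M i m)"
begin

text \<open>The relations with a tail \<open>z\<close>, oriented so that rows, and columns within a
  row, increase from left to right. With them \<open>simp\<close> brings right-nested products to an
  ordered normal form, which proves the identities between entries below.\<close>

lemma straighten_assoc:
  "l < i \<Longrightarrow> M i j * (M l j * z) = p * (M l j * (M i j * z))"
  "m < j \<Longrightarrow> M i j * (M i m * z) = p * (M i m * (M i j * z))"
  "l < i \<Longrightarrow> j < m \<Longrightarrow> M i j * (M l m * z) = M l m * (M i j * z)"
  "l < i \<Longrightarrow> m < j \<Longrightarrow>
      M i j * (M l m * z) = M l m * (M i j * z) - (q - p) * (M l j * (M i m * z))"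
  using same_column[of l i j] same_row[of m j i] antidiagonal[of l i j m] diagonal[of l i m j]
  by (simp_all add: left_diff_distrib flip: mult.assoc)

lemma scalar_left:
  "M i j * q = q * M i j" "M i j * p = p * M i j"
  "M i j * (q * z) = q * (M i j * z)" "M i j * (p * z) = p * (M i j * z)"
  by (simp_all add: q_central p_central flip: mult.assoc) 

lemmas straighten = same_column same_row antidiagonal diagonal straighten_assoc
  scalar_left scalar_simps mult.assoc distrib_left distrib_right
  left_diff_distrib right_diff_distrib mult_minus_left mult_minus_right

definition minor :: "idx \<Rightarrow> idx \<Rightarrow> idx \<Rightarrow> idx \<Rightarrow> 'b" where
  "minor i j k l = M i k * M j l - q * (M i l * M j k)"

definition qdet :: 'b where
  "qdet = M I1 I1 * M I2 I2 * M I3 I3 - q * (M I1 I1 * M I2 I3 * M I3 I2)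
     - q * (M I1 I2 * M I2 I1 * M I3 I3) + q ^ 2 * (M I1 I2 * M I2 I3 * M I3 I1)
     + q ^ 2 * (M I1 I3 * M I2 I1 * M I3 I2) - q ^ 3 * (M I1 I3 * M I2 I2 * M I3 I1)"

definition sigma1 :: 'b where
  "sigma1 = M I1 I1 + M I2 I2 + M I3 I3"

definition sigma2 :: 'b where
  "sigma2 = minor I1 I2 I1 I2 + minor I1 I3 I1 I3 + minor I2 I3 I2 I3"

lemma qdet_central: "M i j * qdet = qdet * M i j"
  unfolding qdet_def power2_eq_square power3_eq_cube
  by (cases i; cases j) (simp add: straighten)+

lemma sigma1_sigma2: "sigma1 * sigma2 = sigma2 * sigma1"
  unfolding sigma1_def sigma2_def minor_def by (simp add: straighten)

end

section \<open>Coaction on the quantum plane\<close>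

locale quantum_plane_coaction = quantum_matrix q p M
  for q p :: "'b::ring_1" and M +
  fixes x :: "idx \<Rightarrow> 'b"
  assumes plane: "i < j \<Longrightarrow> x j * x i = p * (x i * x j)"
    and x_M: "x k * M i j = M i j * x k"
begin

definition Y :: "idx \<Rightarrow> 'b" where
  "Y i = M i I1 * x I1 + M i I2 * x I2 + M i I3 * x I3"

lemma plane_assoc: "i < j \<Longrightarrow> x j * (x i * z) = p * (x i * (x j * z))"
  using plane[of i j] by (simp flip: mult.assoc)

lemma x_left:
  "x k * (M i j * z) = M i j * (x k * z)"
  "x k * q = q * x k" "x k * p = p * x k"
  "x k * (q * z) = q * (x k * z)" "x k * (p * z) = p * (x k * z)"
  using x_M[of k i j] by (simp_all add: q_central p_central flip: mult.assoc)

lemmas straighten_x = straighten plane plane_assoc x_M x_left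

lemma Y_commute: "i < j \<Longrightarrow> Y j * Y i = p * (Y i * Y j)"
  unfolding Y_def by (elim idx_less_cases; hypsubst; simp add: straighten_x)

text \<open>The coaction on the quantum exterior algebra commutes with the Koszul differential.\<close>

lemma laplace_rows2:
  assumes "i < i'"
  shows "M i I1 * Y i' - q * (M i' I1 * Y i) = minor i i' I1 I2 * x I2 + minor i i' I1 I3 * x I3"
    "M i I2 * Y i' - q * (M i' I2 * Y i) = minor i i' I2 I3 * x I3 - q * (minor i i' I1 I2 * x I1)"
    "M i I3 * Y i' - q * (M i' I3 * Y i) =
       - q * (minor i i' I1 I3 * x I1) - q * (minor i i' I2 I3 * x I2)"
  using assms unfolding Y_def minor_def by (elim idx_less_cases; hypsubst; simp add: straighten_x)+

text \<open>The coefficients of \<open>x I2\<close> and \<open>x I3\<close> are Laplace expansions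
  with a repeated column and vanish; in that of \<open>x I1\<close> column 1 stands behind columns 2
  and 3, which costs the factor \<open>q ^ 2\<close>.\<close>

lemma laplace_rows3:
  "minor I1 I2 I2 I3 * Y I3 - q * (minor I1 I3 I2 I3 * Y I2) + q ^ 2 * (minor I2 I3 I2 I3 * Y I1)
     = q ^ 2 * (qdet * x I1)"
  unfolding Y_def minor_def qdet_def power2_eq_square power3_eq_cube
  by (simp add: straighten_x)

end

section \<open>Powers of \<open>q\<close>-commuting elements\<close>

definition central :: "'b::ring_1 \<Rightarrow> bool" where
  "central c \<longleftrightarrow> (\<forall>z. z * c = c * z)"

lemma centralD: "central c \<Longrightarrow> z * c = c * z"
  by (simp add: central_def)

lemma central_left: "central c \<Longrightarrow> z * (c * y) = c * (z * y)"
  by (simp add: central_def flip: mult.assoc)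

lemma central_mult: "central a \<Longrightarrow> central b \<Longrightarrow> central (a * b)"
  unfolding central_def by (metis mult.assoc)

lemma central_power: "central a \<Longrightarrow> central (a ^ n)"
  by (induction n) (auto simp: central_mult, simp add: central_def)

lemma central_0 [simp]: "central 0" and central_1 [simp]: "central 1"
  by (simp_all add: central_def)

lemma central_add_diff:
  "central a \<Longrightarrow> central b \<Longrightarrow> central (a + b)"
  "central a \<Longrightarrow> central b \<Longrightarrow> central (a - b)"
  unfolding central_def
  by (simp_all only: distrib_left distrib_right left_diff_distrib right_diff_distrib) metis+

lemmas central_closed = central_0 central_1 central_mult central_power central_add_diff

primrec qint :: "'b::semiring_1 \<Rightarrow> nat \<Rightarrow> 'b" where
  "qint w 0 = 0"
| "qint w (Suc n) = 1 + w * qint w n"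

text \<open>The q-Pascal rule gives the Gaussian binomials without division.\<close>

fun qbinomial :: "'b::semiring_1 \<Rightarrow> nat \<Rightarrow> nat \<Rightarrow> 'b" where
  "qbinomial w n 0 = 1"
| "qbinomial w 0 (Suc k) = 0"
| "qbinomial w (Suc n) (Suc k) = qbinomial w n k + w ^ Suc k * qbinomial w n (Suc k)"

lemma qbinomial_eq_0: "n < k \<Longrightarrow> qbinomial w n k = 0"
  by (induction w n k rule: qbinomial.induct) auto

lemma qbinomial_self [simp]: "qbinomial w n n = 1"
  by (induction n) (auto simp: qbinomial_eq_0)

lemma central_qint: "central w \<Longrightarrow> central (qint w n)"
  by (induction n) (simp_all add: central_closed)

lemma central_qbinomial: "central w \<Longrightarrow> central (qbinomial w n k)"
  by (induction w n k rule: qbinomial.induct) (simp_all add: central_closed del: power_Suc)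

lemma qcommute_power:
  fixes w :: "'b::ring_1"
  assumes w: "central w" and AB: "A * B = w * (B * A)"
  shows "A * B ^ n = w ^ n * (B ^ n * A)"
proof (induction n)
  case (Suc n)
  have "A * B ^ Suc n = (A * B) * B ^ n"
    by (simp add: mult.assoc)
  also have "\<dots> = w * (B * (A * B ^ n))"
    by (simp only: AB mult.assoc)
  also have "\<dots> = w * (w ^ n * (B * (B ^ n * A)))"
    by (simp only: Suc central_left[of "w ^ n"] central_closed w)
  finally show ?case
    by (simp add: mult.assoc)
qed simp

text \<open>Multiplication by \<open>B + A\<close> from the left reproduces the q-Pascal rule:
  \<open>B\<close> raises \<open>k\<close>, and \<open>A\<close> picks up \<open>w ^ k\<close> on
  its way past \<open>B ^ k\<close>.\<close>

lemma qbinomial_theorem: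
  fixes w :: "'b::ring_1"
  assumes w: "central w" and AB: "A * B = w * (B * A)"
  shows "(B + A) ^ n = (\<Sum>k\<le>n. qbinomial w n k * (B ^ k * A ^ (n - k)))"
proof (induction n)
  case (Suc n)
  let ?f = "\<lambda>k. B ^ k * A ^ (Suc n - k)"
  let ?b = "qbinomial w n"
  have A: "A * (?b k * (B ^ k * A ^ (n - k))) = w ^ k * ?b k * ?f k" if "k \<le> n" for k
  proof -
    have "A * (?b k * (B ^ k * A ^ (n - k))) = ?b k * (A * B ^ k * A ^ (n - k))"
      by (simp only: central_left[OF central_qbinomial[OF w]] mult.assoc)
    also have "\<dots> = ?b k * (w ^ k * (B ^ k * (A * A ^ (n - k))))"
      by (simp only: qcommute_power[OF w AB] mult.assoc)
    also have "A * A ^ (n - k) = A ^ (Suc n - k)"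
      using that by (simp add: Suc_diff_le)
    finally show ?thesis
      by (simp only: centralD[OF central_qbinomial[OF w], symmetric] flip: mult.assoc)
  qed
  have B: "B * (?b k * (B ^ k * A ^ (n - k))) = ?b k * ?f (Suc k)" for k
    by (simp add: central_left[OF central_qbinomial[OF w]] mult.assoc)
  have "(B + A) ^ Suc n = (\<Sum>k\<le>n. ?b k * ?f (Suc k)) + (\<Sum>k\<le>n. w ^ k * ?b k * ?f k)"
  proof -
    have "(B + A) ^ Suc n = (\<Sum>k\<le>n. B * (?b k * (B ^ k * A ^ (n - k))))
        + (\<Sum>k\<le>n. A * (?b k * (B ^ k * A ^ (n - k))))"
      by (simp only: power_Suc Suc distrib_right sum_distrib_left sum.distrib)
    also have "(\<Sum>k\<le>n. A * (?b k * (B ^ k * A ^ (n - k)))) = (\<Sum>k\<le>n. w ^ k * ?b k * ?f k)"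
      by (intro sum.cong refl A) simp
    finally show ?thesis by (simp only: B)
  qed
  also have "(\<Sum>k\<le>n. w ^ k * ?b k * ?f k) = (\<Sum>k\<le>Suc n. w ^ k * ?b k * ?f k)"
    by (simp add: qbinomial_eq_0)
  also have "\<dots> = ?f 0 + (\<Sum>k\<le>n. w ^ Suc k * ?b (Suc k) * ?f (Suc k))"
    by (subst sum.atMost_Suc_shift) simp
  finally have "(B + A) ^ Suc n = ?f 0 + (\<Sum>k\<le>n. qbinomial w (Suc n) (Suc k) * ?f (Suc k))"
    by (simp add: distrib_right sum.distrib mult.assoc del: power_Suc diff_Suc_Suc)
  then show ?case
    by (subst sum.atMost_Suc_shift) simp
qed simp

lemma qint_Suc_right: "qint w (Suc n) = qint w n + w ^ n" for w :: "'b::ring_1"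
  by (induction n) (simp_all add: algebra_simps)

text \<open>On its way through the factors \<open>B\<close>, \<open>A\<close> leaves a
  \<open>Z\<close> at each of them; moving these to the right end produces the geometric sum
  \<open>qint c (Suc n)\<close>.\<close>

lemma commutator_power:
  fixes c s :: "'b::ring_1"
  assumes c: "central c" and s: "central s"
    and AB: "A * B = B * A - s * Z" and ZB: "Z * B = c * (B * Z)"
  shows "A * B ^ Suc n = B ^ Suc n * A - s * (qint c (Suc n) * (B ^ n * Z))"
proof (induction n)
  case 0
  show ?case by (simp add: AB)
next
  case (Suc n)
  note cent = central_left[OF s, of B] central_left[OF central_qint[OF c], of B]
  have "A * B ^ Suc (Suc n) = (A * B) * B ^ Suc n"
    by (simp only: power_Suc mult.assoc)
  also have "\<dots> = B * (A * B ^ Suc n) - s * (Z * B ^ Suc n)"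
    by (simp only: AB left_diff_distrib mult.assoc)
  also have "Z * B ^ Suc n = c ^ Suc n * (B ^ Suc n * Z)"
    by (rule qcommute_power[OF c ZB])
  also have "B * (A * B ^ Suc n) = B ^ Suc (Suc n) * A - s * (qint c (Suc n) * (B ^ Suc n * Z))"
    unfolding Suc by (simp only: right_diff_distrib cent) (simp only: power_Suc mult.assoc)
  finally show ?case
    by (simp only: qint_Suc_right[of c "Suc n"] distrib_left distrib_right diff_diff_add)
qed

lemma qint_telescope: "(1 - w) * qint w n = 1 - w ^ n" for w :: "'b::ring_1"
proof (induction n)
  case (Suc n)
  have "(1 - w) * qint w (Suc n) = (1 - w) + w * ((1 - w) * qint w n)"
    by (simp add: algebra_simps)
  also have "\<dots> = 1 - w ^ Suc n"
    by (simp only: Suc) (simp add: algebra_simps)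
  finally show ?case .
qed simp

lemma qbinomial_frobenius:
  fixes w :: "'b::ring_1"
  assumes w: "central w" and AB: "A * B = w * (B * A)"
    and N: "0 < N" and vanish: "\<And>k. 0 < k \<Longrightarrow> k < N \<Longrightarrow> qbinomial w N k = 0"
  shows "(B + A) ^ N = B ^ N + A ^ N"
proof -
  have "(B + A) ^ N = (\<Sum>k\<in>{0, N}. qbinomial w N k * (B ^ k * A ^ (N - k)))"
    unfolding qbinomial_theorem[OF w AB]
    by (rule sum.mono_neutral_right) (auto simp: vanish)
  then show ?thesis using N by (simp add: add.commute)
qed

section \<open>\<open>N\<close>-th powers in a quantum matrix and in its coaction\<close>

context quantum_parameter
begin

lemma central_qp: "central q" "central p"
  by (simp_all add: central_def q_central p_central)

lemma p_power_N: "q ^ N = 1 \<Longrightarrow> p ^ N = 1"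
proof -
  assume "q ^ N = 1"
  moreover have "q ^ n * p ^ n = 1" for n
  proof (induction n)
    case (Suc n)
    have "q ^ Suc n * p ^ Suc n = q * (q ^ n * p ^ n) * p"
      by (simp add: power_commutes mult.assoc)
    then show ?case by (simp add: Suc qp)
  qed simp
  ultimately show ?thesis by (metis mult_1)
qed

end

context quantum_matrix
begin

text \<open>Between entries that commute up to a scalar, the scalar occurs to the power
  \<open>N\<close> and disappears. In the diagonal cases \<open>commutator_power\<close> leaves
  \<open>(q - p) * qint (p ^ 2) N\<close>, or the same with \<open>p\<close> and \<open>q\<close>
  exchanged.\<close>

lemma power_central:
  assumes N: "q ^ N = 1"
  shows "M i j * M l m ^ N = M l m ^ N * M i j"
proof (cases N)
  case (Suc n)
  note pN = p_power_N[OF N]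
  have power_square_1: "c ^ N = 1 \<Longrightarrow> (c ^ 2) ^ N = 1" for c :: 'b
    by (metis power_mult mult.commute power_one)
  have scaled: "M i j * M l m ^ N = M l m ^ N * M i j"
    if "central c" "c ^ N = 1" "M i j * M l m = c * (M l m * M i j)" for c
    using qcommute_power[OF that(1,3), of N] that(2) by simp
  have comm: "M i j * M l m ^ N = M l m ^ N * M i j"
    if "central s" "central c" "M i j * M l m = M l m * M i j - s * Z"
      "Z * M l m = c * (M l m * Z)" "s * qint c N = 0" for s c Z
    using commutator_power[OF that(2,1,3,4), of n] that(5)
    by (simp add: Suc flip: mult.assoc)
  \<comment> \<open>As \<open>q - p = q * (1 - p ^ 2)\<close>, the geometric sum telescopes to
    \<open>1 - p ^ (2 * N)\<close>.\<close>
  have c1: "(q - p) * qint (p ^ 2) N = 0"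
  proof -
    have "(q - p) * qint (p ^ 2) N = q * ((1 - p ^ 2) * qint (p ^ 2) N)"
      by (simp add: algebra_simps power2_eq_square scalar_simps)
    then show ?thesis
      by (simp only: qint_telescope) (simp add: power_square_1 pN)
  qed
  have c2: "(p - q) * qint (q ^ 2) N = 0"
  proof -
    have "(p - q) * qint (q ^ 2) N = p * ((1 - q ^ 2) * qint (q ^ 2) N)"
      by (simp add: algebra_simps power2_eq_square scalar_simps)
    then show ?thesis
      by (simp only: qint_telescope) (simp add: power_square_1 N)
  qed
  consider "l < i" "j < m" | "l < i" "j = m" | "l < i" "m < j"
    | "l = i" "j < m" | "l = i" "j = m" | "l = i" "m < j"
    | "i < l" "j < m" | "i < l" "j = m" | "i < l" "m < j"
    by (meson linorder_less_linear)
  then show ?thesis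
  proof cases
    case 1 then show ?thesis using antidiagonal[of l i j m] by (intro scaled[of 1]) simp_all
  next
    case 2 then show ?thesis
      by (intro scaled[of p]) (simp_all add: same_column central_qp pN)
  next
    case 3
    then have "M l j * M i m * M l m = p ^ 2 * (M l m * (M l j * M i m))"
      by (simp add: straighten power2_eq_square)
    with 3 show ?thesis
      by (intro comm[of "q - p" "p ^ 2" "M l j * M i m"])
        (simp_all add: diagonal c1 central_closed central_qp)
  next
    case 4 then show ?thesis
      using same_row[of j m i]
      by (intro scaled[of q]) (simp_all add: central_qp N scalar_simps)
  next
    case 5 then show ?thesis by (simp add: power_commutes)
  next
    case 6 then show ?thesis
      by (intro scaled[of p]) (simp_all add: same_row central_qp pN)
  next
    \<comment> \<open>The diagonal relation is read backwards here, which exchanges \<open>p\<close>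
      and \<open>q\<close>.\<close>
    case 7
    then have "M i m * M l j * M l m = q ^ 2 * (M l m * (M i m * M l j))"
      by (simp add: straighten power2_eq_square)
    moreover from 7 have "M i j * M l m = M l m * M i j - (p - q) * (M i m * M l j)"
      using diagonal[of i l j m] by (simp add: left_diff_distrib)
    ultimately show ?thesis
      by (intro comm[of "p - q" "q ^ 2" "M i m * M l j"])
        (simp_all only: c2 central_closed central_qp)
  next
    case 8 then show ?thesis
      using same_column[of i l m]
      by (intro scaled[of q]) (simp_all add: central_qp N scalar_simps)
  next
    case 9 then show ?thesis
      using antidiagonal[of i l m j] by (intro scaled[of 1]) simp_all
  qed
qed simp

end

context quantum_plane_coaction
begin

lemma Y_power_commute:
  assumes "q ^ N = 1"
  shows "Y i * Y j ^ N = Y j ^ N * Y i"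
proof -
  consider "i < j" | "i = j" | "j < i" by (meson linorder_less_linear)
  then show ?thesis
  proof cases
    case 1
    then have "Y i * Y j = q * (Y j * Y i)" by (simp add: Y_commute scalar_simps)
    from qcommute_power[OF central_qp(1) this, of N] show ?thesis by (simp add: assms)
  next
    case 3
    from qcommute_power[OF central_qp(2) Y_commute[OF 3], of N] show ?thesis
      by (simp add: p_power_N assms)
  qed (simp add: power_commutes)
qed

text \<open>The summands of \<open>Y i\<close> commute up to \<open>q ^ 2\<close>: one factor
  \<open>q\<close> comes from the row relation, one from the quantum plane. This is why the Gaussian
  binomials have base \<open>q ^ 2\<close>.\<close>

lemma Y_power:
  assumes "0 < N" and "\<And>k. 0 < k \<Longrightarrow> k < N \<Longrightarrow> qbinomial (q ^ 2) N k = 0"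
  shows "Y i ^ N = M i I1 ^ N * x I1 ^ N + M i I2 ^ N * x I2 ^ N + M i I3 ^ N * x I3 ^ N"
proof -
  have w: "central (q ^ 2)" by (simp add: central_closed central_qp)
  have comm: "(M i j * x j) * (M i k * x k) = q ^ 2 * ((M i k * x k) * (M i j * x j))"
    if "j < k" for j k
    by (simp add: mult.assoc x_left x_M plane[OF that] straighten_assoc(2)[OF that] scalar_left
        scalar_simps power2_eq_square)
  have pow: "(M i j * x j) ^ n = M i j ^ n * x j ^ n" for j n
  proof (induction n)
    case (Suc n)
    have "x j * M i j ^ n = M i j ^ n * x j"
      by (rule power_commuting_commutes[symmetric]) (simp add: x_M)
    then have "x j * (M i j ^ n * z) = M i j ^ n * (x j * z)" for z
      by (simp flip: mult.assoc)
    then show ?case by (simp add: Suc mult.assoc)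
  qed simp
  have "(M i I3 * x I3 + (M i I2 * x I2 + M i I1 * x I1)) ^ N
      = (M i I3 * x I3) ^ N + (M i I2 * x I2 + M i I1 * x I1) ^ N"
    by (rule qbinomial_frobenius[OF w _ assms])
      (simp_all add: comm distrib_left distrib_right)
  also have "(M i I2 * x I2 + M i I1 * x I1) ^ N = (M i I2 * x I2) ^ N + (M i I1 * x I1) ^ N"
    by (rule qbinomial_frobenius[OF w _ assms]) (simp_all add: comm)
  finally show ?thesis by (simp add: Y_def pow add_ac)
qed

end

section \<open>Right linear operators on functions\<close>

text \<open>Right linearity makes multiplication by central elements central among the operators.\<close>

typedef (overloaded) ('i, 'b) endo =
  "{T :: ('i \<Rightarrow> 'b::ring_1) \<Rightarrow> 'i \<Rightarrow> 'b.
     (\<forall>f g. T (\<lambda>i. f i + g i) = (\<lambda>i. T f i + T g i)) \<and> (\<forall>f z. T (\<lambda>i. f i * z) = (\<lambda>i. T f i * z))}"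
  morphisms app Endo
  by (rule exI[of _ "\<lambda>f. f"]) simp

setup_lifting type_definition_endo

lemma app_mult_right: "app T (\<lambda>i. f i * z) = (\<lambda>i. app T f i * z)"
  using app[of T] by simp

lemma app_zero: "app T (\<lambda>i. 0) = (\<lambda>i. 0)"
  using app_mult_right[of T "\<lambda>i. 0" 0] by simp

instantiation endo :: (type, ring_1) ring_1
begin

lift_definition zero_endo :: "('a, 'b) endo" is "\<lambda>f i. 0" by simp
lift_definition one_endo :: "('a, 'b) endo" is "\<lambda>f. f" by simp
lift_definition plus_endo :: "('a, 'b) endo \<Rightarrow> ('a, 'b) endo \<Rightarrow> ('a, 'b) endo"
  is "\<lambda>S T f i. S f i + T f i" by (simp add: distrib_right add_ac)
lift_definition minus_endo :: "('a, 'b) endo \<Rightarrow> ('a, 'b) endo \<Rightarrow> ('a, 'b) endo"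
  is "\<lambda>S T f i. S f i - T f i" by (simp add: left_diff_distrib add_diff_add)
lift_definition uminus_endo :: "('a, 'b) endo \<Rightarrow> ('a, 'b) endo"
  is "\<lambda>T f i. - T f i" by simp
lift_definition times_endo :: "('a, 'b) endo \<Rightarrow> ('a, 'b) endo \<Rightarrow> ('a, 'b) endo"
  is "\<lambda>S T f. S (T f)" by simp

instance
proof
  fix R S T :: "('a, 'b) endo"
  show "R + S + T = R + (S + T)" "R + S = S + R" "0 + R = R" "- R + R = 0" "R - S = R + - S"
    by (transfer; simp add: fun_eq_iff add_ac)+
  show "R * S * T = R * (S * T)" "1 * R = R" "R * 1 = R" "(R + S) * T = R * T + S * T"
    "R * (S + T) = R * S + R * T"
    by (transfer; simp)+
  show "(0 :: ('a, 'b) endo) \<noteq> 1"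
    by transfer (metis zero_neq_one)
qed

end

lemma app_simps [simp]:
  "app 0 f i = 0" "app 1 f = f" "app (S + T) f i = app S f i + app T f i"
  "app (S - T) f i = app S f i - app T f i" "app (- T) f i = - app T f i"
  "app (S * T) f = app S (app T f)"
  by (transfer; simp)+

lemma endo_eqI: "(\<And>f i. app S f i = app T f i) \<Longrightarrow> S = T"
  by (auto simp: fun_eq_iff simp flip: app_inject)

lift_definition scal :: "'b::ring_1 \<Rightarrow> ('i, 'b) endo" is "\<lambda>b f i. b * f i"
  by (simp add: distrib_left mult.assoc)

lemma app_scal [simp]: "app (scal b) f i = b * f i"
  by transfer simp

lemma scal_hom:
  "scal 0 = 0" "scal 1 = 1" "scal (a + b) = scal a + scal b" "scal (a - b) = scal a - scal b"
  "scal (a * b) = scal a * scal b"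
  by (rule endo_eqI; simp add: distrib_right left_diff_distrib mult.assoc)+

lemma scal_power: "scal (a ^ n) = scal a ^ n"
  by (induction n) (simp_all add: scal_hom)

lemma central_scal: "central c \<Longrightarrow> central (scal c :: ('i, 'b::ring_1) endo)"
  unfolding central_def
proof (intro allI endo_eqI)
  fix T :: "('i, 'b) endo" and f i
  assume c: "\<forall>z. z * c = c * z"
  then have "app T (\<lambda>i. c * f i) = (\<lambda>i. c * app T f i)"
    using app_mult_right[of T f c] by simp
  moreover have "app (scal c) f = (\<lambda>i. c * f i)"
    by (simp add: fun_eq_iff)
  ultimately show "app (T * scal c) f i = app (scal c * T) f i" by simp
qed

lemma scal_qbinomial: "scal (qbinomial w n k) = qbinomial (scal w) n k"
  by (induction w n k rule: qbinomial.induct) (simp_all add: scal_hom scal_power del: power_Suc)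

lemma (in quantum_parameter) quantum_parameter_scal:
  "quantum_parameter (scal q :: ('i, 'b) endo) (scal p)"
  by unfold_locales
    (simp_all add: qp centralD[OF central_scal] central_qp flip: scal_hom(5), simp add: scal_hom)

lemma (in quantum_matrix) quantum_matrix_scal:
  "quantum_matrix (scal q :: ('i, 'b) endo) (scal p) (\<lambda>i j. scal (M i j))"
proof -
  interpret E: quantum_parameter "scal q :: ('i, 'b) endo" "scal p"
    by (rule quantum_parameter_scal)
  show ?thesis
    by unfold_locales (simp_all only: same_column same_row antidiagonal diagonal flip: scal_hom)
qed

section \<open>The quantum MacMahon theorem\<close>

text \<open>
  A function on triples lists the coefficients of the ordered monomials \<open>x\<^sub>1\<^sup>a x\<^sub>2\<^sup>b x\<^sub>3\<^sup>c\<close>, on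
  which \<open>plane_x p i\<close> is left multiplication by \<open>x\<^sub>i\<close>.
\<close>

lift_definition plane_x :: "'b::ring_1 \<Rightarrow> idx \<Rightarrow> (nat \<times> nat \<times> nat, 'b) endo" is
  "\<lambda>p k f (a, b, c). case k of
      I1 \<Rightarrow> if a = 0 then 0 else f (a - 1, b, c)
    | I2 \<Rightarrow> if b = 0 then 0 else p ^ a * f (a, b - 1, c)
    | I3 \<Rightarrow> if c = 0 then 0 else p ^ (a + b) * f (a, b, c - 1)"
  by (auto simp: fun_eq_iff distrib_left mult.assoc split: idx.split)

lemma app_plane_x [simp]:
  "app (plane_x p I1) f (a, b, c) = (if a = 0 then 0 else f (a - 1, b, c))"
  "app (plane_x p I2) f (a, b, c) = (if b = 0 then 0 else p ^ a * f (a, b - 1, c))"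
  "app (plane_x p I3) f (a, b, c) = (if c = 0 then 0 else p ^ (a + b) * f (a, b, c - 1))"
  by (transfer; simp)+

lemma endo_eqI3: "(\<And>f a b c. app S f (a, b, c) = app T f (a, b, c)) \<Longrightarrow> S = T"
  by (rule endo_eqI) auto

text \<open>The constant monomial: a product of the \<open>Y i\<close> applied to it lists the
  coefficients of that product in the quantum plane.\<close>

definition vacuum :: "nat \<times> nat \<times> nat \<Rightarrow> 'b::ring_1" where
  "vacuum v = (if v = (0, 0, 0) then 1 else 0)"

context quantum_matrix
begin

lemma M_p_power: "z * p ^ n = p ^ n * z" "z * (p ^ n * y) = p ^ n * (z * y)"
  by (rule centralD central_left, rule central_power, rule central_qp)+

lemma p_power_collect: "p ^ m * (p ^ n * z) = p ^ (m + n) * z" "p * (p ^ n * z) = p ^ Suc n * z"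
  by (simp_all add: power_add mult.assoc)

lemma quantum_plane_coaction_scal:
  "quantum_plane_coaction (scal q) (scal p) (\<lambda>i j. scal (M i j)) (plane_x p)"
proof -
  interpret E: quantum_matrix "scal q :: (nat \<times> nat \<times> nat, 'b) endo" "scal p" "\<lambda>i j. scal (M i j)"
    by (rule quantum_matrix_scal)
  show ?thesis
  proof
    fix i j :: idx
    assume "i < j"
    then show "plane_x p j * plane_x p i = scal p * (plane_x p i * plane_x p j)"
      by (elim idx_less_cases; hypsubst; intro endo_eqI3; rename_tac f a b c; case_tac a; case_tac
          b;
          case_tac c; simp add: p_power_collect add_ac del: power_Suc)
  next
    fix i j k
    show "plane_x p k * scal (M i j) = scal (M i j) * plane_x p k"
      by (cases k; intro endo_eqI3; simp add: M_p_power)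
  qed
qed

interpretation plane: quantum_plane_coaction "scal q" "scal p" "\<lambda>i j. scal (M i j)" "plane_x p"
  by (rule quantum_plane_coaction_scal)

definition Ymon :: "nat \<Rightarrow> nat \<Rightarrow> nat \<Rightarrow> (nat \<times> nat \<times> nat, 'b) endo" where
  "Ymon a b c = plane.Y I1 ^ a * plane.Y I2 ^ b * plane.Y I3 ^ c"

definition Ycoeff :: "nat \<Rightarrow> nat \<Rightarrow> nat \<Rightarrow> nat \<times> nat \<times> nat \<Rightarrow> 'b" where
  "Ycoeff a b c = app (Ymon a b c) vacuum"

definition diag_coeff :: "nat \<times> nat \<times> nat \<Rightarrow> 'b" where
  "diag_coeff v = (case v of (a, b, c) \<Rightarrow> Ycoeff a b c (a, b, c))"

text \<open>The alternating sum of principal minors in which every index taken lowers its exponent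
  by \<open>N\<close>. Step 1 gives the MacMahon recurrence; step \<open>N\<close> serves the matrix
  of \<open>N\<close>-th powers.\<close>

definition diag_step :: "nat \<Rightarrow> (nat \<times> nat \<times> nat \<Rightarrow> 'b) \<Rightarrow> nat \<times> nat \<times> nat \<Rightarrow> 'b" where
  "diag_step N t v = (case v of (a, b, c) \<Rightarrow>
       (if N \<le> a then M I1 I1 * t (a - N, b, c) else 0)
     + (if N \<le> b then M I2 I2 * t (a, b - N, c) else 0)
     + (if N \<le> c then M I3 I3 * t (a, b, c - N) else 0)
     - (if N \<le> a \<and> N \<le> b then minor I1 I2 I1 I2 * t (a - N, b - N, c) else 0)
     - (if N \<le> a \<and> N \<le> c then minor I1 I3 I1 I3 * t (a - N, b, c - N) else 0)
     - (if N \<le> b \<and> N \<le> c then minor I2 I3 I2 I3 * t (a, b - N, c - N) else 0)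
     + (if N \<le> a \<and> N \<le> b \<and> N \<le> c then qdet * t (a - N, b - N, c - N) else 0))"

lemma scal_minor: "plane.minor i j k l = scal (minor i j k l)"
  by (simp add: plane.minor_def minor_def scal_hom)

lemma scal_qdet: "plane.qdet = scal qdet"
  by (simp add: plane.qdet_def qdet_def scal_hom scal_power)

lemma Y_Ymon:
  "plane.Y I1 * Ymon a b c = Ymon (Suc a) b c"
  "plane.Y I2 * Ymon a b c = scal (p ^ a) * Ymon a (Suc b) c"
  "plane.Y I3 * Ymon a b c = scal (p ^ (a + b)) * Ymon a b (Suc c)"
proof -
  have cp: "central (scal p :: (nat \<times> nat \<times> nat, 'b) endo)" and cpn:
      "central (scal p ^ n :: (nat \<times> nat \<times> nat, 'b) endo)" for n
    by (simp_all add: central_scal central_qp central_power)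
  show "plane.Y I1 * Ymon a b c = Ymon (Suc a) b c"
    by (simp add: Ymon_def mult.assoc)
  have 21: "plane.Y I2 * (plane.Y I1 ^ a * z) = scal p ^ a * (plane.Y I1 ^ a * (plane.Y I2 * z))"
      for a z
    using qcommute_power[OF cp plane.Y_commute[of I1 I2], of a] by (simp flip: mult.assoc)
  have 31: "plane.Y I3 * (plane.Y I1 ^ a * z) = scal p ^ a * (plane.Y I1 ^ a * (plane.Y I3 * z))"
      for a z
    using qcommute_power[OF cp plane.Y_commute[of I1 I3], of a] by (simp flip: mult.assoc)
  have 32: "plane.Y I3 * (plane.Y I2 ^ a * z) = scal p ^ a * (plane.Y I2 ^ a * (plane.Y I3 * z))"
      for a z
    using qcommute_power[OF cp plane.Y_commute[of I2 I3], of a] by (simp flip: mult.assoc)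
  show "plane.Y I2 * Ymon a b c = scal (p ^ a) * Ymon a (Suc b) c"
    by (simp add: Ymon_def mult.assoc 21 scal_power)
  have "plane.Y I3 * Ymon a b c
      = scal p ^ a * (plane.Y I1 ^ a * (scal p ^ b * (plane.Y I2 ^ b * (plane.Y I3 * plane.Y I3
          ^ c))))"
    by (simp add: Ymon_def mult.assoc 31 32)
  then show "plane.Y I3 * Ymon a b c = scal (p ^ (a + b)) * Ymon a b (Suc c)"
    by (simp add: Ymon_def mult.assoc scal_power scal_hom(5) power_add central_left[OF cpn, of
        "plane.Y I1 ^ a"])
qed

lemma app_Y_Ycoeff:
  "app (plane.Y I1) (Ycoeff a b c) v = Ycoeff (Suc a) b c v"
  "app (plane.Y I2) (Ycoeff a b c) v = p ^ a * Ycoeff a (Suc b) c v"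
  "app (plane.Y I3) (Ycoeff a b c) v = p ^ (a + b) * Ycoeff a b (Suc c) v"
  using fun_cong[OF arg_cong[OF Y_Ymon(1)[of a b c], of app], of vacuum]
    fun_cong[OF arg_cong[OF Y_Ymon(2)[of a b c], of app], of vacuum]
    fun_cong[OF arg_cong[OF Y_Ymon(3)[of a b c], of app], of vacuum]
  by (simp_all add: Ycoeff_def)

lemma app_Y: "app (plane.Y i) f v = M i I1 * app (plane_x p I1) f v
    + M i I2 * app (plane_x p I2) f v
    + M i I3 * app (plane_x p I3) f v"
  by (simp add: plane.Y_def)

lemma app_laplace_rows2:
  assumes "i < i'"
  shows "M i I1 * app (plane.Y i') f v - q * (M i' I1 * app (plane.Y i) f v)
      = minor i i' I1 I2 * app (plane_x p I2) f v + minor i i' I1 I3 * app (plane_x p I3) f v"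
    "M i I2 * app (plane.Y i') f v - q * (M i' I2 * app (plane.Y i) f v)
      = minor i i' I2 I3 * app (plane_x p I3) f v - q * (minor i i' I1 I2 * app (plane_x p I1) f v)"
    "M i I3 * app (plane.Y i') f v - q * (M i' I3 * app (plane.Y i) f v)
      = - q * (minor i i' I1 I3 * app (plane_x p I1) f v)
          - q * (minor i i' I2 I3 * app (plane_x p I2) f v)"
  using plane.laplace_rows2[OF assms, THEN arg_cong[of _ _ app], THEN fun_cong, of f,
      THEN fun_cong, of v]
  by (simp_all add: scal_minor)

lemma app_laplace_rows3:
  "minor I1 I2 I2 I3 * app (plane.Y I3) f v - q * (minor I1 I3 I2 I3 * app (plane.Y I2) f v)
     + q ^ 2 * (minor I2 I3 I2 I3 * app (plane.Y I1) f v)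
     = q ^ 2 * (qdet * app (plane_x p I1) f v)"
  using plane.laplace_rows3[THEN arg_cong[of _ _ app], THEN fun_cong, of f, THEN fun_cong, of v]
  by (simp add: scal_minor scal_qdet flip: scal_power)

lemma p_times:
  assumes "A - q * B = C - q * D"
  shows "B - D = p * A - p * C"
proof -
  have "p * (A - q * B) = p * (C - q * D)" using assms by simp
  then show ?thesis by (simp add: right_diff_distrib scalar_simps algebra_simps)
qed

text \<open>
  With weight \<open>b\<close> fixed, the Koszul differential pairs the subset \<open>S\<close> of \<open>{2, 3}\<close> with
  \<open>S \<union> {1}\<close>. The difference of their diagonal coefficients consists of off-diagonal ones
  (\<open>U, V, W, Z\<close> below), which cancel in the alternating sum over \<open>S\<close>.
\<close>

lemma macmahon_case1:
  "Ycoeff (Suc a) b c (Suc a, b, c) = diag_step 1 diag_coeff (Suc a, b, c)"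
proof -
  note act = app_Y_Ycoeff p_power_collect M_p_power[of "M i j" for i j]
    M_p_power[of "minor i j k l" for i j k l] M_p_power[of qdet]
  define U where "U = (if b = 0 then 0 else p ^ Suc a * (M I1 I2 * Ycoeff a b c (Suc a, b - 1, c)))"
  define V where "V = (if c = 0 then 0 else p ^ (Suc a + b) * (M I1 I3 * Ycoeff a b c (Suc a, b, c
      - 1)))"
  define W where "W = (if b = 0 \<or> c = 0 then 0 else
    p ^ (Suc a + b) * (minor I1 I2 I2 I3 * Ycoeff a (b - 1) c (Suc a, b - 1, c - 1)))"
  define Z where "Z = (if b = 0 \<or> c = 0 then 0 else
    p ^ Suc a * (minor I1 I3 I2 I3 * Ycoeff a b (c - 1) (Suc a, b - 1, c - 1)))"
  \<comment> \<open>The labels name the set \<open>S\<close> of the pairing: the empty set here,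
    then {2}, {3} and {2, 3}.\<close>
  have 0: "Ycoeff (Suc a) b c (Suc a, b, c) = M I1 I1 * Ycoeff a b c (a, b, c) + U + V"
    unfolding app_Y_Ycoeff(1)[symmetric] by (simp add: app_Y U_def V_def M_p_power[of "M i j"
        for i j] del: power_Suc)
  have 2: "(if b = 0 then 0 else M I2 I2 * Ycoeff (Suc a) (b - 1) c (Suc a, b - 1, c))
      - (if b = 0 then 0 else minor I1 I2 I1 I2 * Ycoeff a (b - 1) c (a, b - 1, c)) = U - W"
  proof (cases b)
    case (Suc b')
    show ?thesis
      using p_times[OF app_laplace_rows2(2)[of I1 I2 "Ycoeff a b' c" "(Suc a, b', c)"]]
      by (cases c) (simp_all add: act Suc U_def W_def del: power_Suc)
  qed (simp add: U_def W_def)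
  have 3: "(if c = 0 then 0 else M I3 I3 * Ycoeff (Suc a) b (c - 1) (Suc a, b, c - 1))
      - (if c = 0 then 0 else minor I1 I3 I1 I3 * Ycoeff a b (c - 1) (a, b, c - 1)) = V + Z"
  proof (cases c)
    case (Suc c')
    have "M I1 I3 * app (plane.Y I3) (Ycoeff a b c') (Suc a, b, c')
        - q * (M I3 I3 * app (plane.Y I1) (Ycoeff a b c') (Suc a, b, c'))
      = - q * (minor I1 I3 I2 I3 * app (plane_x p I2) (Ycoeff a b c') (Suc a, b, c'))
        - q * (minor I1 I3 I1 I3 * app (plane_x p I1) (Ycoeff a b c') (Suc a, b, c'))"
      using app_laplace_rows2(3)[of I1 I3 "Ycoeff a b c'" "(Suc a, b, c')"]
          by (simp add: algebra_simps)
    from p_times[OF this] show ?thesis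
      by (cases b) (simp_all add: act Suc V_def Z_def scalar_simps del: power_Suc)
  qed (simp add: V_def Z_def)
  have 23: "(if b = 0 \<or> c = 0 then 0 else minor I2 I3 I2 I3 * Ycoeff (Suc a) (b - 1) (c
      - 1) (Suc a, b - 1, c - 1))
      - (if b = 0 \<or> c = 0 then 0 else qdet * Ycoeff a (b - 1) (c - 1) (a, b - 1, c - 1)) = Z - W"
  proof (cases "b = 0 \<or> c = 0")
    case False
    then obtain b' c' where bc: "b = Suc b'" "c = Suc c'" by (meson not0_implies_Suc)
    \<comment> \<open>Two factors \<open>p\<close> clear the \<open>q ^ 2\<close> of the Laplace
      identity.\<close>
    have "p * (p * (minor I1 I2 I2 I3 * app (plane.Y I3) (Ycoeff a b' c') (Suc a, b', c')
          - q * (minor I1 I3 I2 I3 * app (plane.Y I2) (Ycoeff a b' c') (Suc a, b', c'))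
        + q ^ 2 * (minor I2 I3 I2 I3 * app (plane.Y I1) (Ycoeff a b' c') (Suc a, b', c'))))
      = p * (p * (q ^ 2 * (qdet * app (plane_x p I1) (Ycoeff a b' c') (Suc a, b', c'))))"
      by (simp only: app_laplace_rows3)
    then show ?thesis
      by (simp add: bc act W_def Z_def distrib_left right_diff_distrib scalar_simps power2_eq_square
          mult.assoc del: power_Suc) (simp add: algebra_simps)
  qed (simp add: W_def Z_def)
  have sum: "x + A2 + A3 - B2 - B3 - A23 + B23 = x + (A2 - B2) + (A3 - B3) - (A23 - B23)"
    for x A2 A3 B2 B3 A23 B23 :: 'b
    by (simp add: algebra_simps)
  have [simp]: "(Suc 0 \<le> n) = (n \<noteq> 0)" for n by auto
  have "diag_step 1 diag_coeff (Suc a, b, c) = M I1 I1 * Ycoeff a b c (a, b, c) + (U - W)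
      + (V + Z) - (Z - W)"
    unfolding 2[symmetric] 3[symmetric] 23[symmetric] sum[symmetric]
    by (simp add: diag_step_def diag_coeff_def)
  then show ?thesis using 0 by (simp add: algebra_simps)
qed

text \<open>With first exponent 0, index 2 takes over the pairing: \<open>S\<close> runs through the
  subsets of {3} and is matched with \<open>S\<close> together with 2.\<close>

lemma macmahon_case2:
  "Ycoeff 0 (Suc b) c (0, Suc b, c) = diag_step 1 diag_coeff (0, Suc b, c)"
proof -
  note act = app_Y_Ycoeff p_power_collect M_p_power[of "M i j" for i j]
    M_p_power[of "minor i j k l" for i j k l] M_p_power[of qdet]
  define V where "V = (if c = 0 then 0 else p ^ Suc b * (M I2 I3 * Ycoeff 0 b c (0, Suc b, c - 1)))"
  have "p ^ 0 * Ycoeff 0 (Suc b) c (0, Suc b, c) = M I2 I2 * Ycoeff 0 b c (0, b, c) + V"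
    unfolding app_Y_Ycoeff(2)[symmetric] by (simp add: app_Y V_def M_p_power[of "M i j"
        for i j] del: power_Suc)
  moreover have "(if c = 0 then 0 else M I3 I3 * Ycoeff 0 (Suc b) (c - 1) (0, Suc b, c - 1))
      - (if c = 0 then 0 else minor I2 I3 I2 I3 * Ycoeff 0 b (c - 1) (0, b, c - 1)) = V"
  proof (cases c)
    case (Suc c')
    have "M I2 I3 * app (plane.Y I3) (Ycoeff 0 b c') (0, Suc b, c')
        - q * (M I3 I3 * app (plane.Y I2) (Ycoeff 0 b c') (0, Suc b, c'))
      = 0 - q * (minor I2 I3 I2 I3 * app (plane_x p I2) (Ycoeff 0 b c') (0, Suc b, c'))"
      using app_laplace_rows2(3)[of I2 I3 "Ycoeff 0 b c'" "(0, Suc b, c')"] by simp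
    from p_times[OF this] show ?thesis
      by (simp add: act Suc V_def scalar_simps del: power_Suc)
  qed (simp add: V_def)
  ultimately show ?thesis by (simp add: diag_step_def diag_coeff_def) (simp add: algebra_simps
      split: if_splits)
qed

lemma macmahon_case3:
  "Ycoeff 0 0 (Suc c) (0, 0, Suc c) = diag_step 1 diag_coeff (0, 0, Suc c)"
proof -
  have "p ^ (0 + 0) * Ycoeff 0 0 (Suc c) (0, 0, Suc c) = M I3 I3 * Ycoeff 0 0 c (0, 0, c)"
    unfolding app_Y_Ycoeff(3)[symmetric] by (simp add: app_Y)
  then show ?thesis by (simp add: diag_step_def diag_coeff_def)
qed

text \<open>The quantum MacMahon theorem in each multidegree; the cases are distinguished by the
  first index with a positive exponent.\<close>

lemma diag_coeff_macmahon: "v \<noteq> (0, 0, 0) \<Longrightarrow> diag_coeff v = diag_step 1 diag_coeff v"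
proof -
  assume v: "v \<noteq> (0, 0, 0)"
  obtain a b c where abc: "v = (a, b, c)" by (cases v)
  show ?thesis
    using v unfolding abc diag_coeff_def[of "(a, b, c)"]
    by (cases a; cases b; cases c) (simp_all add: macmahon_case1 macmahon_case2 macmahon_case3)
qed

lemma diag_coeff_0: "diag_coeff (0, 0, 0) = 1"
  by (simp add: diag_coeff_def Ycoeff_def Ymon_def vacuum_def)

lemma Y_homogeneous:
  assumes "\<And>x y z. x + y + z \<noteq> n \<Longrightarrow> f (x, y, z) = 0" and "x + y + z \<noteq> Suc n"
  shows "app (plane.Y i) f (x, y, z) = 0"
  using assms(2) by (cases x; cases y; cases z) (auto simp: app_Y assms(1))

lemma Ycoeff_eq_0: "x + y + z \<noteq> a + b + c \<Longrightarrow> Ycoeff a b c (x, y, z) = 0"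
proof -
  have step: "\<forall>x y z. x + y + z \<noteq> n + k \<longrightarrow> app (plane.Y i ^ n * T) f (x, y, z) = 0"
    if "\<forall>x y z. x + y + z \<noteq> k \<longrightarrow> app T f (x, y, z) = 0" for i n k T and f :: "nat \<times> nat \<times> nat \<Rightarrow> 'b"
  proof (induction n)
    case 0
    show ?case using that by simp
  next
    case (Suc n)
    then show ?case
      by (auto intro!: Y_homogeneous[of "n + k"] simp: mult.assoc)
  qed
  assume "x + y + z \<noteq> a + b + c"
  moreover have "\<forall>x y z. x + y + z \<noteq> 0 \<longrightarrow> app 1 vacuum (x, y, z) = (0 :: 'b)"
    by (simp add: vacuum_def)
  note step[OF step[OF step[OF this, where i = I3 and n = c], where i = I2 and n = b],
      where i = I1 and n = a]
  ultimately show ?thesis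
    by (auto simp: Ycoeff_def Ymon_def mult.assoc)
qed

section \<open>The matrix of \<open>N\<close>-th powers and the recurrence with step
  \<open>N\<close>\<close>

lemma quantum_matrix_power:
  assumes "q ^ N = 1"
  shows "quantum_matrix 1 1 (\<lambda>i j. M i j ^ N)"
proof -
  have "M i j ^ N * M l m ^ N = M l m ^ N * M i j ^ N" for i j l m
    by (rule power_commuting_commutes, rule power_central[OF assms])
  then show ?thesis by unfold_locales simp_all
qed

lemma app_plane_x_power:
  "app (plane_x p I1 ^ n) f (a, b, c) = (if n \<le> a then f (a - n, b, c) else 0)"
  "app (plane_x p I2 ^ n) f (a, b, c) = (if n \<le> b then (p ^ a) ^ n * f (a, b - n, c) else 0)"
  "app (plane_x p I3 ^ n) f (a, b, c) = (if n \<le> c then (p ^ (a + b)) ^ n * f (a, b, c - n) else 0)"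
proof -
  show "app (plane_x p I1 ^ n) f (a, b, c) = (if n \<le> a then f (a - n, b, c) else 0)"
    by (induction n arbitrary: a) auto
  show "app (plane_x p I2 ^ n) f (a, b, c) = (if n \<le> b then (p ^ a) ^ n * f (a, b - n, c) else 0)"
    by (induction n arbitrary: b) (auto simp: mult.assoc)
  show "app (plane_x p I3 ^ n) f (a, b, c) = (if n \<le> c then (p ^ (a + b)) ^ n * f (a, b, c - n)
      else 0)"
    by (induction n arbitrary: c) (auto simp: mult.assoc)
qed

text \<open>\<open>Y i ^ N\<close> commutes with every \<open>Y j\<close> and acts on the variables
  \<open>x j ^ N\<close> as the coaction of the matrix of \<open>N\<close>-th powers. So the whole
  monomial is one of that coaction times the remainder \<open>Ymon r1 r2 r3\<close>.\<close>

lemma diag_coeff_frobenius_mult: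
  assumes qN: "q ^ N = 1" and N: "0 < N"
    and vanish: "\<And>k. 0 < k \<Longrightarrow> k < N \<Longrightarrow> qbinomial (q ^ 2) N k = 0"
    and r: "r1 < N" "r2 < N" "r3 < N"
  shows "diag_coeff (N * a + r1, N * b + r2, N * c + r3)
    = quantum_matrix.diag_coeff 1 (\<lambda>i j. M i j ^ N) (a, b, c) * diag_coeff (r1, r2, r3)"
proof -
  interpret P: quantum_matrix 1 1 "\<lambda>i j. M i j ^ N"
    by (rule quantum_matrix_power[OF qN])
  \<comment> \<open>Only exponents in the residue class of (r1, r2, r3) modulo \<open>N\<close> are
    recorded; the operators \<open>Y i ^ N\<close> change exponents by multiples of \<open>N\<close>
    and so respect the class.\<close>
  define lifts where "lifts g g' \<longleftrightarrow>
    (\<forall>x y z. g (N * x + r1, N * y + r2, N * z + r3) = g' (x, y, z) * diag_coeff (r1, r2, r3))"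
    for g g' :: "nat \<times> nat \<times> nat \<Rightarrow> 'b"
  have pN: "(p ^ n) ^ N = 1" for n
    using p_power_N[OF qN] by (metis power_mult mult.commute power_one)
  have le: "(N \<le> N * x + s) = (x \<noteq> 0)" "x \<noteq> 0 \<Longrightarrow> N * x + s - N = N * (x - 1) + s"
    if "s < N" for x s
    using that by (cases x; simp)+
  interpret PP: quantum_plane_coaction "scal 1" "scal 1" "\<lambda>i j. scal (M i j ^ N)" "plane_x 1"
    by (rule P.quantum_plane_coaction_scal)
  have vanish': "qbinomial (scal q ^ 2 :: (nat \<times> nat \<times> nat, 'b) endo) N k = 0" if "0 < k" "k < N"
      for k
    using vanish[OF that] by (metis scal_qbinomial scal_power scal_hom(1))
  have Y_lifts: "lifts (app (plane.Y i ^ N) g) (app (PP.Y i) g')" if "lifts g g'" for i g g'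
  proof -
    have "app (plane.Y i ^ N) g v = M i I1 ^ N * app (plane_x p I1 ^ N) g v
        + M i I2 ^ N * app (plane_x p I2 ^ N) g v + M i I3 ^ N * app (plane_x p I3 ^ N) g v" for v
      by (subst plane.Y_power[OF N]) (rule vanish', simp_all flip: scal_power)
    moreover have h: "g (N * x + r1, N * y + r2, N * z + r3)
        = g' (x, y, z) * diag_coeff (r1, r2, r3)" for x y z
      using that by (simp add: lifts_def)
    note h h[of 0, simplified] h[of _ 0, simplified] h[of _ _ 0, simplified] h[of 0 0, simplified]
      h[of 0 _ 0, simplified] h[of _ 0 0, simplified]
    ultimately show ?thesis
      unfolding lifts_def by (auto simp: P.app_Y app_plane_x_power pN le r distrib_right mult.assoc)
  qed
  have Y_pow_lifts: "lifts (app ((plane.Y i ^ N) ^ n * T) g) (app (PP.Y i ^ n * T') g')"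
    if "lifts (app T g) (app T' g')" for i n g g' T T'
    using that by (induction n) (auto simp: mult.assoc intro!: Y_lifts)
  have commute: "plane.Y i ^ s * (plane.Y j ^ N) ^ n = (plane.Y j ^ N) ^ n * plane.Y i ^ s"
      for i j s n
    by (intro power_commuting_commutes power_commuting_commutes[symmetric] plane.Y_power_commute)
      (use qN in \<open>simp flip: scal_power add: scal_hom\<close>)
  have split: "plane.Y i ^ (N * n + s) = (plane.Y i ^ N) ^ n * plane.Y i ^ s" for i n s
    by (simp add: power_add power_mult)
  have "Ymon (N * a + r1) (N * b + r2) (N * c + r3)
      = (plane.Y I1 ^ N) ^ a * ((plane.Y I2 ^ N) ^ b * ((plane.Y I3 ^ N) ^ c * 1)) * Ymon r1 r2 r3"
    unfolding Ymon_def split mult.assoc mult_1_left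
    by (metis (no_types) commute mult.assoc)
  \<comment> \<open>A degree count: within the class only (r1, r2, r3) itself has the degree of
    \<open>Ymon r1 r2 r3\<close>.\<close>
  moreover have "lifts (app 1 (Ycoeff r1 r2 r3)) (app 1 vacuum)"
    using N by (auto simp: lifts_def vacuum_def diag_coeff_def intro!: Ycoeff_eq_0)
  note Y_pow_lifts[OF Y_pow_lifts[OF Y_pow_lifts[OF this, where i = I3 and n = c],
      where i = I2 and n = b], where i = I1 and n = a]
  ultimately show ?thesis
    by (simp add: lifts_def diag_coeff_def P.diag_coeff_def P.Ycoeff_def P.Ymon_def Ycoeff_def
        mult.assoc)
qed

text \<open>The MacMahon recurrence of the matrix of \<open>N\<close>-th powers, at the quotients of
  the exponents by \<open>N\<close>, times the common factor of the remainders. The last hypothesis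
  makes some quotient positive.\<close>

lemma diag_coeff_frobenius:
  assumes qN: "q ^ N = 1" and N: "0 < N"
    and vanish: "\<And>k. 0 < k \<Longrightarrow> k < N \<Longrightarrow> qbinomial (q ^ 2) N k = 0"
    and v: "N \<le> a \<or> N \<le> b \<or> N \<le> c"
  shows "diag_coeff (a, b, c) = quantum_matrix.diag_step 1 (\<lambda>i j. M i j ^ N) N diag_coeff (a, b, c)"
proof -
  interpret P: quantum_matrix 1 1 "\<lambda>i j. M i j ^ N"
    by (rule quantum_matrix_power[OF qN])
  define a' b' c' r1 r2 r3 where "a' = a div N" "b' = b div N" "c' = c div N"
    "r1 = a mod N" "r2 = b mod N" "r3 = c mod N"
  note defs = this
  have abc: "a = N * a' + r1" "b = N * b' + r2" "c = N * c' + r3" and r: "r1 < N" "r2 < N" "r3 < N"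
    using N by (simp_all add: defs)
  have le: "(N \<le> N * x + s) = (1 \<le> x)" "1 \<le> x \<Longrightarrow> N * x + s - N = N * (x - 1) + s" if "s < N" for x s
    using that by (cases x; simp)+
  have nz: "(a', b', c') \<noteq> (0, 0, 0)"
    using v unfolding abc le(1)[OF r(1)] le(1)[OF r(2)] le(1)[OF r(3)] by auto
  have mult: "diag_coeff (N * x + r1, N * y + r2, N * z + r3)
      = P.diag_coeff (x, y, z) * diag_coeff (r1, r2, r3)" for x y z
    by (rule diag_coeff_frobenius_mult[OF qN N _ r]) (rule vanish)
  have "diag_coeff (a, b, c) = P.diag_step 1 P.diag_coeff (a', b', c') * diag_coeff (r1, r2, r3)"
    unfolding abc mult P.diag_coeff_macmahon[OF nz, symmetric] ..
  then show ?thesis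
    unfolding abc
    by (simp add: P.diag_step_def le r mult distrib_right left_diff_distrib mult.assoc
        if_distrib[of "\<lambda>z. z * _"] cong: if_cong)
qed

end

section \<open>Linear recurrences of order three\<close>

text \<open>
  \<open>kseq s1 s2 s3 (n + 2)\<close> is the complete symmetric function \<open>h\<^sub>n\<close> of the roots of
  \<open>x\<^sup>3 - s1 x\<^sup>2 + s2 x - s3\<close>; the shift makes the recurrence valid from the start.
\<close>

fun kseq :: "'b::ring_1 \<Rightarrow> 'b \<Rightarrow> 'b \<Rightarrow> nat \<Rightarrow> 'b" where
  "kseq s1 s2 s3 0 = 0"
| "kseq s1 s2 s3 (Suc 0) = 0"
| "kseq s1 s2 s3 (Suc (Suc 0)) = 1"
| "kseq s1 s2 s3 (Suc (Suc (Suc n))) =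
     s1 * kseq s1 s2 s3 (Suc (Suc n)) - s2 * kseq s1 s2 s3 (Suc n) + s3 * kseq s1 s2 s3 n"

text \<open>The sum of the \<open>n\<close>-th powers of the roots: summing
  \<open>1 / (1 - r * t)\<close> over the roots \<open>r\<close> gives the numerator
  \<open>3 - 2 * s1 * t + s2 * t ^ 2\<close> over the denominator whose inverse generates the
  complete symmetric functions.\<close>

definition psum1 :: "'b::comm_ring_1 \<Rightarrow> 'b \<Rightarrow> 'b \<Rightarrow> nat \<Rightarrow> 'b" where
  "psum1 s1 s2 s3 n = 3 * kseq s1 s2 s3 (n + 2) - 2 * s1 * kseq s1 s2 s3 (n + 1)
      + s2 * kseq s1 s2 s3 n"

text \<open>
  In \<open>R[x]/(x\<^sup>3 - s1 x\<^sup>2 + s2 x - s3)\<close> the rows \<open>(a\<^sub>i, b\<^sub>i, c\<^sub>i)\<close> are the coordinates of \<open>x\<^sup>i y\<close>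
  with respect to \<open>1, x, x\<^sup>2\<close>, where \<open>y\<close> is the element for which \<open>k0, k1, k2\<close> are the last
  coordinates of \<open>y, x y, x\<^sup>2 y\<close>. For \<open>y = x\<^sup>n\<close> the form is the second elementary symmetric
  function of the \<open>n\<close>-th powers of the roots.
\<close>

definition psum2_form :: "'b::comm_ring_1 \<Rightarrow> 'b \<Rightarrow> 'b \<Rightarrow> 'b \<Rightarrow> 'b \<Rightarrow> 'b \<Rightarrow> 'b" where
  "psum2_form s1 s2 s3 k0 k1 k2 =
     (let a0 = k2 - s1 * k1 + s2 * k0; b0 = k1 - s1 * k0; c0 = k0;
          a1 = s3 * c0; b1 = a0 - s2 * c0; c1 = b0 + s1 * c0;
          a2 = s3 * c1; b2 = a1 - s2 * c1; c2 = b1 + s1 * c1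
      in (a0 * b1 - b0 * a1) + (a0 * c2 - c0 * a2) + (b1 * c2 - c1 * b2))"

definition psum2 :: "'b::comm_ring_1 \<Rightarrow> 'b \<Rightarrow> 'b \<Rightarrow> nat \<Rightarrow> 'b" where
  "psum2 s1 s2 s3 n = psum2_form s1 s2 s3 (kseq s1 s2 s3 n) (kseq s1 s2 s3 (n
      + 1)) (kseq s1 s2 s3 (n + 2))"

context
  fixes s1 s2 s3 :: "'b::comm_ring_1"
begin

private abbreviation k where "k \<equiv> kseq s1 s2 s3"

text \<open>The factors in terms of \<open>m\<close> are the coordinates of \<open>x ^ m\<close>
  with respect to 1, \<open>x\<close>, \<open>x ^ 2\<close> modulo the cubic; the identity compares
  last coordinates in the product of \<open>x ^ n\<close> and \<open>x ^ m\<close>.\<close>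

lemma kseq_add:
  "k (n + m) = (k (m + 2) - s1 * k (m + 1) + s2 * k m) * k n + (k (m + 1) - s1 * k m) * k (n + 1)
     + k m * k (n + 2)"
proof (induction s1 s2 s3 n rule: kseq.induct)
  case (4 s1 s2 s3 n)
  let ?k = "kseq s1 s2 s3"
  have eq: "?k (Suc (Suc (Suc n)) + m) = s1 * ?k (Suc (Suc n) + m) - s2 * ?k (Suc n + m)
      + s3 * ?k (n + m)"
    and shift: "?k (Suc (Suc (Suc i))) = s1 * ?k (Suc (Suc i)) - s2 * ?k (Suc i) + s3 * ?k i" for i
    by simp_all
  show ?case
    unfolding eq 4 by (simp only: add_Suc_right add_Suc add_0_right One_nat_def numeral_2_eq_2
        shift)
      (simp only: algebra_simps)
qed (simp_all add: algebra_simps)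

text \<open>Cayley-Hamilton for multiplication by \<open>x ^ n\<close> modulo the cubic, applied to
  1 and to \<open>x\<close> and read off at the last coordinate. The determinant term vanishes
  because \<open>k 0\<close> and \<open>k 1\<close> are 0.\<close>

lemma kseq_cayley_hamilton:
  "k (3 * n) = psum1 s1 s2 s3 n * k (2 * n) - psum2 s1 s2 s3 n * k n"
  "k (3 * n + 1) = psum1 s1 s2 s3 n * k (2 * n + 1) - psum2 s1 s2 s3 n * k (n + 1)"
proof -
  have shift: "k (i + 3) = s1 * k (i + 2) - s2 * k (i + 1) + s3 * k i" for i
    by (simp add: numeral_3_eq_3)
  \<comment> \<open>In these three values both claims become polynomial identities over
    \<open>s1\<close>, \<open>s2\<close>, \<open>s3\<close>.\<close>
  define k0 k1 k2 where "k0 = k n" and "k1 = k (n + 1)" and "k2 = k (n + 2)"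
  have add: "k (i + n) = (k2 - s1 * k1 + s2 * k0) * k i + (k1 - s1 * k0) * k (i + 1)
      + k0 * k (i + 2)" for i
    using kseq_add[of i n] by (simp add: k0_def k1_def k2_def)
  have arith: "2 * n = n + n" "2 * n + 1 = (n + 1) + n" "2 * n + 2 = (n + 2) + n"
    "3 * n = 2 * n + n" "3 * n + 1 = (2 * n + 1) + n" "i + 1 + 1 = i + 2" "i + 1 + 2 = i + 3"
    "i + 2 + 1 = i + 3" "i + 2 + 2 = (i + 1) + 3" for i :: nat
    by simp_all
  have 2: "k (2 * n) = (k2 - s1 * k1 + s2 * k0) * k0 + (k1 - s1 * k0) * k1 + k0 * k2"
    unfolding arith(1) add by (simp only: k0_def k1_def k2_def)
  have 21: "k (2 * n + 1) = (k2 - s1 * k1 + s2 * k0) * k1 + (k1 - s1 * k0) * k2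
      + k0 * (s1 * k2 - s2 * k1 + s3 * k0)"
    unfolding arith(2) add by (simp only: arith(6-9) shift k0_def k1_def k2_def)
  have 22: "k (2 * n + 2) = (k2 - s1 * k1 + s2 * k0) * k2 + (k1 - s1 * k0) * (s1 * k2 - s2 * k1
      + s3 * k0)
      + k0 * (s1 * (s1 * k2 - s2 * k1 + s3 * k0) - s2 * k2 + s3 * k1)"
    unfolding arith(3) add by (simp only: arith(6-9) shift k0_def k1_def k2_def)
  have 3: "k (3 * n) = (k2 - s1 * k1 + s2 * k0) * k (2 * n) + (k1 - s1 * k0) * k (2 * n + 1)
      + k0 * k (2 * n + 2)"
    unfolding arith(4) add ..
  have 31: "k (3 * n + 1) = (k2 - s1 * k1 + s2 * k0) * k (2 * n + 1) + (k1 - s1 * k0) * k (2 * n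
      + 2)
      + k0 * (s1 * k (2 * n + 2) - s2 * k (2 * n + 1) + s3 * k (2 * n))"
    unfolding arith(5) add by (simp only: arith(6-9) shift)
  have p1: "psum1 s1 s2 s3 n = 3 * k2 - 2 * s1 * k1 + s2 * k0"
    by (simp add: psum1_def k0_def k1_def k2_def)
  have p2: "psum2 s1 s2 s3 n = psum2_form s1 s2 s3 k0 k1 k2"
    by (simp add: psum2_def k0_def k1_def k2_def)
  note k012 = k0_def[symmetric] k1_def[symmetric]
  show "k (3 * n) = psum1 s1 s2 s3 n * k (2 * n) - psum2 s1 s2 s3 n * k n"
    unfolding 3 22 21 2 p1 p2 psum2_form_def Let_def k012 by (simp add: algebra_simps)
  show "k (3 * n + 1) = psum1 s1 s2 s3 n * k (2 * n + 1) - psum2 s1 s2 s3 n * k (n + 1)"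
    unfolding 31 22 21 2 p1 p2 psum2_form_def Let_def k012 by (simp add: algebra_simps)
qed

text \<open>By Jacobi-Trudi this is the Schur polynomial of the partition (m - 2, n - 1) in the
  three roots. For \<open>m = 2 * N\<close> and \<open>n = N\<close> its highest weight is
  \<open>N - 1\<close> times the half sum of positive roots, the Steinberg weight.\<close>

definition casoratian :: "nat \<Rightarrow> nat \<Rightarrow> 'b" where
  "casoratian m n = k m * k (n + 1) - k (m + 1) * k n"

lemma casoratian_rec:
  "casoratian n n = 0"
  "casoratian (n + 3) (n + 1) = s1 * casoratian (n + 2) (n + 1) - s3 * casoratian (n + 1) n"
  "casoratian (m + 3) n = s1 * casoratian (m + 2) n - s2 * casoratian (m + 1) n
      + s3 * casoratian m n"
  by (simp_all add: casoratian_def algebra_simps numeral_3_eq_3 numeral_2_eq_2)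

text \<open>At the indices \<open>n + 2\<close> and \<open>n + 1\<close> stands the Schur polynomial
  of (n, n), the complete symmetric function of degree \<open>n\<close> of the pairwise products of
  the roots. Their elementary symmetric functions are \<open>s2\<close>, \<open>s1 * s3\<close> and
  \<open>s3 * s3\<close>.\<close>

lemma casoratian_diagonal_rec:
  "casoratian 2 1 = 1" "casoratian 3 2 = s2" "casoratian 4 3 = s2 * s2 - s1 * s3"
  "casoratian (n + 4) (n + 3) = s2 * casoratian (n + 3) (n + 2) - s1 * s3 * casoratian (n + 2) (n
      + 1)
     + s3 * s3 * casoratian (n + 1) n"
  by (simp_all add: casoratian_def algebra_simps eval_nat_numeral)

lemma psum1_rec:
  "psum1 s1 s2 s3 0 = 3" "psum1 s1 s2 s3 1 = s1" "psum1 s1 s2 s3 2 = s1 * s1 - 2 * s2"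
  "psum1 s1 s2 s3 (n + 3) = s1 * psum1 s1 s2 s3 (n + 2) - s2 * psum1 s1 s2 s3 (n + 1)
      + s3 * psum1 s1 s2 s3 n"
  by (simp_all add: psum1_def algebra_simps eval_nat_numeral)

text \<open>For the multiples of \<open>y\<close> by powers of \<open>x\<close>, the second
  elementary symmetric function of the conjugates is a combination of powers of the pairwise
  products of the roots, hence satisfies their recurrence. This holds for arbitrary
  \<open>y\<close>.\<close>

lemma psum2_form_shift:
  fixes k0 k1 k2 :: 'b
  defines "k3 \<equiv> s1 * k2 - s2 * k1 + s3 * k0"
  defines "k4 \<equiv> s1 * k3 - s2 * k2 + s3 * k1"
  defines "k5 \<equiv> s1 * k4 - s2 * k3 + s3 * k2"
  shows "psum2_form s1 s2 s3 k3 k4 k5 = s2 * psum2_form s1 s2 s3 k2 k3 k4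
    - s1 * s3 * psum2_form s1 s2 s3 k1 k2 k3 + s3 * s3 * psum2_form s1 s2 s3 k0 k1 k2"
  unfolding psum2_form_def Let_def k5_def k4_def k3_def by (simp add: algebra_simps)

lemma psum2_rec:
  "psum2 s1 s2 s3 0 = 3" "psum2 s1 s2 s3 1 = s2" "psum2 s1 s2 s3 2 = s2 * s2 - 2 * (s1 * s3)"
  "psum2 s1 s2 s3 (n + 3) = s2 * psum2 s1 s2 s3 (n + 2) - s1 * s3 * psum2 s1 s2 s3 (n + 1)
     + s3 * s3 * psum2 s1 s2 s3 n"
proof -
  show "psum2 s1 s2 s3 0 = 3" "psum2 s1 s2 s3 1 = s2" "psum2 s1 s2 s3 2 = s2 * s2 - 2 * (s1 * s3)"
    by (simp_all add: psum2_def psum2_form_def algebra_simps eval_nat_numeral)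
  show "psum2 s1 s2 s3 (n + 3) = s2 * psum2 s1 s2 s3 (n + 2) - s1 * s3 * psum2 s1 s2 s3 (n + 1)
     + s3 * s3 * psum2 s1 s2 s3 n"
    using psum2_form_shift[where ?k0.0 = "k n" and ?k1.0 = "k (n + 1)" and ?k2.0 = "k (n + 2)"]
    by (simp add: psum2_def eval_nat_numeral)
qed

end

section \<open>Evaluation of integer polynomials at commuting elements\<close>

definition rhom :: "('c::comm_ring_1 \<Rightarrow> 'b::ring_1) \<Rightarrow> bool" where
  "rhom h \<longleftrightarrow> h 1 = 1 \<and> (\<forall>a b. h (a + b) = h a + h b) \<and> (\<forall>a b. h (a * b) = h a * h b)"

lemma rhomD:
  assumes "rhom h"
  shows "h 1 = 1" "h (a + b) = h a + h b" "h (a * b) = h a * h b" "h 0 = 0" "h (a - b) = h a - h b"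
proof -
  show "h 1 = 1" "h (a * b) = h a * h b" and 2: "h (a + b) = h a + h b" for a b
    using assms by (auto simp: rhom_def)
  show "h 0 = 0" using 2[of 0 0] by simp
  show "h (a - b) = h a - h b" using 2[of "a - b" b] by (simp add: algebra_simps)
qed

definition peval :: "('c::comm_ring_1 \<Rightarrow> 'b::ring_1) \<Rightarrow> 'b \<Rightarrow> 'c poly \<Rightarrow> 'b" where
  "peval h s p = (\<Sum>i\<le>degree p. h (coeff p i) * s ^ i)"

lemma peval_0: "rhom h \<Longrightarrow> peval h s 0 = 0"
  by (simp add: peval_def rhomD)

lemma peval_pCons: "rhom h \<Longrightarrow> peval h s (pCons a p) = h a + peval h s p * s"
proof (cases "p = 0")
  case False
  assume h: "rhom h"
  show ?thesis
    using False unfolding peval_def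
    by (simp add: sum.atMost_Suc_shift sum_distrib_right mult.assoc power_commutes del:
        sum.atMost_Suc)
qed (simp add: peval_def rhomD)

lemma peval_commute:
  assumes h: "rhom h" and z: "\<And>c. z * h c = h c * z" "z * s = s * z"
  shows "z * peval h s p = peval h s p * z"
proof (induction p)
  case (pCons a p)
  have "z * (peval h s p * s) = peval h s p * (z * s)"
    using pCons.IH by (simp flip: mult.assoc)
  then show ?case
    using z by (simp add: peval_pCons[OF h] distrib_left distrib_right mult.assoc)
qed (simp add: peval_0 h)

lemma rhom_peval:
  assumes h: "rhom h" and s: "\<And>c. s * h c = h c * s"
  shows "rhom (peval h s)"
proof -
  note simps = peval_0[OF h] peval_pCons[OF h] rhomD[OF h]
  have add: "peval h s (a + b) = peval h s a + peval h s b" for a b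
    by (induction a b rule: poly_induct2) (simp_all add: simps distrib_right)
  have smult: "peval h s (smult c a) = h c * peval h s a" for c a
    by (induction a) (simp_all add: simps distrib_left mult.assoc)
  have comm: "s * peval h s a = peval h s a * s" for a
    by (rule peval_commute[OF h s refl])
  have "peval h s (a * b) = peval h s a * peval h s b" for a b
    by (induction a) (simp_all add: simps add smult distrib_right mult.assoc comm)
  with add show ?thesis
    by (simp add: rhom_def simps one_pCons)
qed

lemma peval_const: "rhom h \<Longrightarrow> peval h s [:c:] = h c"
  by (simp add: peval_pCons peval_0)

lemma peval_X: "rhom h \<Longrightarrow> peval h s [:0, 1:] = s"
  by (simp add: peval_pCons peval_0 rhomD)

lemma rhom_numeral: "rhom h \<Longrightarrow> h (numeral n) = numeral n"
proof -
  assume h: "rhom h"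
  have "h (of_nat n) = of_nat n" for n by (induction n) (simp_all add: rhomD[OF h])
  then show ?thesis by (metis of_nat_numeral)
qed

text \<open>The universal case: identities for \<open>kseq\<close>, \<open>psum1\<close> and
  \<open>psum2\<close> hold in this commutative ring and reach noncommutative rings through
  \<open>eval3\<close>.\<close>

abbreviation Z1 :: "int poly poly poly" where "Z1 \<equiv> [:[:[:0, 1:]:]:]"
abbreviation Z2 :: "int poly poly poly" where "Z2 \<equiv> [:[:0, 1:]:]"
abbreviation Z3 :: "int poly poly poly" where "Z3 \<equiv> [:0, 1:]"

definition eval3 :: "'b::ring_1 \<Rightarrow> 'b \<Rightarrow> 'b \<Rightarrow> int poly poly poly \<Rightarrow> 'b" where
  "eval3 s1 s2 s3 = peval (peval (peval of_int s1) s2) s3"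

locale commuting_triple =
  fixes s1 s2 s3 :: "'b::ring_1"
  assumes s12: "s1 * s2 = s2 * s1" and s13: "s1 * s3 = s3 * s1" and s23: "s2 * s3 = s3 * s2"
begin

lemma eval3_properties:
  shows rhom_eval3: "rhom (eval3 s1 s2 s3)"
    and eval3_vars: "eval3 s1 s2 s3 Z1 = s1" "eval3 s1 s2 s3 Z2 = s2" "eval3 s1 s2 s3 Z3 = s3"
    and eval3_commute: "\<And>z. z * s1 = s1 * z \<Longrightarrow> z * s2 = s2 * z \<Longrightarrow> z * s3 = s3 * z \<Longrightarrow>
      z * eval3 s1 s2 s3 P = eval3 s1 s2 s3 P * z"
proof -
  have 0: "rhom (of_int :: int \<Rightarrow> 'b)" by (simp add: rhom_def)
  have c0: "z * of_int c = of_int c * z" for z :: 'b and c by (rule mult_of_int_commute[symmetric])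
  have 1: "rhom (peval of_int s1)" by (rule rhom_peval[OF 0 c0])
  have c1: "z * peval of_int s1 c = peval of_int s1 c * z" if "z * s1 = s1 * z" for z c
    by (rule peval_commute[OF 0 c0 that])
  have 2: "rhom (peval (peval of_int s1) s2)"
    by (rule rhom_peval[OF 1]) (rule c1, simp add: s12)
  have c2: "z * peval (peval of_int s1) s2 c = peval (peval of_int s1) s2 c * z"
    if "z * s1 = s1 * z" "z * s2 = s2 * z" for z c
    by (rule peval_commute[OF 1 c1 that(2)]) (rule that(1))
  show "rhom (eval3 s1 s2 s3)"
    unfolding eval3_def by (rule rhom_peval[OF 2]) (rule c2, simp_all add: s13 s23)
  show "eval3 s1 s2 s3 Z1 = s1" "eval3 s1 s2 s3 Z2 = s2" "eval3 s1 s2 s3 Z3 = s3"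
    by (simp_all add: eval3_def peval_const peval_X 0 1 2)
  show "z * eval3 s1 s2 s3 P = eval3 s1 s2 s3 P * z"
    if "z * s1 = s1 * z" "z * s2 = s2 * z" "z * s3 = s3 * z" for z
    unfolding eval3_def by (rule peval_commute[OF 2 c2 that(3)]) (rule that)+
qed

lemmas eval3_hom = rhomD[OF rhom_eval3]

lemma eval3_commute_eval3:
  "eval3 s1 s2 s3 P * eval3 s1 s2 s3 Q = eval3 s1 s2 s3 Q * eval3 s1 s2 s3 P"
  by (metis eval3_hom(3) mult.commute)

lemma eval3_kseq: "eval3 s1 s2 s3 (kseq Z1 Z2 Z3 n) = kseq s1 s2 s3 n"
  by (induction "Z1" "Z2" "Z3" n rule: kseq.induct) (simp_all only: kseq.simps eval3_hom eval3_vars)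

end

section \<open>The Steinberg character\<close>

definition degree_sum :: "(nat \<times> nat \<times> nat \<Rightarrow> 'b::ring_1) \<Rightarrow> nat \<Rightarrow> 'b" where
  "degree_sum t n = (\<Sum>(a, b, c) | a + b + c = n. t (a, b, c))"

lemma finite_degree: "finite {(a, b, c). a + b + c = (n :: nat)}"
  by (rule finite_subset[of _ "{..n} \<times> {..n} \<times> {..n}"]) auto

lemma degree_sum_0: "degree_sum t 0 = t (0, 0, 0)"
proof -
  have "{(a, b, c). a + b + c = (0 :: nat)} = {(0, 0, 0)}" by auto
  then show ?thesis by (simp add: degree_sum_def)
qed

lemma degree_sum_shift:
  "(\<Sum>(a, b, c) | a + b + c = n. if i \<le> a \<and> j \<le> b \<and> k \<le> c then d * t (a - i, b - j, c - k) else 0)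
    = d * (if i + j + k \<le> n then degree_sum t (n - (i + j + k)) else 0)"
proof (cases "i + j + k \<le> n")
  case True
  have "(\<Sum>(a, b, c) | a + b + c = n. if i \<le> a \<and> j \<le> b \<and> k \<le> c then d * t (a - i, b - j, c - k)
      else 0)
      = (\<Sum>(a, b, c) | a + b + c = n \<and> i \<le> a \<and> j \<le> b \<and> k \<le> c. d * t (a - i, b - j, c - k))"
    by (rule sum.mono_neutral_cong_right[OF finite_degree]) (auto split: if_splits)
  also have "\<dots> = (\<Sum>(a, b, c) | a + b + c = n - (i + j + k). d * t (a, b, c))"
    by (rule sum.reindex_bij_witness[of _ "\<lambda>(a, b, c). (a + i, b + j, c + k)" "\<lambda>(a, b, c). (a
        - i, b - j, c - k)"])
      (use True in auto)
  finally show ?thesis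
    using True by (simp add: degree_sum_def sum_distrib_left split_def)
next
  case False
  then have "\<And>a b c. a + b + c = n \<Longrightarrow> \<not> (i \<le> a \<and> j \<le> b \<and> k \<le> c)" by auto
  with False show ?thesis by (auto intro!: sum.neutral)
qed

context quantum_matrix
begin

lemma degree_sum_step:
  assumes t: "\<And>a b c. a + b + c = n \<Longrightarrow> t (a, b, c) = diag_step N t (a, b, c)"
  shows "degree_sum t n = sigma1 * (if N \<le> n then degree_sum t (n - N) else 0)
    - sigma2 * (if 2 * N \<le> n then degree_sum t (n - 2 * N) else 0)
    + qdet * (if 3 * N \<le> n then degree_sum t (n - 3 * N) else 0)"
proof -
  let ?f = "\<lambda>d i j k (a, b, c). if i \<le> a \<and> j \<le> b \<and> k \<le> c then d * t (a - i, b - j, c - k) else 0"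
  have "degree_sum t n = (\<Sum>v | (case v of (a, b, c) \<Rightarrow> a + b + c = n).
      ?f (M I1 I1) N 0 0 v + ?f (M I2 I2) 0 N 0 v + ?f (M I3 I3) 0 0 N v
      - ?f (minor I1 I2 I1 I2) N N 0 v - ?f (minor I1 I3 I1 I3) N 0 N v
      - ?f (minor I2 I3 I2 I3) 0 N N v + ?f qdet N N N v)"
    unfolding degree_sum_def
    by (rule sum.cong) (auto simp: t diag_step_def cong: if_cong split del: if_split)
  also have "\<dots> = M I1 I1 * (if N \<le> n then degree_sum t (n - N) else 0)
      + M I2 I2 * (if N \<le> n then degree_sum t (n - N) else 0)
      + M I3 I3 * (if N \<le> n then degree_sum t (n - N) else 0)
      - minor I1 I2 I1 I2 * (if 2 * N \<le> n then degree_sum t (n - 2 * N) else 0)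
      - minor I1 I3 I1 I3 * (if 2 * N \<le> n then degree_sum t (n - 2 * N) else 0)
      - minor I2 I3 I2 I3 * (if 2 * N \<le> n then degree_sum t (n - 2 * N) else 0)
      + qdet * (if 3 * N \<le> n then degree_sum t (n - 3 * N) else 0)"
    unfolding sum.distrib sum_subtractf degree_sum_shift
    by (simp only: add_0_left add_0_right mult_2 add_ac numeral_3_eq_3 mult_Suc mult_0)
  finally show ?thesis
    by (simp only: sigma1_def sigma2_def distrib_right) (simp only: diff_diff_add add_ac)
qed

text \<open>Summing \<open>diag_coeff_macmahon\<close> over a degree gives the recurrence of
  \<open>kseq\<close>, whose zeros at 0 and 1 stand for the degrees -2 and -1.\<close>

lemma degree_sum_diag_coeff: "n + 2 = m \<Longrightarrow> degree_sum diag_coeff n = kseq sigma1 sigma2 qdet m"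
proof (induction n arbitrary: m rule: less_induct)
  case (less n)
  show ?case
  proof (cases n)
    case 0
    then show ?thesis using less.prems by (simp add: degree_sum_0 diag_coeff_0 eval_nat_numeral
        flip: less.prems)
  next
    case (Suc n')
    have "degree_sum diag_coeff n = sigma1 * (if 1 \<le> n then degree_sum diag_coeff (n - 1) else 0)
      - sigma2 * (if 2 * 1 \<le> n then degree_sum diag_coeff (n - 2 * 1) else 0)
      + qdet * (if 3 * 1 \<le> n then degree_sum diag_coeff (n - 3 * 1) else 0)"
      by (rule degree_sum_step, rule diag_coeff_macmahon) (auto simp: Suc)
    also have "(if 1 \<le> n then degree_sum diag_coeff (n - 1) else 0) = kseq sigma1 sigma2 qdet (n'
        + 2)"
      using less.IH[of "n - 1"] Suc by simp
    also have "(if 2 * 1 \<le> n then degree_sum diag_coeff (n - 2 * 1) else 0)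
        = kseq sigma1 sigma2 qdet (n' + 1)"
      using less.IH[of "n - 2"] Suc by (cases n') auto
    also have "(if 3 * 1 \<le> n then degree_sum diag_coeff (n - 3 * 1) else 0)
        = kseq sigma1 sigma2 qdet n'"
    proof (cases "n' < 2")
      case True
      then show ?thesis by (auto simp: Suc less_2_cases_iff)
    next
      case False
      then obtain m where "n' = m + 2" by (metis add.commute le_Suc_ex not_less)
      then show ?thesis using less.IH[of "n - 3"] Suc by simp
    qed
    finally show ?thesis by (simp add: Suc flip: less.prems)
  qed
qed

lemma sigma_commute_power:
  assumes "q ^ N = 1"
  shows "M i j ^ N * sigma1 = sigma1 * M i j ^ N" "M i j ^ N * sigma2 = sigma2 * M i j ^ N"
    "M i j ^ N * qdet = qdet * M i j ^ N"
proof -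
  note c = power_central[OF assms, symmetric]
  have c2: "M i j ^ N * (M k l * z) = M k l * (M i j ^ N * z)" for k l z
    using c[of i j k l] by (simp flip: mult.assoc)
  have cq: "M i j ^ N * (q * z) = q * (M i j ^ N * z)" for z
    by (simp add: q_central flip: mult.assoc)
  show "M i j ^ N * sigma1 = sigma1 * M i j ^ N"
    by (simp add: sigma1_def distrib_left distrib_right c)
  show "M i j ^ N * sigma2 = sigma2 * M i j ^ N"
    by (simp add: sigma2_def minor_def distrib_left distrib_right left_diff_distrib
        right_diff_distrib c c2 cq mult.assoc)
  show "M i j ^ N * qdet = qdet * M i j ^ N"
    by (rule power_commuting_commutes) (rule qdet_central)
qed

lemma commuting_triple_sigma: "commuting_triple sigma1 sigma2 qdet"
proof
  have c: "M i j * (qdet * z) = qdet * (M i j * z)" for i j z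
    by (simp add: qdet_central flip: mult.assoc)
  have cq: "qdet * (q * z) = q * (qdet * z)" for z
    by (simp add: q_central flip: mult.assoc)
  show "sigma1 * sigma2 = sigma2 * sigma1" by (rule sigma1_sigma2)
  show "sigma1 * qdet = qdet * sigma1"
    by (simp add: sigma1_def distrib_left distrib_right qdet_central)
  show "sigma2 * qdet = qdet * sigma2"
    by (simp add: sigma2_def minor_def distrib_left distrib_right left_diff_distrib
        right_diff_distrib qdet_central c cq mult.assoc)
qed

text \<open>At \<open>3 * N\<close> and \<open>3 * N + 1\<close>, the recurrence with step
  \<open>N\<close> and \<open>kseq_cayley_hamilton\<close> give two homogeneous linear equations for
  the two differences. The Casoratian is, up to sign, their determinant.\<close>

lemma steinberg_annihilates:
  assumes qN: "q ^ N = 1" and N: "0 < N"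
    and vanish: "\<And>k. 0 < k \<Longrightarrow> k < N \<Longrightarrow> qbinomial (q ^ 2) N k = 0"
  defines "D1 \<equiv> quantum_matrix.sigma1 (\<lambda>i j. M i j ^ N)"
    and "D2 \<equiv> quantum_matrix.sigma2 1 (\<lambda>i j. M i j ^ N)"
    and "ev \<equiv> eval3 sigma1 sigma2 qdet"
  shows "ev (casoratian Z1 Z2 Z3 (2 * N) N) * (D1 - ev (psum1 Z1 Z2 Z3 N)) = 0"
    and "ev (casoratian Z1 Z2 Z3 (2 * N) N) * (D2 - ev (psum2 Z1 Z2 Z3 N)) = 0"
proof -
  interpret P: quantum_matrix 1 1 "\<lambda>i j. M i j ^ N"
    by (rule quantum_matrix_power[OF qN])
  interpret S: commuting_triple sigma1 sigma2 qdet
    by (rule commuting_triple_sigma)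
  let ?k = "kseq sigma1 sigma2 qdet" and ?K = "kseq Z1 Z2 Z3"
  \<comment> \<open>From degree \<open>3 * N - 2\<close> on, every triple of exponents has an entry
    at least \<open>N\<close>, as \<open>diag_coeff_frobenius\<close> requires.\<close>
  have step: "degree_sum diag_coeff n = D1 * (if N \<le> n then degree_sum diag_coeff (n - N) else 0)
      - D2 * (if 2 * N \<le> n then degree_sum diag_coeff (n - 2 * N) else 0)
      + P.qdet * (if 3 * N \<le> n then degree_sum diag_coeff (n - 3 * N) else 0)" if "3 * N \<le> n + 2"
          for n
    unfolding D1_def D2_def
    by (rule P.degree_sum_step, rule diag_coeff_frobenius[OF qN N vanish]) (use that N in auto)
  \<comment> \<open>The third term is a multiple of \<open>?k 0\<close> or \<open>?k 1\<close>,
    hence zero.\<close>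
  have kN: "?k m = D1 * ?k (m - N) - D2 * ?k (m - 2 * N)" if "m = 3 * N \<or> m = 3 * N + 1" for m
  proof -
    have k: "(if j \<le> m - 2 then degree_sum diag_coeff (m - 2 - j) else 0) = ?k (m - j)" if "j \<le> m"
        for j
    proof (cases "j \<le> m - 2")
      case True
      moreover have "2 \<le> m" using \<open>m = 3 * N \<or> m = 3 * N + 1\<close> N by auto
      ultimately show ?thesis using degree_sum_diag_coeff[of "m - 2 - j" "m - j"] by simp
    next
      case False
      with that have "m - j = 0 \<or> m - j = 1" by auto
      with False show ?thesis by auto
    qed
    have m: "N \<le> m" "2 * N \<le> m" "3 * N \<le> m" "3 * N \<le> m - 2 + 2" "m - 2 + 2 = m" "?k (m - 3 * N) = 0"
      using that N by auto
    show ?thesis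
      using step[OF m(4)] degree_sum_diag_coeff[OF m(5)]
          by (simp add: k[OF m(1)] k[OF m(2)] k[OF m(3)] m(6))
  qed
  have k: "ev (?K n) = ?k n" for n
    unfolding ev_def by (rule S.eval3_kseq)
  note hom = S.eval3_hom[folded ev_def]
  have 1: "D1 * ev (?K (2 * N)) - D2 * ev (?K N) = ev (psum1 Z1 Z2 Z3 N) * ev (?K (2 * N))
      - ev (psum2 Z1 Z2 Z3 N) * ev (?K N)"
    using kN[of "3 * N"] arg_cong[OF kseq_cayley_hamilton(1)[of Z1 Z2 Z3 N], of ev]
    by (simp add: hom(3,5) k)
  have 2: "D1 * ev (?K (2 * N + 1)) - D2 * ev (?K (N + 1))
      = ev (psum1 Z1 Z2 Z3 N) * ev (?K (2 * N + 1)) - ev (psum2 Z1 Z2 Z3 N) * ev (?K (N + 1))"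
    using kN[of "3 * N + 1"] arg_cong[OF kseq_cayley_hamilton(2)[of Z1 Z2 Z3 N], of ev]
    by (simp only: hom(3,5) k) (simp add: Suc_diff_le)
  define d1 d2 where "d1 = D1 - ev (psum1 Z1 Z2 Z3 N)" and "d2 = D2 - ev (psum2 Z1 Z2 Z3 N)"
  define a b a' b' where "a = ev (?K (2 * N))" and "b = ev (?K N)" and "a' = ev (?K (2 * N + 1))"
    and "b' = ev (?K (N + 1))"
  have 1: "d1 * a = d2 * b" and 2: "d1 * a' = d2 * b'"
    using 1 2 by (simp_all add: d1_def d2_def a_def b_def a'_def b'_def left_diff_distrib
        algebra_simps)
  have comm_ev: "ev P * ev Q = ev Q * ev P" for P Q
    unfolding ev_def by (rule S.eval3_commute_eval3)
  have comm_power: "M i j ^ N * ev P = ev P * M i j ^ N" for i j P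
    unfolding ev_def by (rule S.eval3_commute) (rule sigma_commute_power[OF qN])+
  have comm_power2: "M i j ^ N * (ev P * z) = ev P * (M i j ^ N * z)" for i j z P
    by (simp add: comm_power flip: mult.assoc)
  have "D1 * ev P = ev P * D1" "D2 * ev P = ev P * D2" for P
    by (simp_all add: D1_def D2_def P.sigma1_def P.sigma2_def P.minor_def comm_power comm_power2
        distrib_left distrib_right left_diff_distrib right_diff_distrib mult.assoc)
  then have comm: "d1 * ev P = ev P * d1" "d2 * ev P = ev P * d2" for P
    by (simp_all add: d1_def d2_def left_diff_distrib right_diff_distrib comm_ev)
  have c: "ev (casoratian Z1 Z2 Z3 (2 * N) N) = a * b' - a' * b"
    by (simp add: casoratian_def hom a_def b_def a'_def b'_def)
  have comm': "d1 * a = a * d1" "d1 * a' = a' * d1" "d2 * b = b * d2" "d2 * b' = b' * d2"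
    by (simp_all add: a_def b_def a'_def b'_def comm)
  have ev: "a * b' = b' * a" "a' * b = b * a'" "b * b' = b' * b" "a * a' = a' * a"
    unfolding a_def b_def a'_def b'_def by (rule comm_ev)+
  \<comment> \<open>Cramer's rule; evaluated polynomials commute with each other and with
    \<open>d1\<close> and \<open>d2\<close>.\<close>
  have "a * b' * d1 = b' * (d1 * a)" "a' * b * d1 = b * (d1 * a')"
    by (simp_all add: ev(1,2) comm' mult.assoc)
  moreover have "b' * (d2 * b) = b * (d2 * b')"
    by (simp add: comm' ev(3) flip: mult.assoc)
  ultimately show "ev (casoratian Z1 Z2 Z3 (2 * N) N) * (D1 - ev (psum1 Z1 Z2 Z3 N)) = 0"
    by (simp add: c left_diff_distrib 1 2 flip: d1_def)
  have "a * b' * d2 = a * (d2 * b')" "a' * b * d2 = a' * (d2 * b)"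
    by (simp_all add: comm' mult.assoc)
  moreover have "a * (d1 * a') = a' * (d1 * a)"
    by (simp add: comm' ev(4) flip: mult.assoc)
  ultimately show "ev (casoratian Z1 Z2 Z3 (2 * N) N) * (D2 - ev (psum2 Z1 Z2 Z3 N)) = 0"
    by (simp add: c left_diff_distrib flip: d2_def 1 2)
qed

end

section \<open>Perturbation of the diagonal\<close>

lemma peval_rel:
  fixes R :: "'b::ring_1 \<Rightarrow> 'd::ring_1 \<Rightarrow> bool"
  assumes R: "R 0 0" "R 1 1" "\<And>a b c d. R a b \<Longrightarrow> R c d \<Longrightarrow> R (a + c) (b + d)"
      "\<And>a b c d. R a b \<Longrightarrow> R c d \<Longrightarrow> R (a * c) (b * d)"
    and h: "\<And>c. R (h c) (h' c)" and s: "R s s'"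
  shows "R (peval h s p) (peval h' s' p)"
proof -
  have pow: "R (s ^ n) (s' ^ n)" for n by (induction n) (simp_all add: R s)
  have "R (\<Sum>i\<in>I. h (coeff p i) * s ^ i) (\<Sum>i\<in>I. h' (coeff p i) * s' ^ i)" for I
    by (induction I rule: infinite_finite_induct) (simp_all add: R h pow)
  then show ?thesis by (simp add: peval_def)
qed

text \<open>A relation instead of a homomorphism, because it is applied to setting
  \<open>y = 0\<close> and to boundedness of degree, which are not maps defined on all
  operators.\<close>

lemma eval3_rel:
  fixes R :: "'b::ring_1 \<Rightarrow> 'd::ring_1 \<Rightarrow> bool"
  assumes R: "R 0 0" "R 1 1" "\<And>a b c d. R a b \<Longrightarrow> R c d \<Longrightarrow> R (a + c) (b + d)"
      "\<And>a b c d. R a b \<Longrightarrow> R c d \<Longrightarrow> R (a * c) (b * d)" "\<And>a b. R a b \<Longrightarrow> R (- a) (- b)"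
    and s: "R s1 t1" "R s2 t2" "R s3 t3"
  shows "R (eval3 s1 s2 s3 P) (eval3 t1 t2 t3 P)"
proof -
  have nat: "R (of_nat n) (of_nat n)" for n by (induction n) (simp_all add: R)
  have int: "R (of_int c) (of_int c)" for c by (cases c rule: int_cases2) (simp_all add: nat R(5))
  have 1: "R (peval of_int s1 c) (peval of_int t1 c)" for c
    by (rule peval_rel[where R = R]) (simp_all add: R s int)
  have 2: "R (peval (peval of_int s1) s2 c) (peval (peval of_int t1) t2 c)" for c
    by (rule peval_rel[where R = R]) (simp_all add: R s 1)
  show ?thesis unfolding eval3_def
    by (rule peval_rel[where R = R]) (simp_all add: R s 2)
qed

section \<open>Operators filtered by a degree in the third argument\<close>

lift_definition shift_op :: "nat \<Rightarrow> nat \<Rightarrow> (nat \<times> nat \<times> nat, 'b::ring_1) endo" is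
  "\<lambda>a b f (n, m, k). f (n + a, m + b, k)"
  by auto

text \<open>Multiplication by a new variable of degree \<open>d\<close>. The weights depend on the
  first two arguments, so that \<open>shift_op a b\<close> passes it at the cost of
  \<open>u ^ a * v ^ b\<close>.\<close>

lift_definition weight_op :: "'b::ring_1 \<Rightarrow> 'b \<Rightarrow> nat \<Rightarrow> (nat \<times> nat \<times> nat, 'b) endo" is
  "\<lambda>u v d f (n, m, k). if k < d then 0 else u ^ n * v ^ m * f (n, m, k - d)"
  by (auto simp: distrib_left mult.assoc)

lemma app_shift_op [simp]: "app (shift_op a b) f (n, m, k) = f (n + a, m + b, k)"
  by transfer simp

lemma app_weight_op [simp]:
  "app (weight_op u v d) f (n, m, k) = (if k < d then 0 else u ^ n * v ^ m * f (n, m, k - d))"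
  by transfer simp

lemma shift_op_add: "shift_op a b * shift_op c d = shift_op (a + c) (b + d)"
  by (rule endo_eqI3) (simp add: add_ac)

lemma shift_op_0: "shift_op 0 0 = 1"
  by (rule endo_eqI3) simp

lemma shift_op_scal: "shift_op a b * scal z = scal z * shift_op a b"
  by (rule endo_eqI3) simp

text \<open>The degree of an operator is the amount by which it raises a bound on the support in the
  third argument; the strict form lets the zero operator have the bound 0.\<close>

definition degree_lt :: "nat \<Rightarrow> (nat \<times> nat \<times> nat, 'b::ring_1) endo \<Rightarrow> bool" where
  "degree_lt d T \<longleftrightarrow> (\<forall>f K. (\<forall>n m k. K < k \<longrightarrow> f (n, m, k) = 0) \<longrightarrow>
     (\<forall>n m k. K + d \<le> k \<longrightarrow> app T f (n, m, k) = 0))"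

lemma degree_ltD: "degree_lt d T \<Longrightarrow> (\<And>n m k. K < k \<Longrightarrow> f (n, m, k) = 0) \<Longrightarrow> K + d \<le> k
    \<Longrightarrow> app T f (n, m, k) = 0"
  unfolding degree_lt_def by blast

lemma degree_lt_mono: "degree_lt d T \<Longrightarrow> d \<le> e \<Longrightarrow> degree_lt e T"
  unfolding degree_lt_def by (meson add_left_mono order_trans)

lemma degree_lt_closed:
  "degree_lt 0 0" "degree_lt 1 1" "degree_lt 1 (scal z)"
  "degree_lt d T \<Longrightarrow> degree_lt d U \<Longrightarrow> degree_lt d (T + U)" "degree_lt d T \<Longrightarrow> degree_lt d U
      \<Longrightarrow> degree_lt d (T - U)"
  "degree_lt d T \<Longrightarrow> degree_lt d (- T)"
  by (auto simp: degree_lt_def)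

lemma degree_lt_mult:
  assumes T: "degree_lt (Suc d) T" and U: "degree_lt e U"
  shows "degree_lt (d + e) (T * U)"
  unfolding degree_lt_def
proof (intro allI impI)
  fix f :: "nat \<times> nat \<times> nat \<Rightarrow> 'a" and K n m k
  assume f: "\<forall>n m k. K < k \<longrightarrow> f (n, m, k) = 0" and k: "K + (d + e) \<le> k"
  show "app (T * U) f (n, m, k) = 0"
  proof (cases "K + e")
    \<comment> \<open>No degree is left for \<open>app U f\<close>, so it vanishes; in the other
      case \<open>L\<close> bounds its degree.\<close>
    case 0
    have "app U f (n, m, k) = 0" for n m k
      using U f by (rule_tac degree_ltD[of e U K f]) (auto simp: 0)
    then have "app U f = (\<lambda>_. 0)" by auto
    then show ?thesis by (simp add: app_zero)
  next
    case (Suc L)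
    have "app U f (n, m, k) = 0" if "L < k" for n m k
      using U f that Suc by (rule_tac degree_ltD[of e U K f]) auto
    then show ?thesis
      using k Suc by (auto intro: degree_ltD[OF T, of L])
  qed
qed

locale leading_term = quantum_parameter q p for q p :: "'b::ring_1"
begin

text \<open>The term of degree \<open>d\<close> is that of a monomial with exponents
  \<open>a\<close> and \<open>b\<close> in the variables called \<open>y1\<close> and
  \<open>y3\<close> below; it acts by units.\<close>

definition leading :: "nat \<Rightarrow> nat \<Rightarrow> nat \<Rightarrow> (nat \<times> nat \<times> nat, 'b) endo \<Rightarrow> bool" where
  "leading d a b T \<longleftrightarrow> degree_lt (Suc d) T \<and> (\<forall>f K. (\<forall>n m k. K < k \<longrightarrow> f (n, m, k) = 0) \<longrightarrow>
     (\<forall>n m. app T f (n, m, K + d) = p ^ (a * n) * q ^ (b * m) * f (n, m, K)))"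

lemma leading_degree_lt: "leading d a b T \<Longrightarrow> d < e \<Longrightarrow> degree_lt e T"
  unfolding leading_def by (metis Suc_leI degree_lt_mono)

lemma leading_add: "leading d a b T \<Longrightarrow> degree_lt d U \<Longrightarrow> leading d a b (T + U)"
proof -
  assume T: "leading d a b T" and U: "degree_lt d U"
  have "degree_lt (Suc d) (T + U)"
    using T degree_lt_mono[OF U, of "Suc d"] by (auto simp: leading_def degree_lt_closed)
  moreover have "app U f (n, m, K + d) = 0" if "\<forall>n m k. K < k \<longrightarrow> f (n, m, k) = 0"
    for f :: "nat \<times> nat \<times> nat \<Rightarrow> 'b" and K n m
    by (rule degree_ltD[OF U, of K]) (use that in auto)
  ultimately show ?thesis using T by (simp add: leading_def)
qed

lemma leading_diff: "leading d a b T \<Longrightarrow> degree_lt d U \<Longrightarrow> leading d a b (T - U)"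
  using leading_add[of d a b T "- U"] by (simp add: degree_lt_closed)

lemma leading_cong: "leading d a b T \<Longrightarrow> d = d' \<Longrightarrow> a = a' \<Longrightarrow> b = b' \<Longrightarrow> leading d' a' b' T"
  by simp

lemma leading_1: "leading 0 0 0 1"
  by (simp add: leading_def degree_lt_def)

lemma leading_mult:
  assumes T: "leading d a b T" and U: "leading e a' b' U"
  shows "leading (d + e) (a + a') (b + b') (T * U)"
proof -
  have comm: "q ^ i * (p ^ j * z) = p ^ j * (q ^ i * z)" for i j z
    using central_left[OF central_power[OF central_qp(2)]] .
  have degree_lt: "degree_lt (Suc d) T" "degree_lt (Suc e) U"
    using T U by (simp_all add: leading_def)
  have "app (T * U) f (n, m, K + (d + e)) = p ^ ((a + a') * n) * q ^ ((b + b') * m) * f (n, m, K)"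
    if f: "\<forall>n m k. K < k \<longrightarrow> f (n, m, k) = 0" for f :: "nat \<times> nat \<times> nat \<Rightarrow> 'b" and K n m
  proof -
    have g: "\<forall>n m k. K + e < k \<longrightarrow> app U f (n, m, k) = 0"
      using degree_lt(2) f by (auto intro: degree_ltD[of "Suc e" U K])
    then have "app T (app U f) (n, m, K + e + d) = p ^ (a * n) * q ^ (b * m) * app U f (n, m, K
        + e)"
      using T by (simp add: leading_def)
    also have "app U f (n, m, K + e) = p ^ (a' * n) * q ^ (b' * m) * f (n, m, K)"
      using U f by (simp add: leading_def)
    finally show ?thesis
      by (simp add: add_ac distrib_right power_add mult.assoc comm)
  qed
  with degree_lt_mult[OF degree_lt] show ?thesis
    by (simp add: leading_def)
qed

text \<open>If \<open>app D f\<close> were nonzero, its coefficient of highest degree would reappear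
  in \<open>app (T * D) f\<close> times a unit. The bound on \<open>D\<close> ensures that there is
  a highest degree.\<close>

lemma leading_regular:
  assumes T: "leading d a b T" and "T * D = 0" and D: "degree_lt e D"
    and f: "\<And>n m k. k \<noteq> 0 \<Longrightarrow> f (n, m, k) = 0"
  shows "app D f (n, m, k) = 0"
proof -
  define g where "g = app D f"
  have Tg: "app T g v = 0" for v
    using arg_cong[OF assms(2), of "\<lambda>S. app S f v"] by (simp add: g_def)
  have unit: "z = 0" if "p ^ i * q ^ j * z = 0" for i j z
  proof -
    have pow: "q ^ i * (p ^ i * z) = z" "p ^ i * (q ^ i * z) = z" for i and z :: 'b
    proof -
      have "p ^ i * (q ^ i * z) = z"
      proof (induction i arbitrary: z)
        case (Suc i)
        have "p ^ Suc i * (q ^ Suc i * z) = p * (p ^ i * (q ^ i * (q * z)))"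
          by (simp only: power_Suc2[of q] power_Suc[of p] mult.assoc)
        then show ?case by (simp add: Suc scalar_simps)
      qed simp
      then show "p ^ i * (q ^ i * z) = z" "q ^ i * (p ^ i * z) = z"
        by (simp_all add: central_left[OF central_power[OF central_qp(1)], symmetric])
    qed
    have "z = p ^ j * (q ^ i * (p ^ i * q ^ j * z))"
      by (simp add: pow mult.assoc)
    then show ?thesis using that by simp
  qed
  \<comment> \<open>The support bound \<open>L\<close> is lowered step by step to 0.\<close>
  have "(\<forall>n m k. L \<le> k \<longrightarrow> g (n, m, k) = 0) \<Longrightarrow> g (n, m, k) = 0" for L
  proof (induction L)
    case (Suc L)
    then have supp: "\<forall>n m k. L < k \<longrightarrow> g (n, m, k) = 0" by auto
    have "p ^ (a * n) * q ^ (b * m) * g (n, m, L) = 0" for n m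
      using T supp Tg by (metis leading_def)
    then have "\<forall>n m k. L \<le> k \<longrightarrow> g (n, m, k) = 0"
      using supp unit by (metis le_neq_implies_less)
    then show ?case by (rule Suc.IH)
  qed simp
  moreover have "\<forall>n m k. e \<le> k \<longrightarrow> g (n, m, k) = 0"
    unfolding g_def using f by (auto intro!: degree_ltD[OF D, of 0])
  ultimately show ?thesis by (simp add: g_def)
qed

end

section \<open>The perturbed quantum matrix\<close>

context quantum_matrix
begin

text \<open>
  The operators \<open>graded i j\<close> carry the degree of \<open>M i j\<close> with respect to the first and the third
  row and column as shifts in the first two arguments; there \<open>y1\<close> and \<open>y3\<close> act by powers of \<open>p\<close>
  and \<open>q\<close>, which produces the commutation relations needed for \<open>perturbed\<close>. The third argument
  is the degree in \<open>y\<close>.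
\<close>

definition y1 :: "(nat \<times> nat \<times> nat, 'b) endo" where "y1 = weight_op p 1 2"
definition y3 :: "(nat \<times> nat \<times> nat, 'b) endo" where "y3 = weight_op 1 q 1"

definition graded :: "idx \<Rightarrow> idx \<Rightarrow> (nat \<times> nat \<times> nat, 'b) endo" where
  "graded i j = scal (M i j) *
     shift_op (of_bool (i = I1) + of_bool (j = I1)) (of_bool (i = I3) + of_bool (j = I3))"

definition perturbed :: "idx \<Rightarrow> idx \<Rightarrow> (nat \<times> nat \<times> nat, 'b) endo" where
  "perturbed i j = graded i j + (if i = I1 \<and> j = I1 then y1 else 0) + (if i = I3 \<and> j = I3 then y3
      else 0)"

lemma q_power: "z * q ^ n = q ^ n * z" "z * (q ^ n * y) = q ^ n * (z * y)"
  by (rule centralD central_left, rule central_power, rule central_qp)+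

lemma y_rules:
  "y1 * scal z = scal z * y1" "y3 * scal z = scal z * y3" "y3 * y1 = y1 * y3"
  "shift_op a b * y1 = scal p ^ a * (y1 * shift_op a b)"
  "shift_op a b * y3 = scal q ^ b * (y3 * shift_op a b)"
proof -
  show "y1 * scal z = scal z * y1" "y3 * scal z = scal z * y3"
    unfolding y1_def y3_def by (rule endo_eqI3; simp add: M_p_power q_power)+
  show "y3 * y1 = y1 * y3"
    unfolding y1_def y3_def by (rule endo_eqI3; auto simp: M_p_power(2)[of "q ^ j"
        for j] diff_commute numeral_3_eq_3)
  show "shift_op a b * y1 = scal p ^ a * (y1 * shift_op a b)"
    unfolding y1_def by (rule endo_eqI3; simp add: add.commute flip: scal_power power_add
        mult.assoc)
  show "shift_op a b * y3 = scal q ^ b * (y3 * shift_op a b)"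
    unfolding y3_def by (rule endo_eqI3; simp add: add.commute flip: scal_power power_add
        mult.assoc)
qed

lemma y_rules_assoc:
  "y1 * (scal z * t) = scal z * (y1 * t)" "y3 * (scal z * t) = scal z * (y3 * t)" "y3 * (y1 * t)
      = y1 * (y3 * t)"
  "shift_op a b * (y1 * t) = scal p ^ a * (y1 * (shift_op a b * t))"
  "shift_op a b * (y3 * t) = scal q ^ b * (y3 * (shift_op a b * t))"
  "shift_op a b * (scal z * t) = scal z * (shift_op a b * t)"
  "shift_op a b * (shift_op c d * t) = shift_op (a + c) (b + d) * t"
  by (simp_all add: y_rules shift_op_scal shift_op_add flip: mult.assoc)

text \<open>The relations are homogeneous in rows and columns, so the shifts agree on both sides,
  and \<open>y1\<close>, \<open>y3\<close> pass the other entries as the entries (1, 1) and (3, 3)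
  must. The correction term of the diagonal relation never contains these two entries, whereas (2,
  2) occurs in it; hence only the former are perturbed.\<close>

lemma quantum_matrix_perturbed: "quantum_matrix (scal q) (scal p) perturbed"
proof -
  interpret E: quantum_matrix "scal q :: (nat \<times> nat \<times> nat, 'b) endo" "scal p" "\<lambda>i j. scal (M i j)"
    by (rule quantum_matrix_scal)
  note rules = perturbed_def graded_def E.straighten y_rules y_rules_assoc shift_op_scal
      shift_op_add shift_op_0
  show ?thesis
  proof
    fix i j l m :: idx
    show "perturbed i j * perturbed l j = scal p * (perturbed l j * perturbed i j)" if "l < i"
      using that by (elim idx_less_cases; hypsubst; cases j; simp add: rules)
    show "perturbed i j * perturbed i m = scal p * (perturbed i m * perturbed i j)" if "m < j"
      using that by (elim idx_less_cases; hypsubst; cases i; simp add: rules)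
    show "perturbed i j * perturbed l m = perturbed l m * perturbed i j" if "l < i" "j < m"
      using that by (elim idx_less_cases; hypsubst; simp add: rules)
    show "perturbed i j * perturbed l m = perturbed l m * perturbed i j
        - (scal q - scal p) * (perturbed l j * perturbed i m)" if "l < i" "m < j"
      using that by (elim idx_less_cases; hypsubst; simp add: rules)
  qed
qed

sublocale leading_term ..

text \<open>The matrix \<open>perturbed\<close> has eigenvalues of degree 2, 1 and 0 in the last variable.\<close>

lemma leading_perturbed:
  "leading 2 1 0 (perturbed I1 I1)" "leading 1 0 1 (perturbed I3 I3)"
  "\<not> (i = I1 \<and> j = I1) \<Longrightarrow> \<not> (i = I3 \<and> j = I3) \<Longrightarrow> degree_lt 1 (perturbed i j)"
proof -
  have g: "degree_lt 1 (graded i j)" for i j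
    by (auto simp: degree_lt_def graded_def)
  have y: "leading 2 1 0 y1" "leading 1 0 1 y3"
    by (auto simp: leading_def degree_lt_def y1_def y3_def)
  show "leading 2 1 0 (perturbed I1 I1)" "leading 1 0 1 (perturbed I3 I3)"
    using leading_add[OF y(1) degree_lt_mono[OF g, of 2 I1 I1]] leading_add[OF y(2) g[of I3 I3]]
    by (simp_all add: perturbed_def add.commute)
  show "degree_lt 1 (perturbed i j)" if "\<not> (i = I1 \<and> j = I1)" "\<not> (i = I3 \<and> j = I3)"
    using g that by (auto simp: perturbed_def)
qed

interpretation R: quantum_matrix "scal q" "scal p" perturbed
  by (rule quantum_matrix_perturbed)

interpretation RS: commuting_triple R.sigma1 R.sigma2 R.qdet
  by (rule R.commuting_triple_sigma)

lemma degree_lt_perturbed: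
  "degree_lt 3 (perturbed I1 I1)" "degree_lt 1 (perturbed I1 I2)" "degree_lt 1 (perturbed I1 I3)"
  "degree_lt 1 (perturbed I2 I1)" "degree_lt 1 (perturbed I2 I2)" "degree_lt 1 (perturbed I2 I3)"
  "degree_lt 1 (perturbed I3 I1)" "degree_lt 1 (perturbed I3 I2)" "degree_lt 2 (perturbed I3 I3)"
  by (rule leading_degree_lt[OF leading_perturbed(1)] leading_degree_lt[OF leading_perturbed(2)]
      leading_perturbed(3); simp)+

lemma degree_lt_times: "degree_lt d T \<Longrightarrow> degree_lt e U \<Longrightarrow> 0 < d \<Longrightarrow> degree_lt (d + e - 1) (T * U)"
  using degree_lt_mult[of "d - 1" T e U] by simp

text \<open>\<open>R.sigma1\<close> is led by \<open>perturbed I1 I1\<close> and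
  \<open>R.sigma2\<close> by the minor on the indices 1 and 3. No monomial of the determinant has
  degree above 3.\<close>

lemma leading_sigma:
  "leading 2 1 0 R.sigma1" "leading 3 1 1 R.sigma2" "degree_lt 4 R.qdet"
proof -
  note lows = degree_lt_perturbed degree_lt_closed(3)[of q]
  have "leading 2 1 0 (perturbed I1 I1 + (perturbed I2 I2 + perturbed I3 I3))"
    by (intro leading_add leading_perturbed degree_lt_closed(4) lows degree_lt_mono[OF lows(5)])
        simp
  then show "leading 2 1 0 R.sigma1" by (simp add: R.sigma1_def add.assoc)
  have q: "degree_lt 3 (scal q * (perturbed i j * perturbed k l))"
    if "degree_lt 1 (perturbed i j)" "degree_lt 1 (perturbed k l)" for i j k l
    by (rule degree_lt_mono[OF degree_lt_times[OF degree_lt_closed(3) degree_lt_times[OF that]]])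
        simp_all
  have 13: "leading 3 1 1 (R.minor I1 I3 I1 I3)"
    using leading_diff[OF leading_mult[OF leading_perturbed(1,2)], of
        "scal q * (perturbed I1 I3 * perturbed I3 I1)"] q lows
    by (simp add: R.minor_def numeral_3_eq_3 numeral_2_eq_2)
  have 12: "degree_lt 3 (R.minor I1 I2 I1 I2)"
    using degree_lt_closed(5)[OF degree_lt_times[OF lows(1,5)], of
        "scal q * (perturbed I1 I2 * perturbed I2 I1)"] q lows
    by (simp add: R.minor_def)
  have 23: "degree_lt 3 (R.minor I2 I3 I2 I3)"
    using degree_lt_closed(5)[OF degree_lt_mono[OF degree_lt_times[OF lows(5,9)]], of 3
        "scal q * (perturbed I2 I3 * perturbed I3 I2)"] q lows
    by (simp add: R.minor_def)
  have "leading 3 1 1 (R.minor I1 I3 I1 I3 + (R.minor I1 I2 I1 I2 + R.minor I2 I3 I2 I3))"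
    by (intro leading_add 13 degree_lt_closed(4) 12 23)
  then show "leading 3 1 1 R.sigma2" by (simp add: R.sigma2_def add_ac)
  have qn: "degree_lt 1 (scal q ^ n)" for n
    unfolding scal_power[symmetric] by (rule degree_lt_closed(3))
  have triple: "degree_lt 4 (perturbed i j * perturbed k l * perturbed m n)"
    if "degree_lt d (perturbed i j)" "degree_lt e (perturbed k l)" "degree_lt f (perturbed m n)"
        "0 < d" "0 < e" "d + e + f \<le> 6"
    for i j k l m n d e f
    using degree_lt_times[OF degree_lt_times[OF that(1,2)] that(3)] that
        by (auto intro: degree_lt_mono)
  have qterm: "degree_lt 4 (scal q ^ r * T)" "degree_lt 4 (scal q * T)" if "degree_lt 4 T" for r T
    using degree_lt_times[OF qn that] degree_lt_times[OF degree_lt_closed(3) that] by simp_all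
  have "degree_lt 4 (perturbed I1 I1 * perturbed I2 I2 * perturbed I3 I3)"
    "degree_lt 4 (perturbed I1 I1 * perturbed I2 I3 * perturbed I3 I2)"
    "degree_lt 4 (perturbed I1 I2 * perturbed I2 I1 * perturbed I3 I3)"
    "degree_lt 4 (perturbed I1 I2 * perturbed I2 I3 * perturbed I3 I1)"
    "degree_lt 4 (perturbed I1 I3 * perturbed I2 I1 * perturbed I3 I2)"
    "degree_lt 4 (perturbed I1 I3 * perturbed I2 I2 * perturbed I3 I1)"
    by (rule triple[OF lows(1,5,9)] triple[OF lows(1,6,8)] triple[OF lows(2,4,9)]
        triple[OF lows(2,6,7)]
        triple[OF lows(3,4,8)] triple[OF lows(3,5,7)]; simp)+
  then show "degree_lt 4 R.qdet"
    unfolding R.qdet_def by (intro degree_lt_closed(4,5) qterm)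
qed

definition eval_perturbed :: "int poly poly poly \<Rightarrow> (nat \<times> nat \<times> nat, 'b) endo" where
  "eval_perturbed = eval3 R.sigma1 R.sigma2 R.qdet"

lemmas eval_perturbed_hom = RS.eval3_hom[folded eval_perturbed_def] RS.eval3_vars[folded
    eval_perturbed_def]

text \<open>In the recurrence the term with \<open>R.sigma2\<close> dominates:
  \<open>R.sigma1 * R.qdet\<close> has degree at most 5 and \<open>R.qdet * R.qdet\<close> at most
  6, against 6 and 9 for the square and cube of \<open>R.sigma2\<close>.\<close>

lemma leading_casoratian_diagonal: "leading (3 * n) n n (eval_perturbed (casoratian Z1 Z2 Z3 (n
    + 2) (n + 1)))"
proof (induction n rule: less_induct)
  case (less n)
  consider "n = 0" | "n = 1" | "n = 2" | m where "n = m + 3"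
    by atomize_elim presburger
  then show ?case
  proof cases
    case 1
    have "eval_perturbed (casoratian Z1 Z2 Z3 2 1) = 1"
        by (simp only: casoratian_diagonal_rec eval_perturbed_hom)
    with 1 leading_1 show ?thesis by (simp add: eval_nat_numeral)
  next
    case 2
    have "eval_perturbed (casoratian Z1 Z2 Z3 3 2) = R.sigma2"
        by (simp only: casoratian_diagonal_rec eval_perturbed_hom)
    with 2 leading_sigma(2) show ?thesis by (simp add: eval_nat_numeral)
  next
    case 3
    have "degree_lt 6 (R.sigma1 * R.qdet)"
      using degree_lt_times[OF leading_degree_lt[OF leading_sigma(1), of 3] leading_sigma(3)]
          by simp
    then have "leading 6 2 2 (R.sigma2 * R.sigma2 - R.sigma1 * R.qdet)"
      using leading_diff[OF leading_mult[OF leading_sigma(2,2)]] by (simp add: numeral_2_eq_2)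
    moreover have "eval_perturbed (casoratian Z1 Z2 Z3 4 3) = R.sigma2 * R.sigma2
        - R.sigma1 * R.qdet"
      by (simp only: casoratian_diagonal_rec eval_perturbed_hom)
    ultimately show ?thesis using 3 by (simp add: eval_nat_numeral)
  next
    case 4
    let ?c = "\<lambda>n. eval_perturbed (casoratian Z1 Z2 Z3 (n + 2) (n + 1))"
    have eq: "?c (m + 3) = R.sigma2 * ?c (m + 2) - R.sigma1 * R.qdet * ?c (m + 1)
        + R.qdet * R.qdet * ?c m"
      using arg_cong[OF casoratian_diagonal_rec(4)[of Z1 Z2 Z3 "m + 1"], of eval_perturbed]
      by (simp only: eval_perturbed_hom) (simp add: eval_nat_numeral)
    have "leading (3 * n) n n (R.sigma2 * ?c (m + 2))"
      by (rule leading_cong[OF leading_mult[OF leading_sigma(2) less.IH[of "m + 2"]]])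
          (simp_all add: 4)
    moreover have "degree_lt (3 * n) (R.sigma1 * R.qdet * ?c (m + 1))"
      using degree_lt_times[OF degree_lt_times[OF leading_degree_lt[OF leading_sigma(1), of 3]
          leading_sigma(3)]
          leading_degree_lt[OF less.IH[of "m + 1"], of "3 * (m + 1) + 1"]] 4
      by (auto intro: degree_lt_mono)
    moreover have "degree_lt (3 * n) (R.qdet * R.qdet * ?c m)"
      using degree_lt_times[OF degree_lt_times[OF leading_sigma(3,3)] leading_degree_lt[OF
          less.IH[of m], of "3 * m + 1"]] 4
      by (auto intro: degree_lt_mono)
    ultimately show ?thesis
      unfolding 4 eq using leading_add[OF leading_diff] 4 by blast
  qed
qed

text \<open>From the diagonal on, each increase of the first index multiplies the leading term by
  that of \<open>R.sigma1\<close>. The Steinberg character is the case where \<open>n\<close> and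
  \<open>j\<close> are both \<open>N - 1\<close>.\<close>

lemma leading_casoratian: "leading (3 * n + 2 * j) (n
    + j) n (eval_perturbed (casoratian Z1 Z2 Z3 (n + 1 + (j + 1)) (n + 1)))"
proof -
  let ?w = "\<lambda>j. eval_perturbed (casoratian Z1 Z2 Z3 (n + 1 + j) (n + 1))"
  have rec: "?w (j + 3) = R.sigma1 * ?w (j + 2) - R.sigma2 * ?w (j + 1) + R.qdet * ?w j" for j
    using arg_cong[OF casoratian_rec(3)[of Z1 Z2 Z3 "n + 1 + j" "n + 1"], of eval_perturbed]
    by (simp only: eval_perturbed_hom) (simp add: eval_nat_numeral)
  have "leading (3 * n + 2 * j) (n + j) n (?w (j + 1))"
  proof (induction j rule: less_induct)
    case (less j)
    consider "j = 0" | "j = 1" | m where "j = m + 2"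
      by atomize_elim presburger
    then show ?case
    proof cases
      case 1
      then show ?thesis using leading_casoratian_diagonal[of n] by simp
    next
      case 2
      \<comment> \<open>The recurrence in the first index would involve the index \<open>n\<close>,
        below the diagonal; \<open>casoratian_rec(2)\<close> has the neighbouring pair (n + 1, n)
        instead.\<close>
      have eq: "?w 2 = R.sigma1 * ?w 1 - R.qdet * eval_perturbed (casoratian Z1 Z2 Z3 (n + 1) n)"
        using arg_cong[OF casoratian_rec(2)[of Z1 Z2 Z3 n], of eval_perturbed]
        by (simp only: eval_perturbed_hom) (simp add: eval_nat_numeral)
      have "degree_lt (3 * n + 2) (R.qdet * eval_perturbed (casoratian Z1 Z2 Z3 (n + 1) n))"
      proof (cases n)
        case 0
        have "casoratian Z1 Z2 Z3 (Suc 0) 0 = 0"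
          by (simp add: casoratian_def)
        with 0 show ?thesis by (simp add: eval_perturbed_hom degree_lt_mono[OF degree_lt_closed(1)])
      next
        case (Suc m)
        then show ?thesis
          using degree_lt_times[OF leading_sigma(3) leading_degree_lt[OF
              leading_casoratian_diagonal[of m], of "3 * m + 1"]]
          by (auto intro: degree_lt_mono)
      qed
      moreover have "leading (3 * n + 2) (n + 1) n (R.sigma1 * ?w 1)"
        using leading_cong[OF leading_mult[OF leading_sigma(1) leading_casoratian_diagonal[of n]]]
        by (simp add: numeral_2_eq_2)
      ultimately show ?thesis
        using 2 eq by (simp add: leading_diff numeral_2_eq_2[symmetric] One_nat_def[symmetric]
            del: One_nat_def)
    next
      case 3
      have "leading (3 * n + 2 * j) (n + j) n (R.sigma1 * ?w (m + 2))"
        using leading_cong[OF leading_mult[OF leading_sigma(1) less.IH[of "m + 1"]]]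
            by (simp add: 3)
      moreover have "degree_lt (3 * n + 2 * j) (R.sigma2 * ?w (m + 1))"
        using degree_lt_times[OF leading_degree_lt[OF leading_sigma(2), of 4] leading_degree_lt[OF
            less.IH[of m], of "3 * n + 2 * m + 1"]] 3
        by (auto intro: degree_lt_mono)
      moreover have "degree_lt (3 * n + 2 * j) (R.qdet * ?w m)"
      proof (cases m)
        case 0
        then show ?thesis
            by (simp add: casoratian_rec eval_perturbed_hom degree_lt_mono[OF degree_lt_closed(1)])
      next
        case (Suc m')
        then show ?thesis
          using degree_lt_times[OF leading_sigma(3) leading_degree_lt[OF less.IH[of m'], of "3 * n
              + 2 * m' + 1"]] 3
          by (auto intro: degree_lt_mono)
      qed
      ultimately show ?thesis
        unfolding 3 using leading_add[OF leading_diff] rec[of m] by (simp add: eval_nat_numeral)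
    qed
  qed
  then show ?thesis .
qed

text \<open>Setting \<open>y = 0\<close>: the action on functions that are constant in degree 0.\<close>

definition specializes :: "(nat \<times> nat \<times> nat, 'b) endo \<Rightarrow> 'b \<Rightarrow> bool" where
  "specializes T z \<longleftrightarrow> (\<forall>f c. (\<forall>n m. f (n, m, 0) = c) \<longrightarrow> (\<forall>n m. app T f (n, m, 0) = z * c))"

lemma specializes_closed:
  "specializes 0 0" "specializes 1 1"
  "specializes S a \<Longrightarrow> specializes T b \<Longrightarrow> specializes (S + T) (a + b)"
  "specializes S a \<Longrightarrow> specializes T b \<Longrightarrow> specializes (S * T) (a * b)"
  "specializes S a \<Longrightarrow> specializes (- S) (- a)"
  "specializes S a \<Longrightarrow> specializes T b \<Longrightarrow> specializes (S - T) (a - b)"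
  "specializes (scal a) a"
  by (auto simp: specializes_def distrib_right left_diff_distrib mult.assoc)

lemma specializes_power: "specializes S a \<Longrightarrow> specializes (S ^ n) (a ^ n)"
  by (induction n) (simp_all add: specializes_closed)

lemma specializes_perturbed: "specializes (perturbed i j) (M i j)"
  by (auto simp: specializes_def perturbed_def graded_def y1_def y3_def)

lemma specializes_sigma:
  "specializes R.sigma1 sigma1" "specializes R.sigma2 sigma2" "specializes R.qdet qdet"
  unfolding R.sigma1_def R.sigma2_def R.qdet_def R.minor_def sigma1_def sigma2_def qdet_def
      minor_def
  by (intro specializes_closed specializes_power specializes_perturbed)+

theorem frobenius_trace:
  assumes qN: "q ^ N = 1" and N: "0 < N"
    and vanish: "\<And>k. 0 < k \<Longrightarrow> k < N \<Longrightarrow> qbinomial (q ^ 2) N k = 0"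
  shows "quantum_matrix.sigma1 (\<lambda>i j. M i j ^ N) = eval3 sigma1 sigma2 qdet (psum1 Z1 Z2 Z3 N)"
    and "quantum_matrix.sigma2 1 (\<lambda>i j. M i j ^ N) = eval3 sigma1 sigma2 qdet (psum2 Z1 Z2 Z3 N)"
proof -
  interpret P: quantum_matrix 1 1 "\<lambda>i j. M i j ^ N"
    by (rule quantum_matrix_power[OF qN])
  have qN': "scal q ^ N = (1 :: (nat \<times> nat \<times> nat, 'b) endo)"
    using qN by (simp add: scal_hom flip: scal_power)
  interpret PR: quantum_matrix 1 1 "\<lambda>i j. perturbed i j ^ N"
    by (rule R.quantum_matrix_power[OF qN'])
  have vanish': "qbinomial (scal q ^ 2 :: (nat \<times> nat \<times> nat, 'b) endo) N k = 0" if "0 < k" "k < N"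
      for k
    using vanish[OF that] by (metis scal_qbinomial scal_power scal_hom(1))
  have annihilates: "eval_perturbed (casoratian Z1 Z2 Z3 (2 * N) N) * (PR.sigma1
      - eval_perturbed (psum1 Z1 Z2 Z3 N)) = 0"
    "eval_perturbed (casoratian Z1 Z2 Z3 (2 * N) N) * (PR.sigma2
        - eval_perturbed (psum2 Z1 Z2 Z3 N)) = 0"
    unfolding eval_perturbed_def by (rule R.steinberg_annihilates[OF qN' N], erule (1) vanish')+
  obtain n where n: "N = n + 1" using N by (metis Suc_eq_plus1 gr0_implies_Suc)
  have St: "leading (3 * n + 2 * n) (n + n) n (eval_perturbed (casoratian Z1 Z2 Z3 (2 * N) N))"
    using leading_casoratian[of n n] by (simp add: n mult_2)
  \<comment> \<open>\<open>leading_regular\<close> starts its descent from such a bound.\<close>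
  have bounded: "\<exists>e. degree_lt e (PR.sigma1 - eval_perturbed P)" "\<exists>e. degree_lt e (PR.sigma2
      - eval_perturbed P)" for P
  proof -
    define bd where "bd T \<longleftrightarrow> (\<exists>e. degree_lt (Suc e) T)" for T :: "(nat \<times> nat \<times> nat, 'b) endo"
    have bd: "bd 0" "bd 1" "bd S \<Longrightarrow> bd T \<Longrightarrow> bd (S + T)" "bd S \<Longrightarrow> bd T \<Longrightarrow> bd (S - T)"
      "bd S \<Longrightarrow> bd (- S)" "bd S \<Longrightarrow> bd T \<Longrightarrow> bd (S * T)" for S T
    proof -
      have max: "degree_lt (Suc (max d e)) S" "degree_lt (Suc (max e d)) S" if
          "degree_lt (Suc d) S" for d e S
        using that by (auto intro: degree_lt_mono)
      show "bd 0" unfolding bd_def by (blast intro: degree_lt_mono degree_lt_closed(1))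
      show "bd 1" unfolding bd_def using degree_lt_closed(2) by (metis One_nat_def)
      show "bd S \<Longrightarrow> bd T \<Longrightarrow> bd (S + T)" "bd S \<Longrightarrow> bd T \<Longrightarrow> bd (S - T)"
        unfolding bd_def by (metis max degree_lt_closed(4)) (metis max degree_lt_closed(5))
      show "bd S \<Longrightarrow> bd (- S)" unfolding bd_def by (metis degree_lt_closed(6))
      show "bd S \<Longrightarrow> bd T \<Longrightarrow> bd (S * T)" unfolding bd_def by (metis degree_lt_mult add_Suc_right)
    qed
    have X: "bd (perturbed i j)" for i j
      unfolding bd_def using degree_lt_perturbed
          by (cases i; cases j) (metis numeral_3_eq_3 numeral_2_eq_2 One_nat_def)+
    have pow: "bd T \<Longrightarrow> bd (T ^ k)" for T k
      by (induction k) (simp_all add: bd)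
    have s: "bd R.sigma1" "bd R.sigma2" "bd R.qdet"
      unfolding bd_def using leading_sigma leading_degree_lt
          by (metis lessI, metis lessI, metis eval_nat_numeral(2) semiring_norm(26,27)
              numeral_eq_Suc)
    have "bd (eval_perturbed P)" for P
      unfolding eval_perturbed_def by (rule eval3_rel[where R = "\<lambda>T _ :: 'b. bd T"])
          (simp_all add: bd s)
    moreover have "bd PR.sigma1" "bd PR.sigma2"
      unfolding PR.sigma1_def PR.sigma2_def PR.minor_def by (simp_all add: bd pow X)
    ultimately show "\<exists>e. degree_lt e (PR.sigma1 - eval_perturbed P)" "\<exists>e. degree_lt e (PR.sigma2
        - eval_perturbed P)"
      using bd(4) unfolding bd_def by blast+
  qed
  \<comment> \<open>Constant in degree 0, so \<open>specializes\<close> applies to it with the value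
    1.\<close>
  define v :: "nat \<times> nat \<times> nat \<Rightarrow> 'b" where "v = (\<lambda>(n, m, k). if k = 0 then 1 else 0)"
  have zero: "z = 0" if "eval_perturbed (casoratian Z1 Z2 Z3 (2 * N) N) * D = 0"
      "\<exists>e. degree_lt e D" "specializes D z" for D z
  proof -
    from that(2) obtain e where "degree_lt e D" ..
    then have "app D v (0, 0, 0) = 0"
      by (rule leading_regular[OF St that(1)]) (simp add: v_def)
    moreover have "\<forall>n m. app D v (n, m, 0) = z * 1"
      using that(3) unfolding specializes_def by (rule allE[of _ v]) (auto simp: v_def)
    ultimately show ?thesis by simp
  qed
  have spec: "specializes (eval_perturbed P) (eval3 sigma1 sigma2 qdet P)" for P
    unfolding eval_perturbed_def by (rule eval3_rel) (intro specializes_closed specializes_sigma;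
        assumption)+
  have "specializes PR.sigma1 P.sigma1" "specializes PR.sigma2 P.sigma2"
    unfolding PR.sigma1_def PR.sigma2_def PR.minor_def P.sigma1_def P.sigma2_def P.minor_def
    by (intro specializes_closed specializes_power specializes_perturbed)+
  note spec_diff = this[THEN specializes_closed(6)[OF _ spec]]
  have "P.sigma1 - eval3 sigma1 sigma2 qdet (psum1 Z1 Z2 Z3 N) = 0"
    by (rule zero[OF annihilates(1) bounded(1) spec_diff(1)])
  moreover have "P.sigma2 - eval3 sigma1 sigma2 qdet (psum2 Z1 Z2 Z3 N) = 0"
    by (rule zero[OF annihilates(2) bounded(2) spec_diff(2)])
  ultimately show "P.sigma1 = eval3 sigma1 sigma2 qdet (psum1 Z1 Z2 Z3 N)"
    "P.sigma2 = eval3 sigma1 sigma2 qdet (psum2 Z1 Z2 Z3 N)"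
    by simp_all
qed

end

section \<open>Quantum binomials at roots of unity\<close>

lemma qint_add: "qint w (a + b) = qint w a + w ^ a * qint w b" for w :: "'a::comm_ring_1"
  by (induction a) (simp_all add: algebra_simps)

lemma qint_mult: "qint w (a * b) = qint w a * qint (w ^ a) b" for w :: "'a::comm_ring_1"
  by (induction b) (simp_all add: qint_add algebra_simps)

lemma qint_sum: "qint w n = (\<Sum>j<n. w ^ j)" for w :: "'a::comm_ring_1"
  by (induction n) (simp_all add: qint_Suc_right del: qint.simps(2))

lemma rhom_power: "rhom h \<Longrightarrow> h (a ^ n) = h a ^ n"
  by (induction n) (simp_all add: rhomD)

lemma rhom_qint: "rhom h \<Longrightarrow> h (qint w n) = qint (h w) n"
  by (induction n) (simp_all add: rhomD)

lemma rhom_qbinomial: "rhom h \<Longrightarrow> h (qbinomial w n k) = qbinomial (h w) n k"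
  by (induction w n k rule: qbinomial.induct) (simp_all add: rhomD rhom_power del: power_Suc)

text \<open>The two forms are proved together, since the q-Pascal rule turns each of them into the
  other.\<close>

lemma qbinomial_absorption:
  fixes w :: "'a::comm_ring_1"
  shows "qint w (Suc k) * qbinomial w n (Suc k) = qint w n * qbinomial w (n - 1) k"
    and "k \<le> n \<Longrightarrow> qint w (n - k) * qbinomial w n k = qint w n * qbinomial w (n - 1) k"
proof (induction n arbitrary: k)
  case (Suc n)
  note A = Suc.IH(1) and B = Suc.IH(2)
  {
    case 1
    show ?case
    proof (cases "k \<le> n")
      case True
      have "qint w (Suc k) * qbinomial w (Suc n) (Suc k)
          = qint w (Suc k) * qbinomial w n k + w ^ Suc k * (qint w (Suc k) * qbinomial w n (Suc k))"
        by (simp add: algebra_simps)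
      also have "qint w (Suc k) * qbinomial w n (Suc k) = qint w (n - k) * qbinomial w n k"
        using A[of k] B[OF True] by simp
      also have "qint w (Suc k) * qbinomial w n k + w ^ Suc k * (qint w (n - k) * qbinomial w n k)
          = (qint w (Suc k) + w ^ Suc k * qint w (n - k)) * qbinomial w n k"
        by (simp add: algebra_simps)
      also have "qint w (Suc k) + w ^ Suc k * qint w (n - k) = qint w (Suc n)"
        using qint_add[of w "Suc k" "n - k"] True by simp
      finally show ?thesis by simp
    qed (simp add: qbinomial_eq_0)
  next
    case 2
    show ?case
    proof (cases k)
      case (Suc k')
      show ?thesis
      proof (cases "k \<le> n")
        case True
        have "qint w (Suc n - k) * qbinomial w (Suc n) k
            = qint w (n - k') * qbinomial w n k' + w ^ k * (qint w (Suc n - k) * qbinomial w n k)"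
          by (simp add: Suc algebra_simps)
        also have "qint w (n - k') * qbinomial w n k' = qint w k * qbinomial w n k"
          using A[of k'] B[of k'] True Suc by simp
        also have "qint w k * qbinomial w n k + w ^ k * (qint w (Suc n - k) * qbinomial w n k)
            = (qint w k + w ^ k * qint w (Suc n - k)) * qbinomial w n k"
          by (simp add: algebra_simps)
        also have "qint w k + w ^ k * qint w (Suc n - k) = qint w (Suc n)"
          using qint_add[of w k "Suc n - k"] True by simp
        finally show ?thesis by simp
      next
        case False
        then show ?thesis using \<open>k \<le> Suc n\<close> by (simp add: qbinomial_eq_0)
      qed
    qed simp
  }
qed simp_all

text \<open>The common factor \<open>qint w g\<close> may be a zero divisor, so it is cancelled in \<open>\<int>[t]\<close>.\<close>

lemma qbinomial_absorption_multiple: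
  fixes w :: "'a::comm_ring_1"
  assumes g: "0 < g" and k: "0 < k" and n: "0 < n"
  shows "qint (w ^ g) k * qbinomial w (g * n) (g * k)
    = qint (w ^ g) n * qbinomial w (g * n - 1) (g * k - 1)"
proof -
  let ?t = "[:0, 1:] :: int poly"
  have "0 < g * n" "0 < g * k" using g k n by simp_all
  then have "qint ?t (g * k) * qbinomial ?t (g * n) (g * k)
      = qint ?t (g * n) * qbinomial ?t (g * n - 1) (g * k - 1)"
    using qbinomial_absorption(1)[of ?t "g * k - 1" "g * n"] by (simp only: Suc_diff_1)
  then have "qint ?t g * (qint (?t ^ g) k * qbinomial ?t (g * n) (g * k))
      = qint ?t g * (qint (?t ^ g) n * qbinomial ?t (g * n - 1) (g * k - 1))"
    by (simp only: qint_mult mult.assoc)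
  \<comment> \<open>Evaluation at 1 shows that the factor to be cancelled is not zero.\<close>
  moreover have "poly (qint ?t g) 1 = int g"
    by (induction g) simp_all
  then have "qint ?t g \<noteq> 0"
    using g by (metis of_nat_eq_0_iff less_irrefl poly_0)
  ultimately have eq: "qint (?t ^ g) k * qbinomial ?t (g * n) (g * k)
      = qint (?t ^ g) n * qbinomial ?t (g * n - 1) (g * k - 1)"
    by (metis mult_cancel_left)
  have of_int: "rhom (of_int :: int \<Rightarrow> 'a)"
    by (simp add: rhom_def)
  have hom: "rhom (peval of_int w)"
    by (rule rhom_peval[OF of_int]) (rule mult.commute)
  show ?thesis
    using arg_cong[OF eq, of "peval of_int w"]
    by (simp only: rhomD(3)[OF hom] rhom_qint[OF hom] rhom_qbinomial[OF hom] rhom_power[OF hom]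
        peval_X[OF of_int])
qed

text \<open>By Bezout some multiple \<open>k * m\<close> is 1 modulo \<open>d\<close>, and
  \<open>qint v\<close> is 1 there because \<open>qint v d\<close> vanishes; it has the factor
  \<open>qint v k\<close>.\<close>

lemma qint_unit:
  fixes v :: "'a::comm_ring_1"
  assumes "qint v d = 0" "coprime k d" "0 < k"
  shows "\<exists>u. u * qint v k = 1"
proof -
  from assms(3) obtain m l where "k * m = d * l + 1"
    using bezout_nat[of k d] assms(2) by (auto simp: coprime_iff_gcd_eq_1)
  then have "qint v k * qint (v ^ k) m = qint v (1 + d * l)"
    by (simp flip: qint_mult)
  also have "\<dots> = 1"
    using assms(1) by (simp add: qint_mult)
  finally show ?thesis by (metis mult.commute)
qed

text \<open>With \<open>g\<close> the gcd of \<open>N\<close> and \<open>k\<close>, absorption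
  without the common factor at \<open>g\<close> expresses \<open>qint\<close> at
  \<open>k div g\<close>, a unit, times the binomial as a multiple of \<open>qint\<close> at
  \<open>d\<close>, which is zero.\<close>

lemma qbinomial_root_of_unity:
  fixes z :: "'a::comm_ring_1"
  assumes z: "root_of_unity_of_order N z" and m: "coprime N m" "0 < m" and k: "0 < k" "k < N"
  shows "qbinomial (z ^ m) N k = 0"
proof -
  define g d where "g = gcd N k" and "d = N div g"
  have N: "N = g * d" and g: "0 < g"
    using k by (simp_all add: g_def d_def)
  have "g \<le> k" using k by (simp add: g_def gcd_le2_nat)
  then have d: "1 < d" using N k by (cases d; cases "d - 1") auto
  have "N div d = g" "d dvd N" using N d by auto
  then have zd: "qint (z ^ g) d = 0"
    using z d unfolding root_of_unity_of_order_def qint_sum by metis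
  have "coprime m d" using m N by (metis coprime_commute coprime_mult_left_iff)
  then obtain u where u: "u * qint (z ^ g) m = 1"
    using qint_unit[OF zd] m by blast
  have swap: "(z ^ g) ^ m = (z ^ m) ^ g"
    by (simp add: mult.commute flip: power_mult)
  \<comment> \<open>Both sides are \<open>qint (z ^ g) (m * d)\<close>; this carries the vanishing
    from \<open>z ^ g\<close> over to its \<open>m\<close>-th power.\<close>
  have "qint (z ^ g) m * qint ((z ^ g) ^ m) d = qint (z ^ g) d * qint ((z ^ g) ^ d) m"
    unfolding qint_mult[symmetric] by (simp only: mult.commute)
  then have "u * qint (z ^ g) m * qint ((z ^ g) ^ m) d = 0"
    by (simp add: zd mult.assoc)
  then have wd: "qint ((z ^ m) ^ g) d = 0"
    by (simp add: u swap)
  obtain k' where k': "k = g * k'" by (metis dvdE g_def gcd_dvd2)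
  have "g * gcd k' d = g"
    by (metis N k' g_def gcd.commute gcd_mult_distrib_nat)
  then have "coprime k' d"
    using g by (simp add: coprime_iff_gcd_eq_1)
  moreover have "0 < k'" using k k' by (simp add: zero_less_mult_iff)
  ultimately obtain u' where u': "u' * qint ((z ^ m) ^ g) k' = 1"
    using qint_unit[OF wd] by blast
  have "qint ((z ^ m) ^ g) k' * qbinomial (z ^ m) N k = 0"
    using qbinomial_absorption_multiple[OF g \<open>0 < k'\<close>, of d "z ^ m"] wd d by (simp add: N k')
  then have "u' * qint ((z ^ m) ^ g) k' * qbinomial (z ^ m) N k = 0"
    by (simp add: mult.assoc)
  then show ?thesis by (simp add: u')
qed

section \<open>The product of all quotients of a ring\<close>

definition two_sided_ideal :: "'f::ring_1 set \<Rightarrow> bool" where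
  "two_sided_ideal I \<longleftrightarrow> 0 \<in> I \<and> (\<forall>x\<in>I. \<forall>y\<in>I. x - y \<in> I) \<and> (\<forall>x\<in>I. \<forall>r. r * x \<in> I \<and> x * r \<in> I)"

lemma two_sided_idealD:
  assumes "two_sided_ideal I"
  shows "0 \<in> I" "x \<in> I \<Longrightarrow> y \<in> I \<Longrightarrow> x - y \<in> I" "x \<in> I \<Longrightarrow> y \<in> I \<Longrightarrow> x + y \<in> I" "x \<in> I \<Longrightarrow> - x \<in> I"
    "x \<in> I \<Longrightarrow> r * x \<in> I" "x \<in> I \<Longrightarrow> x * r \<in> I"
proof -
  show 0: "0 \<in> I" and diff: "x \<in> I \<Longrightarrow> y \<in> I \<Longrightarrow> x - y \<in> I" and "x \<in> I \<Longrightarrow> r * x \<in> I" "x \<in> I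
      \<Longrightarrow> x * r \<in> I" for x y
    using assms by (auto simp: two_sided_ideal_def)
  show "x \<in> I \<Longrightarrow> - x \<in> I" for x using diff[OF 0, of x] by simp
  then show "x \<in> I \<Longrightarrow> y \<in> I \<Longrightarrow> x + y \<in> I" using diff[of x "- y"] by simp
qed

definition family_rel :: "('f::ring_1 set \<Rightarrow> 'f) \<Rightarrow> ('f set \<Rightarrow> 'f) \<Rightarrow> bool" where
  "family_rel f g \<longleftrightarrow> (\<forall>I. two_sided_ideal I \<longrightarrow> f I - g I \<in> I)"

text \<open>
  A quotient by an ideal that depends on a parameter cannot be a type. The product of the
  quotients by all two-sided ideals is one, and each single quotient is a factor of it.
\<close>

quotient_type (overloaded) 'f family = "'f::ring_1 set \<Rightarrow> 'f" / family_rel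
proof (rule equivpI)
  show "reflp (family_rel :: ('f set \<Rightarrow> 'f) \<Rightarrow> _)"
    by (auto simp: reflp_def family_rel_def two_sided_idealD)
  show "symp (family_rel :: ('f set \<Rightarrow> 'f) \<Rightarrow> _)"
    by (auto simp: symp_def family_rel_def) (metis two_sided_idealD(4) minus_diff_eq)
  show "transp (family_rel :: ('f set \<Rightarrow> 'f) \<Rightarrow> _)"
    by (auto simp: transp_def family_rel_def) (metis two_sided_idealD(3) diff_add_cancel
        add_diff_eq)
qed

instantiation family :: (ring_1) ring_1
begin

lift_definition zero_family :: "'a family" is "\<lambda>I. 0" .
lift_definition one_family :: "'a family" is "\<lambda>I. 1" .
lift_definition plus_family :: "'a family \<Rightarrow> 'a family \<Rightarrow> 'a family" is "\<lambda>f g I. f I + g I"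
  unfolding family_rel_def by (metis add_diff_add two_sided_idealD(3))
lift_definition minus_family :: "'a family \<Rightarrow> 'a family \<Rightarrow> 'a family" is "\<lambda>f g I. f I - g I"
proof -
  fix f f' g g' :: "'a set \<Rightarrow> 'a"
  have eq: "f I - g I - (f' I - g' I) = (f I - f' I) - (g I - g' I)" for I
    by (simp add: algebra_simps)
  show "family_rel f f' \<Longrightarrow> family_rel g g' \<Longrightarrow> family_rel (\<lambda>I. f I - g I) (\<lambda>I. f' I - g' I)"
    unfolding family_rel_def eq by (blast intro: two_sided_idealD(2))
qed
lift_definition uminus_family :: "'a family \<Rightarrow> 'a family" is "\<lambda>f I. - f I"
  unfolding family_rel_def by (metis minus_diff_minus two_sided_idealD(4))
lift_definition times_family :: "'a family \<Rightarrow> 'a family \<Rightarrow> 'a family" is "\<lambda>f g I. f I * g I"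
proof -
  fix f f' g g' :: "'a set \<Rightarrow> 'a"
  have eq: "f I * g I - f' I * g' I = (f I - f' I) * g I + f' I * (g I - g' I)" for I
    by (simp add: algebra_simps)
  show "family_rel f f' \<Longrightarrow> family_rel g g' \<Longrightarrow> family_rel (\<lambda>I. f I * g I) (\<lambda>I. f' I * g' I)"
    unfolding family_rel_def eq by (blast intro: two_sided_idealD(3,5,6))
qed

instance
proof
  have refl: "family_rel f f" for f :: "'a set \<Rightarrow> 'a"
    by (simp add: family_rel_def two_sided_idealD)
  fix a b c :: "'a family"
  show "a + b + c = a + (b + c)" "a + b = b + a" "0 + a = a" "- a + a = 0" "a - b = a + - b"
    "a * b * c = a * (b * c)" "1 * a = a" "a * 1 = a" "(a + b) * c = a * c + b * c"
    "a * (b + c) = a * b + a * c"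
    by (transfer; simp add: algebra_simps refl)+
  have "two_sided_ideal {0 :: 'a}"
    by (simp add: two_sided_ideal_def)
  then show "(0 :: 'a family) \<noteq> 1"
    by transfer (auto simp: family_rel_def)
qed

end

lift_definition const_family :: "'f::ring_1 \<Rightarrow> 'f family" is "\<lambda>x I. x" .

text \<open>
  For \<open>J = oq_ideal q\<close> the element \<open>at_ideal J 1\<close> is the idempotent of one factor, so a quantum
  matrix in the quotient extends by zero to one in the product.
\<close>

lift_definition at_ideal :: "'f::ring_1 set \<Rightarrow> 'f \<Rightarrow> 'f family" is "\<lambda>J x I. if I = J then x else 0" .

lemma family_rel_refl: "family_rel f f"
  by (simp add: family_rel_def two_sided_idealD)

lemma const_family_hom:
  "const_family 0 = 0" "const_family 1 = 1" "const_family (a + b) = const_family a + const_family b"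
  "const_family (a - b) = const_family a - const_family b"
  "const_family (a * b) = const_family a * const_family b"
  by (transfer; simp add: family_rel_refl)+

lemma at_ideal_hom:
  "at_ideal J (a + b) = at_ideal J a + at_ideal J b"
  "at_ideal J (a - b) = at_ideal J a - at_ideal J b"
  "at_ideal J (a * b) = at_ideal J a * at_ideal J b"
  "const_family c * at_ideal J a = at_ideal J (c * a)"
  by (transfer; simp add: family_rel_def two_sided_idealD)+

lemma at_ideal_eq_0: "x \<in> J \<Longrightarrow> at_ideal J x = 0"
  by transfer (auto simp: family_rel_def two_sided_idealD)

lemma at_ideal_eqI: "x - y \<in> J \<Longrightarrow> at_ideal J x = at_ideal J y"
  using at_ideal_eq_0[of "x - y" J] by (simp add: at_ideal_hom)

lemma central_const_family:
  assumes "central c"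
  shows "central (const_family c)"
  using assms unfolding central_def by (transfer, simp add: family_rel_def two_sided_idealD)

lemma free_const_hom:
  "free_const 0 = 0" "free_const 1 = 1" "free_const (a + b) = free_const a + free_const b"
  "free_const (a * b) = free_const a * free_const b"
  by (simp_all add: free_const_def single_add mult_single)

lemma central_free_const: "central (free_const c :: 'a::comm_ring_1 free_alg)"
proof -
  have single: "Poly_Mapping.single w z * free_const c
      = free_const c * Poly_Mapping.single w (z :: 'a)" for w :: "(idx \<times> idx) word" and z
    by (simp add: free_const_def mult_single mult.commute)
  have "f * free_const c = free_const c * f" for f :: "'a free_alg"
  proof (induction f rule: update_induct)
    case (update f w z)
    then have "Poly_Mapping.update w z f = f + Poly_Mapping.single w z"
      by (intro poly_mapping_eqI) (auto simp: lookup_update lookup_add lookup_single when_def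
          in_keys_iff)
    then show ?case by (simp add: distrib_left distrib_right update single)
  qed simp
  then show ?thesis by (simp add: central_def)
qed

section \<open>Transfer to \<open>O\<^sub>q(SL\<^sub>3)\<close>\<close>

lemma ring_free_alg: "ring (ring_of_type_algebra :: 'a::comm_ring_1 free_alg ring)"
proof -
  have "\<exists>y. x + y = 0" for x :: "'a free_alg"
    using add.right_inverse by blast
  then show ?thesis
    unfolding ring_of_type_algebra_def using add.right_inverse
    by unfold_locales (auto simp: algebra_simps Units_def)
qed

lemma type_algebra_simps:
  "carrier ring_of_type_algebra = UNIV" "x \<otimes>\<^bsub>ring_of_type_algebra\<^esub> y = x * y"
  "x \<oplus>\<^bsub>ring_of_type_algebra\<^esub> y = x + y" "\<one>\<^bsub>ring_of_type_algebra\<^esub> = 1" "\<zero>\<^bsub>ring_of_type_algebra\<^esub> = 0"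
  by (simp_all add: ring_of_type_algebra_def)

lemma a_inv_free_alg: "\<ominus>\<^bsub>ring_of_type_algebra\<^esub> (x :: 'a::comm_ring_1 free_alg) = - x"
proof -
  interpret F: ring "ring_of_type_algebra :: 'a free_alg ring" by (rule ring_free_alg)
  show ?thesis by (rule F.minus_equality) (simp_all add: type_algebra_simps)
qed

lemma a_minus_free_alg: "x \<ominus>\<^bsub>ring_of_type_algebra\<^esub> y = x - (y :: 'a::comm_ring_1 free_alg)"
  by (simp add: a_minus_def a_inv_free_alg type_algebra_simps)

lemma ideal_oq_ideal: "ideal (oq_ideal q) ring_of_type_algebra"
  unfolding oq_ideal_def by (rule ring.genideal_ideal[OF ring_free_alg])
      (simp add: type_algebra_simps)

lemma oq_relators_subset: "oq_relators q \<subseteq> oq_ideal q"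
  unfolding oq_ideal_def by (rule ring.genideal_self[OF ring_free_alg])
      (simp add: type_algebra_simps)

lemma two_sided_ideal_oq_ideal: "two_sided_ideal (oq_ideal q)"
proof -
  interpret I: ideal "oq_ideal q" ring_of_type_algebra by (rule ideal_oq_ideal)
  have mult: "r * x \<in> oq_ideal q" "x * r \<in> oq_ideal q" if "x \<in> oq_ideal q" for x r
    using I.I_l_closed[OF that, of r] I.I_r_closed[OF that, of r]
        by (simp_all add: type_algebra_simps)
  have add: "x + y \<in> oq_ideal q" if "x \<in> oq_ideal q" "y \<in> oq_ideal q" for x y
    using additive_subgroup.a_closed[OF I.additive_subgroup_axioms that]
        by (simp add: type_algebra_simps)
  have neg: "- x \<in> oq_ideal q" if "x \<in> oq_ideal q" for x
    using mult(1)[OF that, of "- 1"] by simp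
  moreover have "x - y \<in> oq_ideal q" if "x \<in> oq_ideal q" "y \<in> oq_ideal q" for x y
    using add[OF that(1) neg[OF that(2)]] by simp
  moreover have "0 \<in> oq_ideal q"
    using additive_subgroup.zero_closed[OF I.additive_subgroup_axioms]
        by (simp add: type_algebra_simps)
  ultimately show ?thesis using mult by (auto simp: two_sided_ideal_def)
qed

lemma oq_class_eqI: "x - y \<in> oq_ideal q \<Longrightarrow> oq_class q x = oq_class q y"
  unfolding oq_class_def
  using ring.quotient_eq_iff_same_a_r_cos[OF ring_free_alg ideal_oq_ideal, of x y q]
  by (simp add: type_algebra_simps a_minus_free_alg)

lemma oq_class_hom:
  "oq_class q x \<in> carrier (Oq_SL3 q)"
  "oq_class q (x + y) = oq_class q x \<oplus>\<^bsub>Oq_SL3 q\<^esub> oq_class q y"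
  "oq_class q (x * y) = oq_class q x \<otimes>\<^bsub>Oq_SL3 q\<^esub> oq_class q y"
  "oq_class q 1 = \<one>\<^bsub>Oq_SL3 q\<^esub>" "oq_class q 0 = \<zero>\<^bsub>Oq_SL3 q\<^esub>"
proof -
  note hom = ideal.rcos_ring_hom[OF ideal_oq_ideal[of q]]
  show "oq_class q x \<in> carrier (Oq_SL3 q)"
    "oq_class q (x + y) = oq_class q x \<oplus>\<^bsub>Oq_SL3 q\<^esub> oq_class q y"
    "oq_class q (x * y) = oq_class q x \<otimes>\<^bsub>Oq_SL3 q\<^esub> oq_class q y"
    "oq_class q 1 = \<one>\<^bsub>Oq_SL3 q\<^esub>"
    using ring_hom_closed[OF hom, of x] ring_hom_add[OF hom, of x y] ring_hom_mult[OF hom, of x y]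
      ring_hom_one[OF hom]
    by (simp_all add: oq_class_def Oq_SL3_def type_algebra_simps)
  show "oq_class q 0 = \<zero>\<^bsub>Oq_SL3 q\<^esub>"
    using ring_hom_zero[OF hom ring_free_alg ideal.quotient_is_ring[OF ideal_oq_ideal]]
    by (simp add: oq_class_def Oq_SL3_def type_algebra_simps)
qed

text \<open>Projection of the product of all quotients to one factor; well defined because
  \<open>oq_ideal q\<close> is among the ideals.\<close>

lift_definition oq_proj :: "'a::comm_ring_1 \<Rightarrow> 'a free_alg family \<Rightarrow> 'a free_alg set" is
  "\<lambda>q f. oq_class q (f (oq_ideal q))"
  by (rule oq_class_eqI) (simp add: family_rel_def two_sided_ideal_oq_ideal)

context
  fixes q :: "'a::comm_ring_1"
begin

interpretation O: ring "Oq_SL3 q" by (rule ring_Oq_SL3)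

lemma oq_proj_simps:
  "oq_proj q x \<in> carrier (Oq_SL3 q)"
  "oq_proj q (x + y) = oq_proj q x \<oplus>\<^bsub>Oq_SL3 q\<^esub> oq_proj q y"
  "oq_proj q (x * y) = oq_proj q x \<otimes>\<^bsub>Oq_SL3 q\<^esub> oq_proj q y"
  "oq_proj q 1 = \<one>\<^bsub>Oq_SL3 q\<^esub>" "oq_proj q 0 = \<zero>\<^bsub>Oq_SL3 q\<^esub>"
  "oq_proj q (const_family f) = oq_class q f"
  "oq_proj q (at_ideal (oq_ideal q) f) = oq_class q f"
  by (transfer; simp add: oq_class_hom)+

lemma oq_proj_diff: "oq_proj q (x - y) = oq_proj q x \<ominus>\<^bsub>Oq_SL3 q\<^esub> oq_proj q y"
proof -
  have "oq_proj q x = oq_proj q (x - y) \<oplus>\<^bsub>Oq_SL3 q\<^esub> oq_proj q y"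
    by (simp flip: oq_proj_simps(2))
  then show ?thesis
    using oq_proj_simps(1) by (metis O.add.inv_solve_right O.minus_eq)
qed

lemma oq_proj_power: "oq_proj q (x ^ n) = oq_proj q x [^]\<^bsub>Oq_SL3 q\<^esub> n"
  by (induction n) (simp_all add: oq_proj_simps power_Suc2 del: power_Suc)

lemma oq_proj_sum: "finite S \<Longrightarrow> oq_proj q (\<Sum>s\<in>S. f s) = (\<Oplus>\<^bsub>Oq_SL3 q\<^esub>s\<in>S. oq_proj q (f s))"
  by (induction S rule: finite_induct) (simp_all add: oq_proj_simps O.finsum_insert Pi_def)

definition scalar :: "'a \<Rightarrow> 'a free_alg family" where "scalar c = const_family (free_const c)"

definition gen_family :: "idx \<Rightarrow> idx \<Rightarrow> 'a free_alg family" where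
  "gen_family i j = at_ideal (oq_ideal q) (free_gen i j)"

lemma rhom_scalar: "rhom scalar"
  by (simp add: rhom_def scalar_def free_const_hom const_family_hom)

lemma central_scalar: "central (scalar c)"
  unfolding scalar_def by (intro central_const_family central_free_const)

lemma oq_eval2_proj:
  "oq_eval2 q P (oq_proj q x) (oq_proj q y) = oq_proj q (peval (peval scalar x) y P)"
  unfolding oq_eval2_def peval_def sum_distrib_right
  by (simp add: oq_proj_sum oq_proj_simps oq_proj_power scalar_def oq_const_def)

lemma at_ideal_scalar: "at_ideal J (free_const c * a * b)
    = scalar c * (at_ideal J a * at_ideal J b)"
  by (simp only: scalar_def at_ideal_hom(3)[of J "free_const c * a" b]
      at_ideal_hom(4)[of "free_const c" J a, symmetric]) (simp only: mult.assoc)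

lemma at_ideal_scalar3:
  "at_ideal J (free_const c * a * b * d) = scalar c * (at_ideal J a * at_ideal J b * at_ideal J d)"
  by (simp only: at_ideal_hom(3)[of J "free_const c * a * b" d] at_ideal_scalar)
      (simp only: mult.assoc)

lemma quantum_matrix_gen_family:
  assumes "q * p = 1"
  shows "quantum_matrix (scalar q) (scalar p) gen_family"
proof -
  have p: "unit_inv q = p"
    unfolding unit_inv_def using assms
        by (rule the_equality) (metis assms mult.commute mult.left_commute mult_1)
  have rel: "at_ideal (oq_ideal q) a = at_ideal (oq_ideal q) b" if "a - b \<in> oq_relators q" for a b
    by (rule at_ideal_eqI) (use that oq_relators_subset in blast)
  show ?thesis
  proof
    show "scalar q * scalar p = 1"
      by (simp add: assms rhomD[OF rhom_scalar] flip: rhomD(3)[OF rhom_scalar])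
    show "x * scalar q = scalar q * x" "x * scalar p = scalar p * x" for x
      by (rule centralD[OF central_scalar])+
    fix i j l m :: idx
    show "gen_family i j * gen_family l j = scalar p * (gen_family l j * gen_family i j)" if "l < i"
    proof -
      have "at_ideal (oq_ideal q) (free_gen i j * free_gen l j)
          = at_ideal (oq_ideal q) (free_const p * free_gen l j * free_gen i j)"
        by (rule rel) (use that in \<open>auto simp: oq_relators_def p\<close>)
      then show ?thesis by (simp add: gen_family_def scalar_def at_ideal_hom flip: mult.assoc)
    qed
    show "gen_family i j * gen_family i m = scalar p * (gen_family i m * gen_family i j)" if "m < j"
    proof -
      have "at_ideal (oq_ideal q) (free_gen i j * free_gen i m)
          = at_ideal (oq_ideal q) (free_const p * free_gen i m * free_gen i j)"
        by (rule rel) (use that in \<open>auto simp: oq_relators_def p\<close>)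
      then show ?thesis by (simp add: gen_family_def scalar_def at_ideal_hom flip: mult.assoc)
    qed
    show "gen_family i j * gen_family l m = gen_family l m * gen_family i j" if "l < i" "j < m"
    proof -
      have "at_ideal (oq_ideal q) (free_gen l m * free_gen i j)
          = at_ideal (oq_ideal q) (free_gen i j * free_gen l m)"
        by (rule rel) (use that in \<open>auto simp: oq_relators_def p\<close>)
      then show ?thesis by (simp add: gen_family_def at_ideal_hom)
    qed
    show "gen_family i j * gen_family l m = gen_family l m * gen_family i j
        - (scalar q - scalar p) * (gen_family l j * gen_family i m)"
      if "l < i" "m < j"
    proof -
      have "at_ideal (oq_ideal q) (free_gen i j * free_gen l m)
          = at_ideal (oq_ideal q) (free_gen l m * free_gen i j
              - free_const (q - p) * free_gen i m * free_gen l j)"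
        by (rule rel) (use that in \<open>auto simp: oq_relators_def p\<close>)
      \<comment> \<open>The relator has these two generators in the opposite order.\<close>
      moreover have "at_ideal (oq_ideal q) (free_gen l j * free_gen i m)
          = at_ideal (oq_ideal q) (free_gen i m * free_gen l j)"
        by (rule rel) (use that in \<open>auto simp: oq_relators_def p\<close>)
      ultimately show ?thesis
        by (simp only: gen_family_def at_ideal_scalar at_ideal_hom(2)
            at_ideal_hom(3)[of _ "free_gen a b" "free_gen c d"
                for a b c d] rhomD(5)[OF rhom_scalar])
    qed
  qed
qed

end

section \<open>The quantum determinant of the generators and the passage to the quotient\<close>

lemma bij_idx_iff:
  "bij s \<longleftrightarrow> s I1 \<noteq> s I2 \<and> s I1 \<noteq> s I3 \<and> s I2 \<noteq> s I3" for s :: "idx \<Rightarrow> idx"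
proof -
  have UNIV: "(UNIV :: idx set) = {I1, I2, I3}"
    using idx.exhaust by auto
  have "finite (UNIV :: idx set)" unfolding UNIV by simp
  then have "bij s \<longleftrightarrow> inj s"
    using finite_UNIV_inj_surj[of s] by (auto simp: bij_def)
  also have "\<dots> \<longleftrightarrow> s I1 \<noteq> s I2 \<and> s I1 \<noteq> s I3 \<and> s I2 \<noteq> s I3"
    unfolding UNIV by (auto simp: inj_on_def)
  finally show ?thesis .
qed

definition perm3 :: "idx \<Rightarrow> idx \<Rightarrow> idx \<Rightarrow> idx \<Rightarrow> idx" where
  "perm3 a b c i = (case i of I1 \<Rightarrow> a | I2 \<Rightarrow> b | I3 \<Rightarrow> c)"

lemma perm3_simps [simp]: "perm3 a b c I1 = a" "perm3 a b c I2 = b" "perm3 a b c I3 = c"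
  by (simp_all add: perm3_def)

lemma perm3_eq_iff: "perm3 a b c = perm3 a' b' c' \<longleftrightarrow> a = a' \<and> b = b' \<and> c = c'"
  by (metis perm3_simps)

lemma Collect_bij_idx:
  "{s. bij s} = {perm3 I1 I2 I3, perm3 I1 I3 I2, perm3 I2 I1 I3, perm3 I2 I3 I1, perm3 I3 I1 I2,
      perm3 I3 I2 I1}"
proof (rule Set.set_eqI)
  fix s :: "idx \<Rightarrow> idx"
  have "s i = perm3 (s I1) (s I2) (s I3) i" for i
    by (cases i) simp_all
  then obtain a b c where s: "s = perm3 a b c" by (metis ext)
  show "s \<in> {s. bij s} \<longleftrightarrow> s \<in> {perm3 I1 I2 I3, perm3 I1 I3 I2, perm3 I2 I1 I3, perm3 I2 I3 I1,
      perm3 I3 I1 I2, perm3 I3 I2 I1}"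
    unfolding s by (cases a; cases b; cases c) (simp_all add: bij_idx_iff perm3_eq_iff)
qed

lemma inversions_perm3:
  "inversions (perm3 a b c) = of_bool (b < a) + of_bool (c < a) + of_bool (c < b)"
proof -
  have "{(i, j). i < j \<and> perm3 a b c j < perm3 a b c i}
      = (if b < a then {(I1, I2)} else {}) \<union> (if c < a then {(I1, I3)} else {}) \<union> (if c < b
          then {(I2, I3)} else {})"
    by (auto elim!: idx_less_cases)
  then show ?thesis by (simp add: inversions_def card_insert_if)
qed

context
  fixes q p :: "'a::comm_ring_1"
  assumes qp: "q * p = 1"
begin

interpretation G: quantum_matrix "scalar q" "scalar p" "gen_family q"
  by (rule quantum_matrix_gen_family[OF qp])

text \<open>The relator orders monomials by columns and \<open>qdet\<close> by rows; straightening
  reconciles them. As the generators are zero in the other factors, the result is an idempotent in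
  place of 1.\<close>

lemma qdet_gen_family: "G.qdet = at_ideal (oq_ideal q) 1"
proof -
  let ?at = "at_ideal (oq_ideal q)"
  have "1 - (\<Sum>s | bij s. free_const ((- q) ^ inversions s) * free_gen (s I1) I1 * free_gen (s I2)
      I2 * free_gen (s I3) I3)
      \<in> oq_ideal q"
    using oq_relators_subset by (fastforce simp: oq_relators_def)
  then have "?at 1 = ?at (\<Sum>s | bij s. free_const ((- q) ^ inversions s) * free_gen (s I1) I1 *
      free_gen (s I2) I2 * free_gen (s I3) I3)"
    by (rule at_ideal_eqI)
  also have "\<dots> = scalar 1 * (gen_family q I1 I1 * gen_family q I2 I2 * gen_family q I3 I3)
      + (scalar (- q) * (gen_family q I1 I1 * gen_family q I3 I2 * gen_family q I2 I3)
      + (scalar (- q) * (gen_family q I2 I1 * gen_family q I1 I2 * gen_family q I3 I3)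
          + (scalar (q ^ 2) * (gen_family q I2 I1 * gen_family q I3 I2 * gen_family q I1 I3)
      + (scalar (q ^ 2) * (gen_family q I3 I1 * gen_family q I1 I2 * gen_family q I2 I3)
          + scalar (- (q ^ 3)) * (gen_family q I3 I1 * gen_family q I2 I2 * gen_family q I1 I3)))))"
    unfolding Collect_bij_idx
    by (simp add: perm3_eq_iff inversions_perm3 at_ideal_hom(1) at_ideal_scalar3 gen_family_def
        numeral_3_eq_3
        numeral_2_eq_2)
  also have "\<dots> = G.qdet"
  proof -
    have neg: "scalar (- b) = - scalar b" for b :: 'a
      using rhomD(5)[OF rhom_scalar, of 0 b] by (simp add: rhomD(4)[OF rhom_scalar])
    have c: "scalar 1 = 1" "scalar (- q) = - scalar q" "scalar (q ^ 2) = scalar q * scalar q"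
      "scalar (- (q ^ 3)) = - (scalar q * (scalar q * scalar q))"
      by (simp_all add: power2_eq_square power3_eq_cube mult.assoc neg rhomD(1,3)[OF rhom_scalar])
    show ?thesis
      unfolding c G.qdet_def by (simp add: G.straighten power2_eq_square power3_eq_cube)
  qed
  finally show ?thesis ..
qed

lemma oq_proj_unit: "oq_proj q (at_ideal (oq_ideal q) 1 * z) = oq_proj q z"
proof -
  interpret O: ring "Oq_SL3 q" by (rule ring_Oq_SL3)
  show ?thesis by (simp add: oq_proj_simps oq_class_hom)
qed

text \<open>The recurrences of \<open>psum1\<close> and \<open>psum2\<close> contain the idempotent
  \<open>G.qdet\<close> where those of \<open>power_sum_poly\<close> have 1. So both sides are
  compared after multiplication by it, which \<open>oq_proj\<close> turns into 1. For pairwise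
  products the roles of \<open>G.sigma1\<close> and \<open>G.sigma2\<close> are exchanged.\<close>

lemma oq_eval2_power_sum:
  "oq_eval2 q (power_sum_poly N) (oq_proj q G.sigma1) (oq_proj q G.sigma2)
     = oq_proj q (eval3 G.sigma1 G.sigma2 G.qdet (psum1 Z1 Z2 Z3 N))"
  "oq_eval2 q (power_sum_poly N) (oq_proj q G.sigma2) (oq_proj q G.sigma1)
     = oq_proj q (eval3 G.sigma1 G.sigma2 G.qdet (psum2 Z1 Z2 Z3 N))"
proof -
  interpret S: commuting_triple G.sigma1 G.sigma2 G.qdet
    by (rule G.commuting_triple_sigma)
  define e where "e = at_ideal (oq_ideal q) (1 :: 'a free_alg)"
  let ?ev = "eval3 G.sigma1 G.sigma2 G.qdet"
  have ee: "e * (e * z) = e * z" for z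
    by (simp add: e_def flip: at_ideal_hom(3) mult.assoc)
  have es: "e * (G.sigma1 * z) = G.sigma1 * (e * z)" "e * (G.sigma2 * z) = G.sigma2 * (e * z)" for z
    using S.s13 S.s23 by (simp_all add: qdet_gen_family e_def flip: mult.assoc)
  note ev = S.eval3_hom S.eval3_vars rhom_numeral[OF S.rhom_eval3]
  have poly: "rhom (peval scalar x)" "rhom (peval (peval scalar x) y)"
    "peval (peval scalar x) y [:[:0, 1:]:] = x" "peval (peval scalar x) y [:0, 1:] = y"
    if "x * y = y * x" for x y
  proof -
    show 1: "rhom (peval scalar x)"
      by (rule rhom_peval[OF rhom_scalar]) (rule centralD[OF central_scalar])
    show "rhom (peval (peval scalar x) y)"
      by (rule rhom_peval[OF 1]) (rule peval_commute[OF rhom_scalar centralD[OF central_scalar]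
          that[symmetric]])
    show "peval (peval scalar x) y [:[:0, 1:]:] = x" "peval (peval scalar x) y [:0, 1:] = y"
      by (simp_all add: peval_const peval_X 1 rhom_scalar)
  qed
  define E where "E = peval (peval scalar G.sigma1) G.sigma2"
  define F where "F = peval (peval scalar G.sigma2) G.sigma1"
  note E = rhomD[OF poly(2)[OF S.s12, folded E_def]] poly(3,4)[OF S.s12, folded E_def]
    rhom_numeral[OF poly(2)[OF S.s12, folded E_def]]
  note F = rhomD[OF poly(2)[OF S.s12[symmetric], folded F_def]] poly(3,4)[OF S.s12[symmetric],
      folded F_def]
    rhom_numeral[OF poly(2)[OF S.s12[symmetric], folded F_def]]
  have three: "[:[:3:]:] = (3 :: 'a poly poly)" by (simp add: numeral_poly)
  have 1: "e * E (power_sum_poly n) = e * ?ev (psum1 Z1 Z2 Z3 n)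
      \<and> e * E (power_sum_poly (n + 1)) = e * ?ev (psum1 Z1 Z2 Z3 (n + 1))
      \<and> e * E (power_sum_poly (n + 2)) = e * ?ev (psum1 Z1 Z2 Z3 (n + 2))" for n
  proof (induction n)
    case 0
    show ?case
      unfolding add_0_left power_sum_poly_rec(1-3) psum1_rec(1-3) three power2_eq_square
          by (simp only: E ev)
  next
    case (Suc n)
    have "e * E (power_sum_poly (n + 3)) = e * ?ev (psum1 Z1 Z2 Z3 (n + 3))"
      unfolding power_sum_poly_rec(4) psum1_rec(4) E ev
      using Suc by (simp add: distrib_left right_diff_distrib es qdet_gen_family ee flip: e_def)
    with Suc show ?case by (simp add: numeral_3_eq_3)
  qed
  have 2: "e * F (power_sum_poly n) = e * ?ev (psum2 Z1 Z2 Z3 n)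
      \<and> e * F (power_sum_poly (n + 1)) = e * ?ev (psum2 Z1 Z2 Z3 (n + 1))
      \<and> e * F (power_sum_poly (n + 2)) = e * ?ev (psum2 Z1 Z2 Z3 (n + 2))" for n
  proof (induction n)
    case 0
    have "e * (G.sigma1 * G.qdet) = e * G.sigma1"
      using ee[of 1] by (simp add: es(1) qdet_gen_family flip: e_def)
        (metis e_def mult_1_right qdet_gen_family S.s13)
    then show ?case
      unfolding add_0_left power_sum_poly_rec(1-3) psum2_rec(1-3) three power2_eq_square
      by (simp only: F ev right_diff_distrib mult_2 distrib_left)
  next
    case (Suc n)
    have "e * F (power_sum_poly (n + 3)) = e * ?ev (psum2 Z1 Z2 Z3 (n + 3))"
      unfolding power_sum_poly_rec(4) psum2_rec(4) F ev
      using Suc by (simp add: distrib_left right_diff_distrib es qdet_gen_family ee mult.assoc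
          flip: e_def)
    with Suc show ?case by (simp add: numeral_3_eq_3)
  qed
  show "oq_eval2 q (power_sum_poly N) (oq_proj q G.sigma1) (oq_proj q G.sigma2)
      = oq_proj q (?ev (psum1 Z1 Z2 Z3 N))"
    "oq_eval2 q (power_sum_poly N) (oq_proj q G.sigma2) (oq_proj q G.sigma1)
        = oq_proj q (?ev (psum2 Z1 Z2 Z3 N))"
    unfolding oq_eval2_proj E_def[symmetric] F_def[symmetric]
    using 1[of N] 2[of N] oq_proj_unit[folded e_def] by metis+
qed

lemma oq_proj_sigma: "oq_proj q G.sigma1 = oq_sigma1 q" "oq_proj q G.sigma2 = oq_sigma2 q"
proof -
  interpret O: ring "Oq_SL3 q" by (rule ring_Oq_SL3)
  have gen_family: "oq_proj q (gen_family q i j) = oq_gen q i j" for i j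
    by (simp add: gen_family_def oq_gen_def oq_proj_simps)
  then show "oq_proj q G.sigma1 = oq_sigma1 q"
    by (simp add: G.sigma1_def oq_sigma1_def oq_proj_simps)
  have scalar: "oq_proj q (scalar c) = oq_const q c" for c
    by (simp add: scalar_def oq_const_def oq_proj_simps)
  have minor: "oq_proj q (G.minor i j i j) = oq_minor2 q i j" for i j
    by (simp add: G.minor_def oq_minor2_def oq_proj_diff oq_proj_simps(3) gen_family scalar flip:
        mult.assoc)
  have "G.sigma2 = G.minor I1 I2 I1 I2 + G.minor I2 I3 I2 I3 + G.minor I1 I3 I1 I3"
    by (simp add: G.sigma2_def add_ac)
  then show "oq_proj q G.sigma2 = oq_sigma2 q"
    by (simp add: oq_sigma2_def oq_proj_simps(2) minor)
qed

end

theorem theorem1p1: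
  fixes q6 :: "'a::comm_ring_1" and N :: nat
    and q :: 'a and A (structure) and x :: "idx \<Rightarrow> idx \<Rightarrow> 'a free_alg set"
  assumes "q6 dvd 1"
    and "q = q6 ^ 6"
    and "A = Oq_SL3 q"
    and "x = oq_gen q"
    and "root_of_unity_of_order N (q6 ^ 2)"
    and "coprime N 6"
  shows "oq_eval2 q (power_sum_poly N) (oq_sigma1 q) (oq_sigma2 q) =
           x I1 I1 [^] N \<oplus> x I2 I2 [^] N \<oplus> x I3 I3 [^] N
       \<and> oq_eval2 q (power_sum_poly N) (oq_sigma2 q) (oq_sigma1 q) =
           x I1 I1 [^] N \<otimes> x I2 I2 [^] N
           \<oplus> x I1 I1 [^] N \<otimes> x I3 I3 [^] N
           \<oplus> x I2 I2 [^] N \<otimes> x I3 I3 [^] N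
           \<ominus> x I1 I2 [^] N \<otimes> x I2 I1 [^] N
           \<ominus> x I1 I3 [^] N \<otimes> x I3 I1 [^] N
           \<ominus> x I2 I3 [^] N \<otimes> x I3 I2 [^] N"
proof -
  have "q dvd 1" using dvd_power_same[OF assms(1), of 6] by (simp add: assms(2))
  then obtain p where qp: "q * p = 1" by (metis dvdE)
  interpret G: quantum_matrix "scalar q" "scalar p" "gen_family q"
    by (rule quantum_matrix_gen_family[OF qp])
  have N: "0 < N" and z: "(q6 ^ 2) ^ N = 1"
    using assms(5) by (simp_all add: root_of_unity_of_order_def)
  have "q = (q6 ^ 2) ^ 3" "q ^ 2 = (q6 ^ 2) ^ 6"
    by (simp_all add: assms(2) flip: power_mult)
  then have "q ^ N = 1"
    using z by (metis mult.commute power_mult power_one)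
  then have qN: "scalar q ^ N = 1"
    by (metis rhom_power[OF rhom_scalar] rhomD(1)[OF rhom_scalar])
  \<comment> \<open>The base \<open>q ^ 2\<close> is the sixth power of the given root of unity
    \<open>q6 ^ 2\<close>, and \<open>N\<close> is coprime to 6.\<close>
  have vanish: "qbinomial (scalar q ^ 2) N k = 0" if "0 < k" "k < N" for k
    using qbinomial_root_of_unity[OF assms(5,6) _ that] \<open>q ^ 2 = (q6 ^ 2) ^ 6\<close>
    by (metis rhom_power[OF rhom_scalar] rhom_qbinomial[OF rhom_scalar] rhomD(4)[OF rhom_scalar]
        zero_less_numeral)
  interpret P: quantum_matrix 1 1 "\<lambda>i j. gen_family q i j ^ N"
    by (rule G.quantum_matrix_power[OF qN])
  have gen_family: "oq_proj q (gen_family q i j ^ N) = x i j [^] N" for i j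
    by (simp add: oq_proj_power assms(3,4) gen_family_def oq_gen_def oq_proj_simps)
  have "P.sigma2 = gen_family q I1 I1 ^ N * gen_family q I2 I2 ^ N
      + gen_family q I1 I1 ^ N * gen_family q I3 I3 ^ N
      + gen_family q I2 I2 ^ N * gen_family q I3 I3 ^ N - gen_family q I1 I2 ^ N * gen_family q I2
          I1 ^ N
      - gen_family q I1 I3 ^ N * gen_family q I3 I1 ^ N - gen_family q I2 I3 ^ N * gen_family q I3
          I2 ^ N"
    by (simp add: P.sigma2_def P.minor_def)
  moreover have "P.sigma1 = gen_family q I1 I1 ^ N + gen_family q I2 I2 ^ N
      + gen_family q I3 I3 ^ N"
    by (rule P.sigma1_def)
  moreover have "oq_eval2 q (power_sum_poly N) (oq_sigma1 q) (oq_sigma2 q) = oq_proj q P.sigma1"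
    "oq_eval2 q (power_sum_poly N) (oq_sigma2 q) (oq_sigma1 q) = oq_proj q P.sigma2"
    unfolding oq_proj_sigma[OF qp, symmetric] oq_eval2_power_sum[OF qp]
    by (subst G.frobenius_trace[OF qN N]; use vanish in blast)+
  ultimately show ?thesis
    by (simp add: oq_proj_simps(2,3) oq_proj_diff gen_family flip: assms(3))
qed

end
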